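(* Let $\lambda>0$. The inequality $$\sin(\pi x)\,\big\{G_\lambda^+(x)-K_\lambda^+(x)\big\}\ge 0$$ holds for all real $x$. Moreover, for every entire function $K:\mathbb{C}\to\mathbb{C}$ of exponential type at most $\pi$ we have $$\int_{-\infty}^\infty \big|G_\lambda^+(x)-K(x)\big|\,dx\;\ge\;\frac{1}{\pi\lambda}\int_0^1\theta_1\big(0,\,i\lambda^{-1}(1-y^2)\big)\,dy,$$ with equality if and only if $K=K_\lambda^+$.
   Context: An entire function $K$ is of exponential type at most $2\pi\delta$ if for every $\epsilon>0$ there is $C_\epsilon>0$ with $|K(z)|\le C_\epsilon e^{(2\pi\delta+\epsilon)|z|}$ for all $z\in\mathbb{C}$. $G_\lambda(z)=e^{-\pi\lambda z^2}$. The truncated Gaussian is given on the real line by $G_\lambda^+(x)=e^{-\pi\lambda x^2}$ for $x>0$, $G_\lambda^+(0)=\tfrac12$, and $G_\lambda^+(x)=0$ for $x<0$. $K_\lambda^+$ is the entire function of exponential type $\pi$ that extends $$K_\lambda^+(z)=\frac{\sin\pi z}{\pi}\sum_{n=1}^\infty(-1)^n\left\{\frac{G_\lambda(n)}{z-n}-\frac{G_\lambda(n)}{z}\right\}$$ (the singularities at the integers are removable). For $\Im\tau>0$, with $q=e^{\pi i\tau}$ and $q^{a}=e^{\pi i\tau a}$, $\theta_1(z,\tau)=\sum_{n=-\infty}^\infty q^{(n+\frac12)^2}e^{(2n+1)\pi i z}$. *)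

theory Defs
  imports "HOL-Complex_Analysis.Complex_Analysis"
begin

definition exp_type_le :: "real \<Rightarrow> (complex \<Rightarrow> complex) \<Rightarrow> bool" where
  "exp_type_le \<sigma> K \<longleftrightarrow>
     (\<forall>\<epsilon>>0. \<exists>C>0. \<forall>z. norm (K z) \<le> C * exp ((\<sigma> + \<epsilon>) * norm z))"

definition gauss :: "real \<Rightarrow> complex \<Rightarrow> complex" where
  "gauss lam z = exp (- of_real (pi * lam) * z\<^sup>2)"

definition trunc_gauss :: "real \<Rightarrow> real \<Rightarrow> real" where
  "trunc_gauss lam x =
     (if x > 0 then exp (- pi * lam * x\<^sup>2) else if x = 0 then 1/2 else 0)"

definition gauss_interp_series :: "real \<Rightarrow> complex \<Rightarrow> complex" where
  "gauss_interp_series lam z =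
     sin (of_real pi * z) / of_real pi *
     (\<Sum>n. (-1) ^ Suc n * (gauss lam (of_nat (Suc n)) / (z - of_nat (Suc n))
                            - gauss lam (of_nat (Suc n)) / z))"

(* The summation index is shifted by one, so the sum runs over the positive integers.
   At an integer the series has junk values caused by division by zero;
   remove_sings replaces them by the limits there.  The lemmas gauss_interp_holomorphic,
   gauss_interp_exp_type and gauss_interp_eq_series below show that this is the entire
   extension of exponential type pi. *)
definition gauss_interp :: "real \<Rightarrow> complex \<Rightarrow> complex" where
  "gauss_interp lam = remove_sings (gauss_interp_series lam)"

(* With q = exp(pi i tau), the power q^a is understood as exp(pi i tau a); only
   meaningful for Im tau > 0, where the two-sided series converges absolutely. *)
definition theta1 :: "complex \<Rightarrow> complex \<Rightarrow> complex" where
  "theta1 z \<tau> = (\<Sum>\<^sub>\<infinity>n::int. exp (of_real pi * \<i> * \<tau> * (of_int n + 1/2)\<^sup>2)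
                            * exp ((2 * of_int n + 1) * of_real pi * \<i> * z))"

definition csinc :: "complex \<Rightarrow> complex" where
  "csinc z = (if z = 0 then 1 else sin (of_real pi * z) / (of_real pi * z))"

lemma csinc_holomorphic: "csinc holomorphic_on UNIV"
proof (rule pole_theorem_open_0)
  show "(\<lambda>z. sin (of_real pi * z) / of_real pi) holomorphic_on UNIV"
    by (intro holomorphic_intros) auto
  have "((\<lambda>z. sin (of_real pi * z) / of_real pi) has_field_derivative 1) (at (0::complex))"
    by (auto intro!: derivative_eq_intros)
  then show "csinc 0 = deriv (\<lambda>z. sin (of_real pi * z) / of_real pi) 0"
    by (simp add: DERIV_imp_deriv csinc_def)
qed (auto simp: csinc_def)

lemma csinc_bound:
  obtains C where "C > 0" "\<And>z. norm (csinc z) \<le> C * exp (pi * \<bar>Im z\<bar>)"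
proof -
  have "compact (csinc ` cball 0 1)"
    using csinc_holomorphic
    by (intro compact_continuous_image holomorphic_on_imp_continuous_on)
       (auto intro: holomorphic_on_subset)
  then have "bounded (csinc ` cball 0 1)" by (rule compact_imp_bounded)
  then obtain B where "\<forall>w\<in>csinc ` cball 0 1. norm w \<le> B" by (auto simp only: bounded_iff)
  then have B: "\<And>z. norm z \<le> 1 \<Longrightarrow> norm (csinc z) \<le> B" by simp
  show ?thesis
  proof
    show "max 1 B > 0" by simp
    fix z :: complex
    show "norm (csinc z) \<le> max 1 B * exp (pi * \<bar>Im z\<bar>)"
    proof (cases "norm z \<le> 1")
      case True
      have "max 1 B * 1 \<le> max 1 B * exp (pi * \<bar>Im z\<bar>)"
        by (intro mult_left_mono) auto
      then show ?thesis using B[OF True] by auto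
    next
      case False
      then have z: "z \<noteq> 0" "1 \<le> norm z" by auto
      have p: "1 \<le> pi * norm z"
        using mult_mono[of 1 pi 1 "norm z"] pi_gt3 z by simp
      have "norm (sin (of_real pi * z)) \<le> exp (pi * \<bar>Im z\<bar>)"
        using cmod_sin_le_exp[of 1 "of_real pi * z"] by (simp add: abs_mult)
      moreover have "norm (sin (of_real pi * z)) / (pi * norm z) \<le> norm (sin (of_real pi * z))"
        using p by (simp add: divide_le_eq mult_left_le_one_le mult_le_cancel_left1)
      ultimately have "norm (csinc z) \<le> 1 * exp (pi * \<bar>Im z\<bar>)"
        using z by (simp add: csinc_def norm_divide norm_mult)
      also have "\<dots> \<le> max 1 B * exp (pi * \<bar>Im z\<bar>)"
        by (intro mult_right_mono) auto
      finally show ?thesis .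
    qed
  qed
qed

lemma norm_gauss_le:
  assumes "lam > 0"
  shows "norm (gauss lam (of_nat (Suc n))) \<le> exp (- pi * lam) ^ n"
proof -
  have "real n \<le> real (Suc n) ^ 2"
    by (simp add: power2_eq_square algebra_simps)
  then have "pi * lam * real n \<le> pi * lam * real (Suc n) ^ 2"
    using assms by (intro mult_left_mono) auto
  moreover have "Re (- of_real (pi * lam) * (of_nat (Suc n))\<^sup>2) = - (pi * lam * real (Suc n) ^ 2)"
    by (metis Re_complex_of_real mult_minus_left of_real_minus of_real_mult of_real_of_nat_eq of_real_power)
  ultimately show ?thesis
    unfolding gauss_def norm_exp_eq_Re
    by (simp add: exp_of_nat_mult[symmetric] algebra_simps)
qed

lemma summable_norm_gauss:
  assumes "lam > 0"
  shows "summable (\<lambda>n. norm (gauss lam (of_nat (Suc n))))"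
proof (rule summable_comparison_test')
  show "summable (\<lambda>n. exp (- pi * lam) ^ n)"
    using assms by (intro summable_geometric) auto
  show "norm (norm (gauss lam (of_nat (Suc n)))) \<le> exp (- pi * lam) ^ n" for n
    using norm_gauss_le[OF assms, of n] by simp
qed

lemma sin_shift: "sin (of_real pi * (z - of_nat n)) = (-1) ^ n * sin (of_real pi * z :: complex)"
proof (induction n)
  case (Suc n)
  have "sin (of_real pi * (z - of_nat (Suc n))) = sin (of_real pi * (z - of_nat n) - of_real pi)"
    by (simp add: algebra_simps)
  also have "\<dots> = - sin (of_real pi * (z - of_nat n))"
    by (simp add: sin_diff flip: sin_of_real cos_of_real)
  finally show ?case using Suc by simp
qed simp

definition gauss_interp_entire :: "real \<Rightarrow> complex \<Rightarrow> complex" where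
  "gauss_interp_entire lam z =
     (\<Sum>n. gauss lam (of_nat (Suc n)) * (csinc (z - of_nat (Suc n)) - (-1) ^ Suc n * csinc z))"

lemma gauss_interp_term_bound:
  assumes C: "\<And>z. norm (csinc z) \<le> C * exp (pi * \<bar>Im z\<bar>)"
  shows "norm (gauss lam (of_nat (Suc n)) * (csinc (z - of_nat (Suc n)) - (-1) ^ Suc n * csinc z))
           \<le> norm (gauss lam (of_nat (Suc n))) * (2 * C * exp (pi * \<bar>Im z\<bar>))"
proof -
  have "norm (csinc (z - of_nat (Suc n)) - (-1) ^ Suc n * csinc z)
      \<le> norm (csinc (z - of_nat (Suc n))) + norm ((-1) ^ Suc n * csinc z)"
    by (rule norm_triangle_ineq4)
  also have "\<dots> \<le> 2 * C * exp (pi * \<bar>Im z\<bar>)"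
    using C[of z] C[of "z - of_nat (Suc n)"] by (simp add: norm_mult norm_power)
  finally show ?thesis
    by (simp add: norm_mult mult_left_mono)
qed

lemma gauss_interp_entire_holomorphic:
  assumes "lam > 0"
  shows "gauss_interp_entire lam holomorphic_on UNIV"
proof (rule holomorphic_uniform_sequence)
  let ?f = "\<lambda>n z. gauss lam (of_nat (Suc n)) * (csinc (z - of_nat (Suc n)) - (-1) ^ Suc n * csinc z)"
  obtain C where C: "C > 0" "\<And>z. norm (csinc z) \<le> C * exp (pi * \<bar>Im z\<bar>)"
    using csinc_bound by blast
  have *: "(\<lambda>z. csinc (z - of_nat (Suc n))) holomorphic_on UNIV" for n
    by (rule holomorphic_on_compose_gen[OF _ csinc_holomorphic, unfolded o_def])
       (auto intro!: holomorphic_intros)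
  show "(\<lambda>z. \<Sum>i<n. ?f i z) holomorphic_on UNIV" for n
    by (intro holomorphic_intros * csinc_holomorphic)
  fix x :: complex
  have "uniform_limit (cball x 1) (\<lambda>n z. \<Sum>i<n. ?f i z) (gauss_interp_entire lam) sequentially"
    unfolding gauss_interp_entire_def
  proof (rule Weierstrass_m_test)
    show "summable (\<lambda>n. norm (gauss lam (of_nat (Suc n))) * (2 * C * exp (pi * (norm x + 1))))"
      by (intro summable_mult2 summable_norm_gauss assms)
    fix n z assume "z \<in> cball x 1"
    then have "norm z \<le> norm x + 1"
      by (metis dist_commute dist_norm mem_cball norm_triangle_sub order_trans add_left_mono)
    then have "\<bar>Im z\<bar> \<le> norm x + 1"
      using abs_Im_le_cmod[of z] by linarith
    then have "norm (gauss lam (of_nat (Suc n))) * (2 * C * exp (pi * \<bar>Im z\<bar>))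
        \<le> norm (gauss lam (of_nat (Suc n))) * (2 * C * exp (pi * (norm x + 1)))"
      using C by (intro mult_left_mono) auto
    then show "norm (?f n z) \<le> norm (gauss lam (of_nat (Suc n))) * (2 * C * exp (pi * (norm x + 1)))"
      using gauss_interp_term_bound[OF C(2), of lam n z] by linarith
  qed
  then show "\<exists>d>0. cball x d \<subseteq> UNIV \<and>
      uniform_limit (cball x d) (\<lambda>n z. \<Sum>i<n. ?f i z) (gauss_interp_entire lam) sequentially"
    by (intro exI[of _ 1]) auto
qed auto

lemma gauss_interp_entire_exp_type:
  assumes "lam > 0"
  shows "exp_type_le pi (gauss_interp_entire lam)"
  unfolding exp_type_le_def
proof (intro allI impI)
  fix \<epsilon> :: real assume "\<epsilon> > 0"
  obtain C where C: "C > 0" "\<And>z. norm (csinc z) \<le> C * exp (pi * \<bar>Im z\<bar>)"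
    using csinc_bound by blast
  let ?A = "\<Sum>n. norm (gauss lam (of_nat (Suc n)))"
  have A: "?A \<ge> 0" by (intro suminf_nonneg summable_norm_gauss assms) auto
  have "norm (gauss_interp_entire lam z) \<le> ((?A + 1) * (2 * C)) * exp ((pi + \<epsilon>) * norm z)" for z
  proof -
    have S: "summable (\<lambda>n. norm (gauss lam (of_nat (Suc n))) * (2 * C * exp (pi * \<bar>Im z\<bar>)))"
      by (intro summable_mult2 summable_norm_gauss assms)
    have "norm (gauss_interp_entire lam z) \<le>
        (\<Sum>n. norm (gauss lam (of_nat (Suc n))) * (2 * C * exp (pi * \<bar>Im z\<bar>)))"
      unfolding gauss_interp_entire_def
      by (intro norm_suminf_le S gauss_interp_term_bound C(2))
    also have "\<dots> = ?A * (2 * C * exp (pi * \<bar>Im z\<bar>))"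
      by (intro suminf_mult2[symmetric] summable_norm_gauss assms)
    also have "\<dots> \<le> (?A + 1) * (2 * C * exp ((pi + \<epsilon>) * norm z))"
      using C A \<open>\<epsilon> > 0\<close> abs_Im_le_cmod[of z]
      by (intro mult_mono mult_left_mono) (auto intro!: mult_mono)
    finally show ?thesis by (simp add: mult.assoc)
  qed
  then show "\<exists>C>0. \<forall>z. norm (gauss_interp_entire lam z) \<le> C * exp ((pi + \<epsilon>) * norm z)"
    using A C by (intro exI[of _ "(?A + 1) * (2 * C)"]) auto
qed

lemma gauss_interp_series_eq_entire:
  assumes "lam > 0" "z \<notin> \<int>"
  shows "gauss_interp_series lam z = gauss_interp_entire lam z"
proof -
  let ?f = "\<lambda>n. gauss lam (of_nat (Suc n)) * (csinc (z - of_nat (Suc n)) - (-1) ^ Suc n * csinc z)"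
  let ?g = "\<lambda>n. (-1) ^ Suc n * (gauss lam (of_nat (Suc n)) / (z - of_nat (Suc n))
                            - gauss lam (of_nat (Suc n)) / z)"
  let ?s = "sin (of_real pi * z) / of_real pi"
  obtain C where C: "C > 0" "\<And>z. norm (csinc z) \<le> C * exp (pi * \<bar>Im z\<bar>)"
    using csinc_bound by blast
  have z: "z \<noteq> 0" "z \<noteq> of_nat n" for n
    using assms(2) by auto
  have s: "?s \<noteq> 0"
    using assms(2) by (auto simp: sin_eq_0 Ints_def)
  have fg: "?f n = ?s * ?g n" for n
  proof -
    have "csinc (z - of_nat (Suc n)) = (-1) ^ Suc n * ?s / (z - of_nat (Suc n))"
      using z(2)[of "Suc n"] sin_shift[of z "Suc n"] by (simp add: csinc_def)
    moreover have "csinc z = ?s / z" using z by (simp add: csinc_def)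
    ultimately show ?thesis by (simp add: diff_divide_distrib algebra_simps)
  qed
  have "summable ?f"
    by (rule summable_comparison_test'[OF _ gauss_interp_term_bound[OF C(2)]])
       (intro summable_mult2 summable_norm_gauss assms)
  then have "summable (\<lambda>n. ?s * ?g n)" by (simp only: fg)
  then have "summable ?g" using s by (subst (asm) summable_cmult_iff) blast
  then have "(\<Sum>n. ?s * ?g n) = ?s * (\<Sum>n. ?g n)" by (rule suminf_mult)
  then show ?thesis
    unfolding gauss_interp_series_def gauss_interp_entire_def by (simp only: fg)
qed

lemma gauss_interp_eq_entire:
  assumes "lam > 0"
  shows "gauss_interp lam = gauss_interp_entire lam"
proof
  fix z :: complex
  have "closed (of_int ` {n. of_int n \<noteq> z} :: complex set)" by (rule closed_of_int_image)
  moreover have "of_int ` {n. of_int n \<noteq> z} = \<int> - {z}" by (auto simp: Ints_def)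
  ultimately have "open (- (\<int> - {z}))" by (simp only: open_Compl)
  then have "eventually (\<lambda>w. w \<in> - (\<int> - {z})) (at z)"
    by (intro eventually_at_in_open') auto
  moreover have "eventually (\<lambda>w. w \<noteq> z) (at z)" by (simp add: eventually_neq_at_within)
  ultimately have ev: "eventually (\<lambda>w. gauss_interp_entire lam w = gauss_interp_series lam w) (at z)"
    by eventually_elim (use gauss_interp_series_eq_entire[OF assms] in auto)
  have "gauss_interp_entire lam \<midarrow>z\<rightarrow> gauss_interp_entire lam z"
    using holomorphic_on_imp_continuous_on[OF gauss_interp_entire_holomorphic[OF assms]]
    by (simp add: continuous_on_eq_continuous_at isCont_def)
  then have "gauss_interp_series lam \<midarrow>z\<rightarrow> gauss_interp_entire lam z"
    by (rule Lim_transform_eventually[OF _ ev])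
  then show "gauss_interp lam z = gauss_interp_entire lam z"
    unfolding gauss_interp_def by (rule remove_sings_eqI)
qed

lemma gauss_interp_holomorphic:
  assumes "lam > 0"
  shows "gauss_interp lam holomorphic_on UNIV"
  by (simp only: gauss_interp_eq_entire gauss_interp_entire_holomorphic assms)

lemma gauss_interp_exp_type:
  assumes "lam > 0"
  shows "exp_type_le pi (gauss_interp lam)"
  by (simp only: gauss_interp_eq_entire gauss_interp_entire_exp_type assms)

lemma gauss_interp_eq_series:
  assumes "lam > 0" "z \<notin> \<int>"
  shows "gauss_interp lam z = gauss_interp_series lam z"
  using gauss_interp_series_eq_entire[OF assms] gauss_interp_eq_entire[OF assms(1)] by metis

end

(* Write G(n) = q^(n^2) with q = exp(-pi lam), let K+ be the interpolant and F = pi (G+ - K+) / sin(pi x).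

   Sign. The Jacobi product shows that sum q^(n^2) z^n attains its minimum over |z| = 1 at z = -1, and
   the maximum principle for exp(-sum_{n>=1} q^(n^2) z^n) extends this to the radius [-1,0]:
   sum_{n>=1} (-1)^(n+1) q^(n^2) (1 - r^n) >= 0. For x < 0 this gives F >= 0 by integrating against
   t r^(t-1) dr with t = -x. For x > 0, exp(pi lam x^2) F is nondecreasing in lam, since its derivative
   is a positive multiple of sum (-1)^(n+1) q^(n^2) (n + n^2/x), and it has a nonnegative limit as
   lam -> 0 by the partial fractions of pi / sin(pi x).

   Minimality. A function J of type pi that is integrable on the line satisfies
   |J(z)| <= M exp(pi |Im z|) by Phragmen-Lindelof, so its Fourier transform vanishes at all
   frequencies w with |w| >= pi; as sgn sin(pi x) only has frequencies (2k+1) pi, it is orthogonal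
   to J. Hence the integral of |G+ - K| is at least that of G+ sgn sin(pi x), with equality for K+.
   Equality forces K to agree with G+ at the nonzero integers, so z (K - K+)(z) / sin(pi z) is entire of
   linear growth, hence affine, and integrability makes it vanish. *)

theory Submission
  imports Defs "HOL-Real_Asymp.Real_Asymp" "HOL-Probability.Sinc_Integral"
begin

section \<open>Extremal properties of the theta function\<close>

text \<open>The constant arises as follows. The square wave has the series (4/pi) sum sin((2k+1) pi
  x)/(2k+1), and the sine integral of the half-line Gaussian at frequency (2k+1) pi is a Dawson
  integral: (2k+1)/(2 lam) times the integral over [0,1] of exp(-pi (k+1/2)^2 (1-y^2)/lam). The
  factors 2k+1 cancel, and the sum over k under the integral is half of theta_1(0, i(1-y^2)/lam).
  For x < 0 each 1/(n - x) is a Laplace transform, so positivity can be integrated. For x > 0 the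
  denominators change sign at n = x, and an argument in lam takes its place. The lowest frequency pi
  of the square wave equals the type of J, so a contour shift has no exponential decay to spare
  there. Vanishing is proved above pi with a damping factor 1/(1 - i d z) and carried to pi by
  dominated convergence. K may be complex-valued on the line and G+ - K need not be integrable: the
  L1 norm is an extended nonnegative integral, and only Re (G+ - K) is paired with the square
  wave.\<close>

lemma summable_nat_power_times_power:
  fixes q :: real assumes "0 < q" "q < 1"
  shows "summable (\<lambda>n. real n ^ k * q ^ n)"
  using assms
proof (induction k arbitrary: q)
  case 0 then show ?case by simp
next
  case (Suc k)
  \<comment> \<open>Half of the geometric decay, y = sqrt q, absorbs one factor n; the other half
    feeds the induction, which is why q is generalized.\<close>
  define y where "y = sqrt q"
  have y: "0 < y" "y < 1" "y * y = q" using Suc.prems by (auto simp: y_def)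
  have "(\<lambda>n. real n * y ^ n) \<longlonglongrightarrow> 0" using y powser_times_n_limit_0[of y] by simp
  then have "Bseq (\<lambda>n. real n * y ^ n)" using convergentI convergent_imp_Bseq by blast
  then obtain B where B: "\<And>n. norm (real n * y ^ n) \<le> B" by (auto simp: Bseq_def)
  show ?case
  proof (rule summable_comparison_test')
    show "summable (\<lambda>n. B * (real n ^ k * y ^ n))" using Suc.IH[OF y(1,2)] by (rule summable_mult)
    fix n
    have "real n ^ Suc k * q ^ n = (real n * y ^ n) * (real n ^ k * y ^ n)"
      by (simp add: y(3)[symmetric] power_mult_distrib)
    also have "norm \<dots> \<le> B * (real n ^ k * y ^ n)"
      using B[of n] y by (subst norm_mult) (simp add: mult_right_mono)
    finally show "norm (real n ^ Suc k * q ^ n) \<le> B * (real n ^ k * y ^ n)" .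
  qed
qed

section \<open>Finite form of the Jacobi triple product\<close>

definition jacobi_poly :: "complex \<Rightarrow> nat \<Rightarrow> complex poly" where
  "jacobi_poly a N = (\<Prod>k<N. [:1, a ^ (2*k+1):] * [:a ^ (2*k+1), 1:])"

text \<open>\<open>jacobi_poly a N\<close> is z^N times the truncated triple product of (1 +
  a^(2k+1) z)(1 + a^(2k+1)/z), so the coefficient of z^(N+n) belongs to the power z^n. Passing from
  z to a^2 z shifts every factor to its neighbour, so only factors at the ends of the product
  survive; they are written here without denominators.\<close>

lemma jacobi_poly_functional:
  "(a * z + a ^ (2*N)) * poly (jacobi_poly a N) (a\<^sup>2 * z) = a ^ (2*N) * (1 + z * a ^ (2*N+1)) * poly (jacobi_poly a N) z"
proof (induction N)
  case 0 then show ?case by (simp add: jacobi_poly_def algebra_simps)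
next
  case (Suc N)
  define P where "P = poly (jacobi_poly a N)"
  have S: "poly (jacobi_poly a (Suc N)) w = P w * (1 + w * a ^ (2*N+1)) * (w + a ^ (2*N+1))" for w
    by (simp add: jacobi_poly_def P_def algebra_simps)
  have e: "a\<^sup>2 * z + a ^ (2*N+1) = a * (a * z + a ^ (2*N))"
    by (simp add: algebra_simps power2_eq_square)
  have "(a * z + a ^ (2 * Suc N)) * poly (jacobi_poly a (Suc N)) (a\<^sup>2 * z)
      = a * (a * z + a ^ (2 * Suc N)) * (1 + a\<^sup>2 * z * a ^ (2*N+1)) * ((a * z + a ^ (2*N)) * P (a\<^sup>2 * z))"
    unfolding S e by (simp add: mult_ac)
  also have "\<dots> = a * (a * z + a ^ (2 * Suc N)) * (1 + a\<^sup>2 * z * a ^ (2*N+1)) *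
       (a ^ (2*N) * (1 + z * a ^ (2*N+1)) * P z)"
    using Suc.IH by (simp only: P_def)
  also have "\<dots> = a ^ (2 * Suc N) * (1 + z * a ^ (2 * Suc N + 1)) * poly (jacobi_poly a (Suc N)) z"
    unfolding S by (simp add: algebra_simps power2_eq_square)
  finally show ?case .
qed

text \<open>Comparison of the coefficients of z^(i+1) in the functional equation gives a two-term
  recurrence, from which the coefficients above the central one follow.\<close>

lemma jacobi_poly_coeff_rec:
  "a ^ (2*i+1) * coeff (jacobi_poly a N) i + a ^ (2*N+2*i+2) * coeff (jacobi_poly a N) (Suc i) =
   a ^ (2*N) * coeff (jacobi_poly a N) (Suc i) + a ^ (4*N+1) * coeff (jacobi_poly a N) i"
proof -
  let ?R = "jacobi_poly a N"
  have "[:a ^ (2*N), a:] * pcompose ?R [:0, a\<^sup>2:] = [:a ^ (2*N), a ^ (4*N+1):] * ?R" (is "?L = ?P")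
  proof -
    have "poly ?L z = poly ?P z" for z
      using jacobi_poly_functional[of a z N]
      by (simp add: poly_pcompose algebra_simps flip: power_add)
    then show ?thesis by (metis poly_eq_poly_eq_iff ext)
  qed
  then have "coeff ?L (Suc i) = coeff ?P (Suc i)" by simp
  then show ?thesis
    by (simp add: coeff_pcompose_linear mult_ac flip: power_mult) (simp add: algebra_simps power_add power2_eq_square)
qed

text \<open>Reversal exchanges the two linear factors for each k: the polynomial form of the
  invariance of the triple product under z -> 1/z.\<close>

lemma jacobi_poly_reflect:
  assumes "a \<noteq> 0" shows "reflect_poly (jacobi_poly a N) = jacobi_poly a N"
proof -
  have "reflect_poly [:1, a ^ (2*k+1):] = [:a ^ (2*k+1), 1:]"
       "reflect_poly [:a ^ (2*k+1), 1:] = [:1, a ^ (2*k+1):]" for k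
    using assms by (simp_all add: reflect_poly_def cCons_def)
  then show ?thesis
    unfolding jacobi_poly_def by (simp add: reflect_poly_prod reflect_poly_mult mult.commute del: mult_pCons_left mult_pCons_right)
qed

lemma degree_jacobi_poly:
  assumes "a \<noteq> 0" shows "degree (jacobi_poly a N) = 2 * N"
proof -
  have "degree ([:1, a ^ (2*k+1):] * [:a ^ (2*k+1), 1:]) = 2" for k
    using assms by (subst degree_mult_eq) auto
  moreover have "[:1, a ^ (2*k+1):] * [:a ^ (2*k+1), 1:] \<noteq> 0" for k
    by (metis mult_eq_0_iff one_neq_zero pCons_eq_0_iff)
  ultimately show ?thesis
    unfolding jacobi_poly_def by (subst degree_prod_sum_eq) (simp_all del: mult_pCons_left mult_pCons_right)
qed

lemma jacobi_poly_coeff_sym: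
  assumes "a \<noteq> 0" "n \<le> N" shows "coeff (jacobi_poly a N) (N - n) = coeff (jacobi_poly a N) (N + n)"
proof -
  have "coeff (jacobi_poly a N) (N - n) = coeff (reflect_poly (jacobi_poly a N)) (N - n)"
    using jacobi_poly_reflect[OF assms(1)] by simp
  then show ?thesis using assms by (simp add: coeff_reflect_poly degree_jacobi_poly)
qed

text \<open>The coefficient at N + n divided by the central one. In closed form it is q^(n^2) times
  the quotient of Gaussian binomials [2N, N+n] / [2N, N] in base q^2. The numerator vanishes at n =
  N, so the sequence is zero from N + 1 on.\<close>

fun jacobi_coeff :: "real \<Rightarrow> nat \<Rightarrow> nat \<Rightarrow> real" where
  "jacobi_coeff q N 0 = 1"
| "jacobi_coeff q N (Suc n) = jacobi_coeff q N n * ((q ^ (2*n+1) - q ^ (2*N+1)) / (1 - q ^ (2*(N+n+1))))"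

context
  fixes q :: real assumes q: "0 < q" "q < 1"
begin

lemma q_power_less_one: "0 < m \<Longrightarrow> q ^ m < 1"
  using q by (simp add: power_less_one_iff)

lemma jacobi_poly_coeff: "coeff (jacobi_poly (of_real q) N) (N + n) = coeff (jacobi_poly (of_real q) N) N * of_real (jacobi_coeff q N n)"
proof (induction n)
  case (Suc n)
  let ?a = "of_real q :: complex" and ?c = "coeff (jacobi_poly (of_real q) N)"
  have "?a ^ (2*N) * (?c (N + Suc n) * of_real (1 - q ^ (2*(N+n+1))))
      = ?a ^ (2*N) * (?c (N + n) * of_real (q ^ (2*n+1) - q ^ (2*N+1)))"
  proof -
    define p where "p = ?a ^ N"
    define s where "s = ?a ^ n"
    have "?a ^ (2*(N+n)+1) = p * p * s * s * ?a" "?a ^ (2*N+2*(N+n)+2) = p * p * p * p * s * s * ?a * ?a"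
        "?a ^ (2*N) = p * p" "?a ^ (4*N+1) = p * p * p * p * ?a"
        "?a ^ (2*(N+n+1)) = p * p * s * s * ?a * ?a" "?a ^ (2*n+1) = s * s * ?a" "?a ^ (2*N+1) = p * p * ?a"
      unfolding p_def s_def power_add[symmetric] power_Suc2[symmetric] by (rule arg_cong[of _ _ "(^) ?a"], simp)+
    then show ?thesis
      using jacobi_poly_coeff_rec[of ?a "N+n" N]
      by (simp only: of_real_diff of_real_power of_real_1 add_Suc_right Nat.add_0_right) (simp add: algebra_simps)
  qed
  then have "?c (N + Suc n) * of_real (1 - q ^ (2*(N+n+1))) = ?c (N + n) * of_real (q ^ (2*n+1) - q ^ (2*N+1))"
    using q by simp
  moreover have "1 - q ^ (2*(N+n+1)) \<noteq> 0" using q_power_less_one[of "2*(N+n+1)"] by simp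
  ultimately have "?c (N + Suc n) = ?c (N + n) * of_real ((q ^ (2*n+1) - q ^ (2*N+1)) / (1 - q ^ (2*(N+n+1))))"
    unfolding of_real_divide by (metis nonzero_eq_divide_eq of_real_eq_0_iff times_divide_eq_right)
  then show ?case using Suc by (simp del: of_real_diff)
qed simp

text \<open>For n < N each ratio lies between 0 and q^(2n+1), and the odd exponents 1, 3, 5, ... add
  up to n^2. The bound is uniform in N, which makes it the majorant in the passage to the
  limit.\<close>

lemma jacobi_coeff_bounds: "0 \<le> jacobi_coeff q N n" "jacobi_coeff q N n \<le> q ^ n\<^sup>2"
proof -
  have "n > N \<Longrightarrow> jacobi_coeff q N n = 0" for n
    by (induction n) (auto simp: less_Suc_eq)
  moreover have "n \<le> N \<Longrightarrow> 0 \<le> jacobi_coeff q N n \<and> jacobi_coeff q N n \<le> q ^ n\<^sup>2" for n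
  proof (induction n)
    case (Suc n)
    let ?r = "(q ^ (2*n+1) - q ^ (2*N+1)) / (1 - q ^ (2*(N+n+1)))"
    have d: "1 - q ^ (2*(N+n+1)) > 0" using q_power_less_one[of "2*(N+n+1)"] by simp
    have "q ^ (2*N+1) \<le> q ^ (2*n+1)" using q Suc.prems by (intro power_decreasing) auto
    then have r0: "0 \<le> ?r" using d by simp
    have "q ^ (2*n+1 + 2*(N+n+1)) \<le> q ^ (2*N+1)" using q by (intro power_decreasing) auto
    then have "?r \<le> q ^ (2*n+1)" unfolding power_add[of q "2*n+1" "2*(N+n+1)"]
      by (subst pos_divide_le_eq[OF d]) (simp only: right_diff_distrib mult_1_right diff_left_mono)
    then have "jacobi_coeff q N n * ?r \<le> q ^ n\<^sup>2 * q ^ (2*n+1)"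
      using Suc r0 q by (intro mult_mono) auto
    also have "\<dots> = q ^ (Suc n)\<^sup>2" by (simp add: power2_eq_square flip: power_add)
       (simp add: algebra_simps mult_2_right)
    finally show ?case using mult_nonneg_nonneg[OF _ r0] Suc by simp
  qed simp
  ultimately show "0 \<le> jacobi_coeff q N n" "jacobi_coeff q N n \<le> q ^ n\<^sup>2" using q
    by (metis linorder_not_le order_refl zero_le_power less_imp_le)+
qed

lemma jacobi_coeff_limit: "(\<lambda>N. jacobi_coeff q N n) \<longlonglongrightarrow> q ^ n\<^sup>2"
proof (induction n)
  case (Suc n)
  have "(\<lambda>N. q ^ N) \<longlonglongrightarrow> 0" using q by (intro LIMSEQ_power_zero) auto
  moreover have "filterlim (\<lambda>N. 2*(N+n+1)) sequentially sequentially" "filterlim (\<lambda>N. 2*N+1) sequentially sequentially"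
    by (rule filterlim_subseq, simp add: strict_mono_def)+
  ultimately have "(\<lambda>N. q ^ (2*(N+n+1))) \<longlonglongrightarrow> 0" "(\<lambda>N. q ^ (2*N+1)) \<longlonglongrightarrow> 0"
    using filterlim_compose[of "\<lambda>N. q ^ N" "nhds 0" sequentially] by blast+
  then have "(\<lambda>N. jacobi_coeff q N n * ((q ^ (2*n+1) - q ^ (2*N+1)) / (1 - q ^ (2*(N+n+1))))) \<longlonglongrightarrow> q ^ n\<^sup>2 * ((q ^ (2*n+1) - 0)/(1 - 0))"
    by (intro tendsto_intros Suc) auto
  moreover have "q ^ n\<^sup>2 * ((q ^ (2*n+1) - 0)/(1 - 0)) = q ^ (Suc n)\<^sup>2" by (simp add: power2_eq_square flip: power_add)
       (simp add: algebra_simps mult_2_right)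
  ultimately show ?case by simp
qed simp

text \<open>On the unit circle z + a^(2k+1) is z times the conjugate of 1 + z a^(2k+1). Hence the
  polynomial divided by z^N is a product of squared moduli on one side and, by the symmetry of the
  coefficients, a cosine sum on the other.\<close>

lemma jacobi_poly_poly_circle:
  assumes "norm z = 1"
  shows "(\<Prod>k<N. (norm (1 + z * of_real q ^ (2*k+1)))\<^sup>2) =
     Re (coeff (jacobi_poly (of_real q) N) N) * (1 + 2 * (\<Sum>n<N. jacobi_coeff q N (Suc n) * Re (z ^ Suc n)))"
proof -
  let ?a = "of_real q :: complex" and ?c = "coeff (jacobi_poly (of_real q) N)"
  have z: "z * cnj z = 1" "z \<noteq> 0" using assms by (auto simp: complex_norm_square[symmetric])
  have *: "(1 + z * ?a ^ (2*k+1)) * (z + ?a ^ (2*k+1)) = z * of_real ((norm (1 + z * of_real q ^ (2*k+1)))\<^sup>2)" for k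
  proof -
    have "z + ?a ^ (2*k+1) = z * cnj (1 + z * ?a ^ (2*k+1))"
      using z by (simp add: algebra_simps)
    then show ?thesis by (simp only: complex_norm_square mult_ac)
  qed
  have "poly (jacobi_poly ?a N) z = (\<Prod>k<N. (1 + z * ?a ^ (2*k+1)) * (z + ?a ^ (2*k+1)))"
    unfolding jacobi_poly_def poly_prod by (intro prod.cong refl) (simp add: algebra_simps)
  also have "\<dots> = (\<Prod>k<N. z * of_real ((norm (1 + z * of_real q ^ (2*k+1)))\<^sup>2))"
    by (intro prod.cong refl *)
  also have "\<dots> = z ^ N * of_real (\<Prod>k<N. (norm (1 + z * of_real q ^ (2*k+1)))\<^sup>2)"
    by (simp add: prod.distrib)
  finally have 1: "poly (jacobi_poly ?a N) z = z ^ N * of_real (\<Prod>k<N. (norm (1 + z * of_real q ^ (2*k+1)))\<^sup>2)" .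
  have "poly (jacobi_poly ?a N) z = (\<Sum>i\<le>2*N. ?c i * z ^ i)"
    using q by (simp add: poly_altdef degree_jacobi_poly)
  also have "{..2*N} = {..<N} \<union> {N} \<union> {N<..2*N}" by auto
  also have "(\<Sum>i\<in>{..<N} \<union> {N} \<union> {N<..2*N}. ?c i * z ^ i) =
     (\<Sum>i<N. ?c i * z ^ i) + ?c N * z ^ N + (\<Sum>i\<in>{N<..2*N}. ?c i * z ^ i)"
    by (subst sum.union_disjoint; auto)+
  also have "(\<Sum>i<N. ?c i * z ^ i) = (\<Sum>n<N. ?c (N - Suc n) * z ^ (N - Suc n))"
    by (rule sum.nat_diff_reindex[symmetric])
  also have "\<dots> = (\<Sum>n<N. z ^ N * (?c (N + Suc n) * cnj z ^ Suc n))"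
  proof (intro sum.cong refl)
    fix n assume n: "n \<in> {..<N}"
    have "z ^ N * cnj z ^ Suc n = z ^ (N - Suc n) * (z * cnj z) ^ Suc n"
    proof -
      have "z ^ N = z ^ (N - Suc n) * z ^ Suc n" using n by (simp flip: power_add del: power_Suc)
      then show ?thesis by (simp only: power_mult_distrib mult.assoc)
    qed
    then have "z ^ N * cnj z ^ Suc n = z ^ (N - Suc n)" using z by simp
    then show "?c (N - Suc n) * z ^ (N - Suc n) = z ^ N * (?c (N + Suc n) * cnj z ^ Suc n)"
      using jacobi_poly_coeff_sym[of ?a "Suc n" N] q n by (simp del: power_Suc add: mult.left_commute)
  qed
  also have "(\<Sum>i\<in>{N<..2*N}. ?c i * z ^ i) = (\<Sum>n<N. z ^ N * (?c (N + Suc n) * z ^ Suc n))"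
    by (rule sum.reindex_bij_witness[of _ "\<lambda>n. N + Suc n" "\<lambda>i. i - Suc N"]) (auto simp flip: power_add power_Suc)
  finally have "poly (jacobi_poly ?a N) z = z ^ N * (?c N + (\<Sum>n<N. ?c (N + Suc n) * (z ^ Suc n + cnj z ^ Suc n)))"
    by (simp add: sum_distrib_left sum.distrib algebra_simps del: power_Suc)
  also have "(\<Sum>n<N. ?c (N + Suc n) * (z ^ Suc n + cnj z ^ Suc n))
     = ?c N * (\<Sum>n<N. of_real (2 * (jacobi_coeff q N (Suc n) * Re (z ^ Suc n))))"
    unfolding sum_distrib_left jacobi_poly_coeff
    by (intro sum.cong refl) (simp add: complex_add_cnj complex_cnj_power[symmetric] del: power_Suc complex_cnj_power jacobi_coeff.simps)
  finally have 2: "poly (jacobi_poly ?a N) z = z ^ N * (?c N * of_real (1 + 2 * (\<Sum>n<N. jacobi_coeff q N (Suc n) * Re (z ^ Suc n))))"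
    by (simp add: algebra_simps sum_distrib_left del: power_Suc jacobi_coeff.simps)
  from 1 2 z have "of_real (\<Prod>k<N. (norm (1 + z * of_real q ^ (2*k+1)))\<^sup>2) =
     ?c N * of_real (1 + 2 * (\<Sum>n<N. jacobi_coeff q N (Suc n) * Re (z ^ Suc n)))" by simp
  then have "Re (of_real (\<Prod>k<N. (norm (1 + z * of_real q ^ (2*k+1)))\<^sup>2)) =
     Re (?c N * of_real (1 + 2 * (\<Sum>n<N. jacobi_coeff q N (Suc n) * Re (z ^ Suc n))))" by (rule arg_cong)
  then show ?thesis by (simp only: Re_complex_of_real times_complex.sel Im_complex_of_real mult_zero_right diff_zero)
qed

text \<open>The product form is minimal factor by factor: |1 + z q^(2k+1)| >= 1 - q^(2k+1), with
  equality for z = -1. Dividing by the central coefficient transfers this to the sums, and the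
  product at -1 is a product of squares.\<close>

lemma jacobi_coeff_circle_min:
  assumes "norm z = 1"
  shows "(\<Sum>n<N. jacobi_coeff q N (Suc n) * Re (z ^ Suc n)) \<ge> (\<Sum>n<N. jacobi_coeff q N (Suc n) * Re ((-1) ^ Suc n))"
    and "1 + 2 * (\<Sum>n<N. jacobi_coeff q N (Suc n) * Re ((-1) ^ Suc n)) \<ge> 0"
proof -
  let ?c = "Re (coeff (jacobi_poly (of_real q) N) N)"
  let ?S = "\<lambda>z. \<Sum>n<N. jacobi_coeff q N (Suc n) * Re (z ^ Suc n)"
  let ?P = "\<lambda>z::complex. \<Prod>k<N. (norm (1 + z * of_real q ^ (2*k+1)))\<^sup>2"
  have eq: "?P z = ?c * (1 + 2 * ?S z)" if "norm z = 1" for z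
    using jacobi_poly_poly_circle[OF that] .
  \<comment> \<open>Positivity of the central coefficient is read off at z = 1, where both the
    product and the factor 1 + 2 S are positive.\<close>
  have "?P 1 > 0"
  proof (intro prod_pos)
    fix k
    have "1 + 1 * of_real q ^ (2*k+1) = (of_real (1 + q ^ (2*k+1)) :: complex)" by simp
    then show "(norm (1 + 1 * of_real q ^ (2*k+1) :: complex))\<^sup>2 > 0"
      using q by (metis abs_of_pos add_pos_pos norm_of_real zero_less_one zero_less_power)
  qed
  moreover have "?S 1 \<ge> 0" using jacobi_coeff_bounds by (intro sum_nonneg) (simp del: jacobi_coeff.simps)
  ultimately have c: "?c > 0" using eq[of 1] by (simp add: zero_less_mult_iff del: jacobi_coeff.simps)
  have "?P (-1) \<le> ?P z"
  proof (intro prod_mono conjI)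
    fix k
    have e: "q ^ (2*k+1) < 1" using q_power_less_one[of "2*k+1"] by simp
    have "norm (1 + (-1) * of_real q ^ (2*k+1) :: complex) = \<bar>1 - q ^ (2*k+1)\<bar>"
    proof -
      have "1 + (-1) * of_real q ^ (2*k+1) = (of_real (1 - q ^ (2*k+1)) :: complex)" by simp
      then show ?thesis by (simp only: norm_of_real)
    qed
    also have "\<dots> = 1 - norm (z * of_real q ^ (2*k+1))"
      using e q assms by (simp add: norm_mult norm_power)
    also have "\<dots> \<le> norm (1 + z * of_real q ^ (2*k+1))"
      by (metis norm_diff_ineq norm_one)
    finally show "(norm (1 + (-1) * of_real q ^ (2*k+1) :: complex))\<^sup>2 \<le> (norm (1 + z * of_real q ^ (2*k+1)))\<^sup>2"
      by (intro power_mono) auto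
  qed auto
  then have "?c * (1 + 2 * ?S (-1)) \<le> ?c * (1 + 2 * ?S z)"
    using eq[OF assms] eq[of "-1"] by simp
  then show "?S z \<ge> ?S (-1)" using c by (simp del: jacobi_coeff.simps power_Suc)
  have "?P (-1) \<ge> 0" by (intro prod_nonneg) auto
  then show "1 + 2 * ?S (-1) \<ge> 0" using c eq[of "-1"] by (simp add: zero_le_mult_iff del: jacobi_coeff.simps power_Suc)
qed

section \<open>Inequalities for the theta series\<close>

lemma q_square_summable: "summable (\<lambda>n. real n ^ k * q ^ n\<^sup>2)"
proof (rule summable_comparison_test')
  show "summable (\<lambda>n. real n ^ k * q ^ n)"
    using q by (rule summable_nat_power_times_power)
  show "norm (real n ^ k * q ^ n\<^sup>2) \<le> real n ^ k * q ^ n" for n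
  proof -
    have "n \<le> n\<^sup>2" by (simp add: power2_eq_square)
    then have "q ^ n\<^sup>2 \<le> q ^ n" using q by (intro power_decreasing) auto
    then show ?thesis
      using q by (simp add: abs_mult mult_left_mono)
  qed
qed

lemma summable_theta_Suc: "summable (\<lambda>n. real (Suc n) ^ k * q ^ (Suc n)\<^sup>2)"
  using q_square_summable[of k] by (subst summable_Suc_iff)

lemma summable_theta:
  fixes c :: "nat \<Rightarrow> 'a :: {banach, real_normed_algebra_1}"
  assumes "\<And>n. norm (c n) \<le> B * real (Suc n) ^ k"
  shows "summable (\<lambda>n. of_real (q ^ (Suc n)\<^sup>2) * c n)"
proof (rule summable_comparison_test')
  show "summable (\<lambda>n. B * (real (Suc n) ^ k * q ^ (Suc n)\<^sup>2))"
    by (rule summable_mult[OF summable_theta_Suc])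
  have "norm (of_real (q ^ (Suc n)\<^sup>2) * c n) \<le> q ^ (Suc n)\<^sup>2 * (B * real (Suc n) ^ k)" for n
    by (rule order_trans[OF norm_mult_ineq mult_mono]) (use q assms in \<open>auto simp del: of_nat_Suc of_real_power\<close>)
  then show "norm (of_real (q ^ (Suc n)\<^sup>2) * c n) \<le> B * (real (Suc n) ^ k * q ^ (Suc n)\<^sup>2)" for n
    by (simp only: mult_ac)
qed

lemma theta_truncation_limit:
  assumes "norm z = 1"
  shows "(\<lambda>N. \<Sum>n<N. jacobi_coeff q N (Suc n) * Re (z ^ Suc n)) \<longlonglongrightarrow> (\<Sum>n. q ^ (Suc n)\<^sup>2 * Re (z ^ Suc n))"
proof -
  \<comment> \<open>The truncated sums are extended by zero to full series, so that Tannery's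
    theorem applies with majorant q^((n+1)^2).\<close>
  let ?a = "\<lambda>n N. if n < N then jacobi_coeff q N (Suc n) * Re (z ^ Suc n) else 0"
  have R: "\<bar>Re (z ^ n)\<bar> \<le> 1" for n
    using abs_Re_le_cmod[of "z ^ n"] assms by (simp only: norm_power power_one)
  have "(\<lambda>N. \<Sum>n. ?a n N) \<longlonglongrightarrow> (\<Sum>n. q ^ (Suc n)\<^sup>2 * Re (z ^ Suc n))"
  proof (rule tannerys_theorem[THEN conjunct2, THEN conjunct2])
    fix n
    have "(\<lambda>N. jacobi_coeff q N (Suc n) * Re (z ^ Suc n)) \<longlonglongrightarrow> q ^ (Suc n)\<^sup>2 * Re (z ^ Suc n)"
      by (intro tendsto_intros jacobi_coeff_limit)
    moreover have "eventually (\<lambda>N. jacobi_coeff q N (Suc n) * Re (z ^ Suc n) = ?a n N) sequentially"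
      using eventually_gt_at_top[of n] by eventually_elim simp
    ultimately show "(\<lambda>N. ?a n N) \<longlonglongrightarrow> q ^ (Suc n)\<^sup>2 * Re (z ^ Suc n)"
      by (rule Lim_transform_eventually)
  next
    have "norm (?a n N) \<le> q ^ (Suc n)\<^sup>2" for n N
    proof -
      have "\<bar>jacobi_coeff q N (Suc n)\<bar> * \<bar>Re (z ^ Suc n)\<bar> \<le> q ^ (Suc n)\<^sup>2 * 1"
        using jacobi_coeff_bounds[of N "Suc n"] R by (intro mult_mono) (simp_all del: jacobi_coeff.simps power_Suc)
      then show ?thesis using q by (simp add: abs_mult del: jacobi_coeff.simps power_Suc)
    qed
    then show "eventually (\<lambda>(n,N). norm (?a n N) \<le> q ^ (Suc n)\<^sup>2) (at_top \<times>\<^sub>F sequentially)"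
      by (intro always_eventually) (simp only: split_paired_All prod.case HOL.simp_thms)
    show "summable (\<lambda>n. q ^ (Suc n)\<^sup>2)" using summable_theta_Suc[of 0] by simp
  qed auto
  moreover have "(\<Sum>n. ?a n N) = (\<Sum>n<N. jacobi_coeff q N (Suc n) * Re (z ^ Suc n))" for N
    by (subst suminf_finite[of "{..<N}"]) auto
  ultimately show ?thesis by (simp only:)
qed

lemma theta_circle_min:
  assumes "norm z = 1"
  shows "(\<Sum>n. q ^ (Suc n)\<^sup>2 * (-1) ^ Suc n) \<le> (\<Sum>n. q ^ (Suc n)\<^sup>2 * Re (z ^ Suc n))"
proof -
  have "(\<Sum>n. q ^ (Suc n)\<^sup>2 * Re ((-1) ^ Suc n)) \<le> (\<Sum>n. q ^ (Suc n)\<^sup>2 * Re (z ^ Suc n))"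
    using jacobi_coeff_circle_min(1)[OF assms]
    by (intro LIMSEQ_le[OF theta_truncation_limit theta_truncation_limit] assms) auto
  moreover have "Re ((-1) ^ n) = (-1) ^ n" for n
    by (induction n) auto
  ultimately show ?thesis by (simp only:)
qed

text \<open>This is theta_4(0) >= 0 for the nome q, as a limit of products of squares divided by
  positive central coefficients. It later controls the terms -1/x of the interpolation kernel at the
  cost of 1/(2x).\<close>

lemma theta4_nonneg: "0 \<le> 1 + 2 * (\<Sum>n. q ^ (Suc n)\<^sup>2 * (-1) ^ Suc n)"
proof -
  have "0 \<le> 1 + 2 * (\<Sum>n. q ^ (Suc n)\<^sup>2 * Re ((-1) ^ Suc n))"
    using jacobi_coeff_circle_min(2)[of 1]
    by (intro tendsto_lowerbound[OF tendsto_add[OF tendsto_const tendsto_mult[OF tendsto_const theta_truncation_limit]]]) auto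
  moreover have "Re ((-1) ^ n) = (-1) ^ n" for n
    by (induction n) auto
  ultimately show ?thesis by (simp only:)
qed

lemma theta_disc_min:
  assumes r: "0 \<le> r" "r \<le> 1"
  shows "0 \<le> (\<Sum>n. q ^ (Suc n)\<^sup>2 * ((-1) ^ n * (1 - r ^ Suc n)))"
proof -
  define f where "f z = (\<Sum>n. of_real (q ^ (Suc n)\<^sup>2) * z ^ Suc n)" for z :: complex
  define m where "m = (\<Sum>n. q ^ (Suc n)\<^sup>2 * (-1) ^ Suc n)"
  have sm: "summable (\<lambda>n. of_real (q ^ (Suc n)\<^sup>2) * z ^ Suc n)" if "norm z \<le> 1" for z :: complex
    using that by (intro summable_theta[where B=1 and k=0]) (auto simp: norm_power power_le_one simp del: power_Suc)
  have ul: "uniform_limit (cball 0 1) (\<lambda>N z. \<Sum>n<N. of_real (q ^ (Suc n)\<^sup>2) * z ^ Suc n) f sequentially"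
    unfolding f_def
  proof (rule Weierstrass_m_test)
    show "summable (\<lambda>n. q ^ (Suc n)\<^sup>2)" using summable_theta_Suc[of 0] by simp
    fix n and z :: complex assume "z \<in> cball 0 1"
    then have "norm (z ^ Suc n) \<le> 1" by (auto simp: norm_power power_le_one simp del: power_Suc)
    then show "norm (of_real (q ^ (Suc n)\<^sup>2) * z ^ Suc n) \<le> q ^ (Suc n)\<^sup>2"
      using q by (simp add: norm_mult norm_power mult_left_le del: power_Suc)
  qed
  have cont: "continuous_on (cball 0 1) f"
    by (rule uniform_limit_theorem[OF _ ul]) (auto intro!: always_eventually continuous_intros)
  have hol: "f holomorphic_on ball 0 1"
    by (rule holomorphic_uniform_limit[OF _ ul])
       (auto intro!: always_eventually continuous_intros holomorphic_intros)
  have Ref: "Re (f z) = (\<Sum>n. q ^ (Suc n)\<^sup>2 * Re (z ^ Suc n))" if "norm z \<le> 1" for z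
    unfolding f_def by (subst Re_suminf[OF sm[OF that]]) simp
  have "norm (exp (- f (- of_real r))) \<le> exp (- m)"
  proof (rule maximum_modulus_frontier[of "\<lambda>z. exp (- f z)" "cball 0 1"])
    show "(\<lambda>z. exp (- f z)) holomorphic_on interior (cball 0 1)"
      using hol by (auto intro!: holomorphic_intros)
    show "continuous_on (closure (cball 0 1)) (\<lambda>z. exp (- f z))"
      using cont by (auto intro!: continuous_intros)
    fix z :: complex assume "z \<in> frontier (cball 0 1)"
    then have "norm z = 1" by auto
    then show "norm (exp (- f z)) \<le> exp (- m)"
      using theta_circle_min[of z] Ref[of z] by (simp add: m_def del: power_Suc)
  qed (use r in auto)
  then have "m \<le> (\<Sum>n. q ^ (Suc n)\<^sup>2 * Re ((- of_real r) ^ Suc n))"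
    using Ref[of "- of_real r"] r by (simp del: power_Suc)
  moreover have "Re ((- of_real r) ^ n) = (-r) ^ n" for n
    by (metis Re_complex_of_real of_real_minus of_real_power)
  ultimately have le: "m \<le> (\<Sum>n. q ^ (Suc n)\<^sup>2 * (- r) ^ Suc n)" by (simp only:)
  have s: "summable (\<lambda>n. q ^ (Suc n)\<^sup>2 * (- r) ^ Suc n)" if "0 \<le> r" "r \<le> 1" for r
    using summable_theta[of "\<lambda>n. (-r) ^ Suc n" 1 0] that
    by (simp add: power_abs power_le_one mult_le_one abs_mult)
  have "(\<Sum>n. q ^ (Suc n)\<^sup>2 * (- r) ^ Suc n) - m =
     (\<Sum>n. q ^ (Suc n)\<^sup>2 * (- r) ^ Suc n - q ^ (Suc n)\<^sup>2 * (- 1) ^ Suc n)"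
    unfolding m_def using s[OF r] s[of 1] by (intro suminf_diff) auto
  also have "\<dots> = (\<Sum>n. q ^ (Suc n)\<^sup>2 * ((-1) ^ n * (1 - r ^ Suc n)))"
    by (intro suminf_cong) (simp add: power_minus[of r] algebra_simps)
  finally show ?thesis using le by linarith
qed

lemma geometric_sum_le:
  fixes r :: real
  assumes "0 < r \<and> r < 1"
  shows "norm (\<Sum>i<n. r ^ i) \<le> real n"
proof -
  have "norm (\<Sum>i<n. r ^ i) \<le> (\<Sum>i<n. 1)"
    using assms by (intro sum_norm_le) (simp add: power_le_one)
  then show ?thesis by simp
qed

text \<open>The inequality of \<open>theta_disc_min\<close> is an equality at r = 1; dividing by 1 -
  r leaves geometric sums, and the limit r -> 1 gives the one-sided derivative there.\<close>

lemma theta_alternating_nonneg: "0 \<le> (\<Sum>n. q ^ (Suc n)\<^sup>2 * ((-1) ^ n * real (Suc n)))"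
proof -
  let ?a = "\<lambda>n r. q ^ (Suc n)\<^sup>2 * ((-1) ^ n * (\<Sum>i<Suc n. r ^ i))"
  have ev: "eventually (\<lambda>r::real. 0 < r \<and> r < 1) (at_left 1)"
    using eventually_at_left_real[of 0 1] by (auto elim: eventually_mono)
  have "((\<lambda>r. \<Sum>n. ?a n r) \<longlongrightarrow> (\<Sum>n. q ^ (Suc n)\<^sup>2 * ((-1) ^ n * real (Suc n)))) (at_left 1)"
  proof (rule tannerys_theorem[THEN conjunct2, THEN conjunct2])
    fix n
    have "((\<lambda>r. ?a n r) \<longlongrightarrow> q ^ (Suc n)\<^sup>2 * ((-1) ^ n * (\<Sum>i<Suc n. 1 ^ i))) (at_left 1)"
      by (intro tendsto_intros)
    then show "((\<lambda>r. ?a n r) \<longlongrightarrow> q ^ (Suc n)\<^sup>2 * ((-1) ^ n * real (Suc n))) (at_left 1)"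
      by (simp only: power_one sum_constant card_lessThan mult_1_right)
  next
    have "norm (?a n r) \<le> real (Suc n) ^ 1 * q ^ (Suc n)\<^sup>2" if "0 < r \<and> r < 1" for n r
    proof -
      have "q ^ (Suc n)\<^sup>2 * norm (\<Sum>i<Suc n. r ^ i) \<le> q ^ (Suc n)\<^sup>2 * real (Suc n)"
        using q by (intro mult_left_mono geometric_sum_le that) auto
      then show ?thesis using q by (simp add: abs_mult mult.commute del: sum.lessThan_Suc power_Suc)
    qed
    then show "eventually (\<lambda>(n,r). norm (?a n r) \<le> real (Suc n) ^ 1 * q ^ (Suc n)\<^sup>2) (at_top \<times>\<^sub>F at_left 1)"
      unfolding eventually_prod_filter by (intro exI[of _ "\<lambda>_. True"] exI[of _ "\<lambda>r. 0 < r \<and> r < 1"] conjI ev) auto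
    show "summable (\<lambda>n. real (Suc n) ^ 1 * q ^ (Suc n)\<^sup>2)" by (rule summable_theta_Suc)
  qed auto
  moreover have "eventually (\<lambda>r. 0 \<le> (\<Sum>n. ?a n r)) (at_left 1)"
    using ev
  proof eventually_elim
    case (elim r)
    have e: "1 - r ^ Suc n = (1 - r) * (\<Sum>i<Suc n. r ^ i)" for n
      by (rule one_diff_power_eq)
    have "(\<Sum>n. q ^ (Suc n)\<^sup>2 * ((-1) ^ n * (1 - r ^ Suc n))) = (\<Sum>n. (1 - r) * ?a n r)"
      unfolding e by (simp only: mult_ac)
    also have "\<dots> = (1 - r) * (\<Sum>n. ?a n r)"
    proof (rule suminf_mult)
      have "norm ((-1) ^ n * (\<Sum>i<Suc n. r ^ i)) \<le> 1 * real (Suc n) ^ 1" for n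
        using geometric_sum_le[of r "Suc n"] elim by (simp add: abs_mult del: sum.lessThan_Suc)
      from summable_theta[OF this]
      show "summable (\<lambda>n. ?a n r)" by (simp only: of_real_eq_id id_def)
    qed
    finally show ?case using theta_disc_min[of r] elim by (simp add: zero_le_mult_iff)
  qed
  ultimately show ?thesis by (rule tendsto_lowerbound) auto
qed

text \<open>The second derivative test at the minimum z = -1 of the theta series on the circle. With
  z = -cis(2t) the excess over the minimum is a series in sin^2((n+1)t), so division by 2t^2 and t
  -> 0 replace a second derivative of the series.\<close>

lemma theta_alternating_square_nonneg: "0 \<le> (\<Sum>n. q ^ (Suc n)\<^sup>2 * ((-1) ^ n * (real (Suc n))\<^sup>2))"
proof -
  let ?a = "\<lambda>n t. q ^ (Suc n)\<^sup>2 * ((-1) ^ n * (sin (real (Suc n) * t) / t)\<^sup>2)"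
  have bound: "norm ((sin (real (Suc n) * t) / t)\<^sup>2) \<le> (real (Suc n))\<^sup>2" for n t
  proof -
    have "\<bar>sin (real (Suc n) * t) / t\<bar> \<le> real (Suc n)"
      using abs_sin_x_le_abs_x[of "real (Suc n) * t"] by (cases "t = 0") (auto simp: abs_mult divide_le_eq)
    then show ?thesis by (simp only: real_norm_def abs_power2 abs_le_square_iff[symmetric] abs_of_nat)
  qed
  have lim: "(\<lambda>t. \<Sum>n. ?a n t) \<midarrow>0\<rightarrow> (\<Sum>n. q ^ (Suc n)\<^sup>2 * ((-1) ^ n * (real (Suc n))\<^sup>2))"
  proof (rule tannerys_theorem[THEN conjunct2, THEN conjunct2])
    fix n
    have "((\<lambda>t. sin (real (Suc n) * t)) has_field_derivative real (Suc n)) (at 0)"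
      by (auto intro!: derivative_eq_intros)
    then have "(\<lambda>t. sin (real (Suc n) * t) / t) \<midarrow>0\<rightarrow> real (Suc n)"
      unfolding DERIV_def by simp
    then show "?a n \<midarrow>0\<rightarrow> q ^ (Suc n)\<^sup>2 * ((-1) ^ n * (real (Suc n))\<^sup>2)"
      by (intro tendsto_intros)
  next
    have "norm (?a n t) \<le> (real (Suc n))\<^sup>2 * q ^ (Suc n)\<^sup>2" for n t
      using mult_left_mono[OF bound[of n t], of "q ^ (Suc n)\<^sup>2"] q
      by (simp add: abs_mult mult.commute del: of_nat_Suc power_Suc)
    then show "eventually (\<lambda>(n,t). norm (?a n t) \<le> (real (Suc n))\<^sup>2 * q ^ (Suc n)\<^sup>2) (at_top \<times>\<^sub>F at 0)"
      by (intro always_eventually) (simp only: split_paired_All prod.case HOL.simp_thms)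
    show "summable (\<lambda>n. (real (Suc n))\<^sup>2 * q ^ (Suc n)\<^sup>2)" by (rule summable_theta_Suc)
  qed auto
  have "0 \<le> (\<Sum>n. ?a n t)" if "t \<noteq> 0" for t
  proof -
    have sa: "summable (\<lambda>n. ?a n t)"
      using summable_theta[of "\<lambda>n. (-1) ^ n * (sin (real (Suc n) * t) / t)\<^sup>2" 1 2] bound[of _ t]
      by (simp add: abs_mult del: of_nat_Suc power_Suc)
    define z where "z = - cis (2 * t)"
    have Rez: "Re (z ^ Suc n) = (-1) ^ Suc n * (1 - 2 * (sin (real (Suc n) * t))\<^sup>2)" for n
    proof -
      have "z ^ Suc n = of_real ((-1) ^ Suc n) * cis (real (Suc n) * (2 * t))"
        unfolding z_def power_minus[of "cis (2 * t)"] by (simp add: Complex.DeMoivre del: power_Suc of_nat_Suc)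
      then have "Re (z ^ Suc n) = (-1) ^ Suc n * cos (real (Suc n) * (2 * t))"
        by (simp only: times_complex.sel Re_complex_of_real Im_complex_of_real cis.sel mult_zero_left diff_zero)
      also have "cos (real (Suc n) * (2 * t)) = 1 - 2 * (sin (real (Suc n) * t))\<^sup>2"
        using cos_double_sin[of "real (Suc n) * t"] by (simp only: mult_ac)
      finally show ?thesis .
    qed
    have "summable (\<lambda>n. q ^ (Suc n)\<^sup>2 * Re (z ^ Suc n))"
      using summable_theta[of "\<lambda>n. Re (z ^ Suc n)" 1 0] abs_Re_le_cmod[of "z ^ Suc _"]
      by (simp add: norm_power z_def norm_mult del: power_Suc)
    moreover have "summable (\<lambda>n. q ^ (Suc n)\<^sup>2 * (-1) ^ Suc n)"
      using summable_theta[of "\<lambda>n. (-1::real) ^ Suc n" 1 0] by simp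
    ultimately have "(\<Sum>n. q ^ (Suc n)\<^sup>2 * Re (z ^ Suc n)) - (\<Sum>n. q ^ (Suc n)\<^sup>2 * (-1) ^ Suc n)
       = (\<Sum>n. q ^ (Suc n)\<^sup>2 * Re (z ^ Suc n) - q ^ (Suc n)\<^sup>2 * (-1) ^ Suc n)"
      by (rule suminf_diff)
    also have "\<dots> = (\<Sum>n. (2 * t\<^sup>2) * ?a n t)"
      unfolding Rez using that by (intro suminf_cong) (simp add: power_divide field_simps del: of_nat_Suc)
    also have "\<dots> = (2 * t\<^sup>2) * (\<Sum>n. ?a n t)"
      using sa by (rule suminf_mult)
    finally have "0 \<le> (2 * t\<^sup>2) * (\<Sum>n. ?a n t)"
      using theta_circle_min[of z] by (simp add: z_def del: power_Suc)
    then show ?thesis using that by (simp add: zero_le_mult_iff)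
  qed
  then have "eventually (\<lambda>t. 0 \<le> (\<Sum>n. ?a n t)) (at 0)" by (auto simp: eventually_at_filter)
  with lim show ?thesis by (rule tendsto_lowerbound) auto
qed

end

section \<open>Partial fractions\<close>

text \<open>Termwise differentiation under a summable majorant, combined with the mean value
  theorem. It serves two variables: the exponent u in r = exp(-u) for negative x, and the Gaussian
  parameter for positive x.\<close>

lemma suminf_mono_interval:
  fixes f f' :: "nat \<Rightarrow> real \<Rightarrow> real"
  assumes "a \<le> b"
    and deriv: "\<And>n x. x \<in> {a..b} \<Longrightarrow> (f n has_real_derivative f' n x) (at x within {a..b})"
    and bound: "\<And>n x. x \<in> {a..b} \<Longrightarrow> norm (f' n x) \<le> M n" and M: "summable M"
    and sum: "summable (\<lambda>n. f n a)"
    and nonneg: "\<And>x. x \<in> {a..b} \<Longrightarrow> 0 \<le> (\<Sum>n. f' n x)"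
  shows "(\<Sum>n. f n a) \<le> (\<Sum>n. f n b)"
proof -
  have "uniform_limit {a..b} (\<lambda>n x. \<Sum>i<n. f' i x) (\<lambda>x. \<Sum>i. f' i x) sequentially"
    by (rule Weierstrass_m_test[OF bound M])
  from has_field_derivative_series[OF convex_real_interval(5) deriv this _ sum] \<open>a \<le> b\<close>
  obtain g where g: "\<And>x. x \<in> {a..b} \<Longrightarrow> (\<lambda>n. f n x) sums g x"
    "\<And>x. x \<in> {a..b} \<Longrightarrow> (g has_real_derivative (\<Sum>n. f' n x)) (at x within {a..b})"
    by (metis atLeastAtMost_iff order_refl)
  have "g a \<le> g b"
  proof (rule DERIV_nonneg_imp_increasing_open[OF \<open>a \<le> b\<close>])
    show "continuous_on {a..b} g" using g(2) by (rule DERIV_continuous_on)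
    fix x assume "a < x" "x < b"
    then show "\<exists>y. (g has_real_derivative y) (at x) \<and> 0 \<le> y"
      using g(2)[of x] nonneg[of x] by (intro exI[of _ "\<Sum>n. f' n x"]) (auto simp: at_within_Icc_at)
  qed
  then show ?thesis using g(1) \<open>a \<le> b\<close> by (auto simp: sums_iff)
qed

text \<open>Logarithmic differentiation of the reflection formula for Gamma gives Digamma(1-z) -
  Digamma(z) = pi cot(pi z). Both Digamma values are limits of ln m minus a harmonic-type sum, and
  the logarithms cancel; this fixes the pairing of the pole at -n with the pole at n+1.\<close>

lemma pi_cot_partial_fractions:
  fixes z :: complex
  assumes "z \<notin> \<int>"
  shows "(\<lambda>m. \<Sum>n<m. 1 / (z + of_nat n) + 1 / (z - of_nat (Suc n))) \<longlonglongrightarrow> pi * cot (pi * z)"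
proof -
  have nz: "z + of_nat n \<noteq> 0" "1 - z + of_nat n \<noteq> 0" "z - of_nat n \<noteq> 0" for n
    using assms by (auto simp: add_eq_0_iff2 algebra_simps minus_equation_iff[of z])
  have s: "sin (of_real pi * z) \<noteq> 0"
    using assms by (auto simp: sin_eq_0 Ints_def)
  have zi: "z \<notin> \<int>\<^sub>\<le>\<^sub>0" "1 - z \<notin> \<int>\<^sub>\<le>\<^sub>0" using assms
    by (auto dest: nonpos_Ints_Int)
  have op: "open (- \<int> :: complex set)" by (simp add: open_Compl closed_Ints)
  have "((\<lambda>z. Gamma z * Gamma (1 - z) * sin (of_real pi * z)) has_field_derivative
     (Gamma z * Gamma (1 - z) * (sin (of_real pi * z) * (Digamma z - Digamma (1 - z)) + pi * cos (of_real pi * z)))) (at z)"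
    using zi by (auto intro!: derivative_eq_intros simp: algebra_simps)
  \<comment> \<open>Off the integers this product is locally the constant pi.\<close>
  moreover have "((\<lambda>z. Gamma z * Gamma (1 - z) * sin (of_real pi * z)) has_field_derivative 0) (at z)"
  proof (rule DERIV_cong_ev[OF refl _ refl, THEN iffD2])
    show "eventually (\<lambda>z. Gamma z * Gamma (1 - z) * sin (of_real pi * z) = of_real pi) (nhds z)"
    proof (rule eventually_mono[OF eventually_nhds_in_open[OF op]])
      fix w :: complex assume "w \<in> - \<int>"
      then have "sin (of_real pi * w) \<noteq> 0" by (auto simp: sin_eq_0 Ints_def)
      then show "Gamma w * Gamma (1 - w) * sin (of_real pi * w) = of_real pi"
        by (simp add: Gamma_reflection_complex)
    qed (use assms in auto)
  qed auto
  ultimately have "Gamma z * Gamma (1 - z) * (sin (of_real pi * z) * (Digamma z - Digamma (1 - z)) + pi * cos (of_real pi * z)) = 0"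
    by (rule DERIV_unique)
  then have "Digamma (1 - z) - Digamma z = pi * cot (pi * z)"
  proof -
    assume *: "Gamma z * Gamma (1 - z) * (sin (of_real pi * z) * (Digamma z - Digamma (1 - z)) + pi * cos (of_real pi * z)) = 0"
    have "Gamma z * Gamma (1 - z) \<noteq> 0" using zi by (simp add: Gamma_eq_zero_iff)
    then have "sin (of_real pi * z) * (Digamma z - Digamma (1 - z)) + pi * cos (of_real pi * z) = 0"
      using * by simp
    then have "sin (of_real pi * z) * (Digamma (1 - z) - Digamma z) = pi * cos (of_real pi * z)"
      by (simp add: algebra_simps)
    then show ?thesis using s by (simp add: cot_def field_simps)
  qed
  moreover have "(\<lambda>m. (of_real (ln (real m)) - (\<Sum>n<m. inverse ((1 - z) + of_nat n))) -
      (of_real (ln (real m)) - (\<Sum>n<m. inverse (z + of_nat n)))) \<longlonglongrightarrow> Digamma (1 - z) - Digamma z"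
    by (intro tendsto_diff Digamma_LIMSEQ) (use nz[of 0] in auto)
  moreover have "(of_real (ln (real m)) - (\<Sum>n<m. inverse ((1 - z) + of_nat n))) -
      (of_real (ln (real m)) - (\<Sum>n<m. inverse (z + of_nat n))) = (\<Sum>n<m. 1 / (z + of_nat n) + 1 / (z - of_nat (Suc n)))" for m
  proof -
    have "1 / (z - of_nat (Suc n)) = - inverse ((1 - z) + of_nat n)" for n
      by (metis (no_types, opaque_lifting) add.commute add_diff_eq diff_add_eq_diff_diff_swap inverse_eq_divide minus_diff_eq inverse_minus_eq of_nat_Suc)
    then show ?thesis by (simp add: inverse_eq_divide sum.distrib sum_negf sum_subtractf)
  qed
  ultimately show ?thesis by simp
qed

text \<open>By cot w - cot(w + pi/2) = 2/sin(2w) with w = pi x/2, the left side is pi/2 times a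
  difference of cotangents belonging to x/2 and (x+1)/2. These contribute the even and the odd
  poles, so m terms of each give 2m alternating terms on either side.\<close>

lemma pi_csc_partial_fractions:
  fixes x :: real
  assumes "x \<notin> \<int>"
  shows "(\<lambda>m. (\<Sum>j<2*m. (-1) ^ j / (x + real j)) + (\<Sum>j<2*m. (-1) ^ Suc j / (x - real (Suc j))))
      \<longlonglongrightarrow> pi / sin (pi * x)"
proof -
  let ?z = "complex_of_real x"
  let ?C = "\<lambda>w m. \<Sum>n<m. 1 / (w + of_nat n) + 1 / (w - of_nat (Suc n))"
  let ?R = "\<lambda>m. (\<Sum>j<2*m. (-1) ^ j / (x + real j)) + (\<Sum>j<2*m. (-1) ^ Suc j / (x - real (Suc j)))"
  have z: "?z / 2 \<notin> \<int>" "(?z + 1) / 2 \<notin> \<int>"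
  proof -
    have "2 * (?z/2) \<notin> \<int>" "2 * ((?z+1)/2) - 1 \<notin> \<int>"
    proof -
      have "2 * ((?z+1)/2) - 1 = ?z" by (simp add: field_simps)
      then show "2 * (?z/2) \<notin> \<int>" "2 * ((?z+1)/2) - 1 \<notin> \<int>" using assms by (simp, metis of_real_in_Ints_iff)
    qed
    then show "?z / 2 \<notin> \<int>" "(?z + 1) / 2 \<notin> \<int>"
      by (meson Ints_1 Ints_diff Ints_mult Ints_numeral)+
  qed
  have s: "sin (of_real pi * (?z/2)) \<noteq> 0" "sin (of_real pi * ((?z+1)/2)) \<noteq> 0"
    using z unfolding sin_eq_0 by (auto simp: Ints_def)
  have "(\<lambda>m. (?C (?z/2) m -
             ?C ((?z+1)/2) m) / 2) \<longlonglongrightarrow>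
       (pi * cot (pi * (?z/2)) - pi * cot (pi * ((?z+1)/2))) / 2"
    by (intro tendsto_intros pi_cot_partial_fractions z) simp_all
  moreover have "(pi * cot (pi * (?z/2)) - pi * cot (pi * ((?z+1)/2))) / 2 = of_real (pi / sin (pi * x))"
  proof -
    define w where "w = of_real pi * (?z/2)"
    have w2: "of_real pi * ((?z+1)/2) = w + of_real pi / 2" by (simp add: w_def field_simps)
    have sw: "sin w \<noteq> 0" "cos w \<noteq> 0" using s(1) s(2) unfolding w2
      by (auto simp: w_def sin_add simp flip: sin_of_real cos_of_real of_real_divide)
    have c: "cot (w + of_real pi / 2) = - sin w / cos w"
      unfolding cot_def by (simp add: sin_add cos_add flip: sin_of_real cos_of_real of_real_divide)
    have "of_real (sin (pi * x)) = 2 * sin w * cos w"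
      by (simp add: w_def sin_double[symmetric] flip: sin_of_real)
    moreover have "of_real pi * (cos w * cos w) + of_real pi * (sin w * sin w) = of_real pi"
      by (metis distrib_left mult.right_neutral power2_eq_square sin_cos_squared_add2)
    ultimately show ?thesis using sw unfolding w2 w_def[symmetric] c
      by (simp add: cot_def field_simps power2_eq_square)
  qed
  moreover have "(?C (?z/2) m -
             ?C ((?z+1)/2) m) / 2
      = of_real (?R m)" for m
  proof (induction m)
    case (Suc m)
    let ?c = "2 / (?z + of_nat (2*m)) + 2 / (?z - of_nat (2*m+2)) - (2 / (?z + of_nat (2*m+1)) + 2 / (?z - of_nat (2*m+1)))"
    let ?r = "1 / (x + real (2*m)) + 1 / (x - real (2*m+2)) - (1 / (x + real (2*m+1)) + 1 / (x - real (2*m+1)))"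
    have 1: "1 / (?z/2 + of_nat m) = 2 / (?z + of_nat (2*m))"
      "1 / (?z/2 - of_nat (Suc m)) = 2 / (?z - of_nat (2*m+2))"
      "1 / ((?z+1)/2 + of_nat m) = 2 / (?z + of_nat (2*m+1))"
      "1 / ((?z+1)/2 - of_nat (Suc m)) = 2 / (?z - of_nat (2*m+1))"
    proof -
      have d: "1 / (w / 2) = 2 / w" for w :: complex by simp
      have "?z/2 + of_nat m = (?z + of_nat (2*m)) / 2" "?z/2 - of_nat (Suc m) = (?z - of_nat (2*m+2)) / 2"
        "(?z+1)/2 + of_nat m = (?z + of_nat (2*m+1)) / 2" "(?z+1)/2 - of_nat (Suc m) = (?z - of_nat (2*m+1)) / 2"
        by (simp_all add: field_simps)
      then show "1 / (?z/2 + of_nat m) = 2 / (?z + of_nat (2*m))"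
        "1 / (?z/2 - of_nat (Suc m)) = 2 / (?z - of_nat (2*m+2))"
        "1 / ((?z+1)/2 + of_nat m) = 2 / (?z + of_nat (2*m+1))"
        "1 / ((?z+1)/2 - of_nat (Suc m)) = 2 / (?z - of_nat (2*m+1))"
        by (simp_all only: d)
    qed
    have "(?C (?z/2) (Suc m) - ?C ((?z+1)/2) (Suc m)) / 2 = (?C (?z/2) m - ?C ((?z+1)/2) m) / 2 +
        ?c / 2"
    proof -
      have "(A + P - (B + Q)) / 2 = (A - B) / 2 + (P - Q) / 2" for A B P Q :: complex
        by (simp add: field_simps)
      then show ?thesis by (simp only: sum.lessThan_Suc 1)
    qed
    also have "?c / 2
       = of_real ?r"
    proof -
      have h: "(2 / a + 2 / b - (2 / c + 2 / d)) / 2 = 1 / a + 1 / b - (1 / c + 1 / d)" for a b c d :: complex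
        by (simp add: add_divide_distrib diff_divide_distrib)
      show ?thesis unfolding h by (simp del: of_nat_Suc of_nat_add)
    qed
    also have "(?C (?z/2) m - ?C ((?z+1)/2) m) / 2 = of_real (?R m)" by (rule Suc)
    also have "of_real (?R m) + of_real ?r = complex_of_real (?R (Suc m))"
      unfolding of_real_add[symmetric] by (rule arg_cong[of _ _ of_real]) simp
    finally show ?case .
  qed simp
  ultimately have "(\<lambda>m. of_real (?R m)) \<longlonglongrightarrow> (of_real (pi / sin (pi * x)) :: complex)"
    by (simp only:)
  then show ?thesis unfolding tendsto_of_real_iff .
qed

text \<open>The limiting value 1/(2x) is exactly the amount lost to the -1/x terms in
  \<open>sine_kernel_tail_bound\<close>. Consecutive terms satisfy 1/y - 1/(y+1) >= (1/y -
  1/(y+2))/2, and the right-hand sides telescope.\<close>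

lemma alternating_sum_lower_bound:
  fixes x :: real
  assumes "x > 0"
  shows "1 / (2 * x) - 1 / (2 * (x + real (2*m))) \<le> (\<Sum>j<2*m. (-1) ^ j / (x + real j))"
proof (induction m)
  case (Suc m)
  define y where "y = x + real (2*m)"
  have y: "y > 0" using assms by (simp add: y_def)
  have "1 / (y * (y+1) * (y+2)) \<ge> 0" using y by simp
  moreover have "1/y - 1/(y+1) - (1/(2*y) - 1/(2*(y+2))) = 1 / (y * (y+1) * (y+2))"
    using y by (simp add: divide_simps)
  ultimately have "1/y - 1/(y+1) \<ge> 1/(2*y) - 1/(2*(y+2))" by linarith
  moreover have "(\<Sum>j<2*Suc m. (-1) ^ j / (x + real j)) = (\<Sum>j<2*m. (-1) ^ j / (x + real j)) + (1/y - 1/(y+1))"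
    by (simp add: y_def add_ac)
  moreover have "x + real (2 * Suc m) = y + 2" by (simp add: y_def)
  ultimately show ?case using Suc by (simp only: y_def[symmetric])
qed simp

section \<open>Sign of the interpolation error\<close>

context
  fixes q :: real assumes q: "0 < q" "q < 1"
begin

text \<open>Here N/(N+t) is the integral over u > 0 of t exp(-ut)(1 - exp(-uN)), the weight t
  r^(t-1) dr under r = exp(-u). The explicit antiderivatives \<open>f n\<close> vanish at infinity
  and their sum is nondecreasing by \<open>theta_disc_min\<close>, so its value at 0 is at most 0;
  sum and integral are never interchanged.\<close>

lemma theta_kernel_nonneg:
  assumes t: "t > 0"
  shows "0 \<le> (\<Sum>n. q ^ (Suc n)\<^sup>2 * ((-1) ^ n * (real (Suc n) / (real (Suc n) + t))))"
proof -
  let ?G = "\<lambda>n. q ^ (Suc n)\<^sup>2"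
  let ?m = "\<lambda>n. real (Suc n) + t"
  define f where "f n u = - (?G n * ((-1) ^ n * (exp (-u*t) - t * exp (-u*?m n) / ?m n)))" for n u
  define f' where "f' n u = t * exp (-u*t) * (?G n * ((-1) ^ n * (1 - exp (-u) ^ Suc n)))" for n u
  have sG: "summable ?G" using summable_theta_Suc[OF q, of 0] by simp
  have pos: "real (Suc n) + t > 0" for n using t by simp
  have df: "(f n has_real_derivative f' n u) (at u within S)" for n u S
  proof -
    have "exp (-u) ^ Suc n * exp (-u*t) = exp (-u*?m n)"
      by (simp add: exp_add[symmetric] exp_of_nat_mult[symmetric] algebra_simps del: power_Suc)
    then have "f' n u = - (?G n * ((-1) ^ n * (exp (-u*t) * (-t) + t * exp (-u*?m n))))"
      unfolding f'_def by (simp only: right_diff_distrib mult_1_right) (simp add: algebra_simps del: power_Suc of_nat_Suc)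
    also have "t * exp (-u*?m n) = - (t * (exp (-u*?m n) * (-?m n)) / ?m n)"
    proof -
      have "t * E = - (t * (E * (- w)) / w)" if "w > 0" for E w :: real using that by simp
      then show ?thesis using pos[of n] by blast
    qed
    finally have "f' n u = - (?G n * ((-1) ^ n * (exp (-u*t) * (-t) - t * (exp (-u*?m n) * (-?m n)) / ?m n)))"
      by (simp only: add_uminus_conv_diff)
    then show ?thesis unfolding f_def using pos[of n]
      by (auto intro!: derivative_eq_intros simp del: power_Suc of_nat_Suc)
  qed
  have fb: "norm (f n u) \<le> 2 * exp (-u*t) * ?G n" if "u \<ge> 0" for n u
  proof -
    have a: "0 \<le> exp (-u*?m n)" "exp (-u*?m n) \<le> exp (-u*t)"
      using that by (auto simp: algebra_simps intro: order_trans[of _ 0])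
    have "t * exp (-u*?m n) / ?m n = (t / ?m n) * exp (-u*?m n)" by simp
    also have "\<dots> \<le> 1 * exp (-u*t)" using t a by (intro mult_mono) auto
    finally have "\<bar>t * exp (-u*?m n) / ?m n\<bar> \<le> exp (-u*t)" using t by simp
    then have "\<bar>exp (-u*t) - t * exp (-u*?m n) / ?m n\<bar> \<le> 2 * exp (-u*t)"
      using exp_ge_zero[of "-u*t"] by linarith
    then have "?G n * \<bar>exp (-u*t) - t * exp (-u*?m n) / ?m n\<bar> \<le> ?G n * (2 * exp (-u*t))"
      using q by (intro mult_left_mono) auto
    then show ?thesis using q by (simp add: f_def abs_mult mult_ac del: power_Suc of_nat_Suc)
  qed
  have sf: "summable (\<lambda>n. f n u)" if "u \<ge> 0" for u
    by (rule summable_comparison_test'[OF summable_mult[OF sG] fb]) (rule that)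
  have mono: "(\<Sum>n. f n 0) \<le> (\<Sum>n. f n U)" if "U \<ge> 0" for U
  proof (rule suminf_mono_interval[OF that df])
    fix n u assume u: "u \<in> {0..U}"
    have a: "0 \<le> exp (-u) ^ Suc n" "exp (-u) ^ Suc n \<le> 1" using u by (auto intro!: power_le_one mult_le_one)
    have "t * exp (-u*t) * (?G n * \<bar>1 - exp (-u) ^ Suc n\<bar>) \<le> (t * 1) * (?G n * 1)"
      using t u a q by (intro mult_mono) (auto simp del: power_Suc)
    then show "norm (f' n u) \<le> t * ?G n"
      using t q by (simp add: f'_def abs_mult del: power_Suc)
  next
    show "summable (\<lambda>n. t * ?G n)" by (rule summable_mult[OF sG])
    show "summable (\<lambda>n. f n 0)" by (rule sf) simp
    fix u assume u: "u \<in> {0..U}"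
    have a: "0 \<le> exp (-u) ^ Suc n" "exp (-u) ^ Suc n \<le> 1" for n using u by (auto intro!: power_le_one mult_le_one)
    have "summable (\<lambda>n. ?G n * ((-1) ^ n * (1 - exp (-u) ^ Suc n)))"
      using summable_theta[OF q, of "\<lambda>n. (-1) ^ n * (1 - exp (-u) ^ Suc n)" 1 0] a
      by (simp add: abs_mult del: power_Suc)
    then have "(\<Sum>n. f' n u) = t * exp (-u*t) * (\<Sum>n. ?G n * ((-1) ^ n * (1 - exp (-u) ^ Suc n)))"
      unfolding f'_def by (rule suminf_mult)
    also have "\<dots> \<ge> 0" using t u by (intro mult_nonneg_nonneg theta_disc_min[OF q]) auto
    finally show "0 \<le> (\<Sum>n. f' n u)" .
  qed
  have up: "(\<Sum>n. f n U) \<le> 2 * exp (-U*t) * (\<Sum>n. ?G n)" if "U \<ge> 0" for U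
  proof -
    have "(\<Sum>n. f n U) \<le> (\<Sum>n. 2 * exp (-U*t) * ?G n)"
      using fb[OF that] by (intro suminf_le sf[OF that] summable_mult sG) (metis abs_le_D1 real_norm_def)
    also have "\<dots> = 2 * exp (-U*t) * (\<Sum>n. ?G n)" by (rule suminf_mult[OF sG])
    finally show ?thesis .
  qed
  have "((\<lambda>U. exp (-U*t)) \<longlongrightarrow> 0) at_top" using t by real_asymp
  then have lim: "((\<lambda>U. 2 * exp (-U*t) * (\<Sum>n. ?G n)) \<longlongrightarrow> 2 * 0 * (\<Sum>n. ?G n)) at_top"
    by (intro tendsto_intros)
  have "(\<Sum>n. f n 0) \<le> 2 * 0 * (\<Sum>n. ?G n)"
  proof (rule tendsto_lowerbound[OF lim])
    show "eventually (\<lambda>U. (\<Sum>n. f n 0) \<le> 2 * exp (-U*t) * (\<Sum>n. ?G n)) at_top"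
      using eventually_ge_at_top[of 0] by eventually_elim (rule order_trans[OF mono up])
  qed simp
  moreover have "(\<Sum>n. f n 0) = - (\<Sum>n. ?G n * ((-1) ^ n * (real (Suc n) / ?m n)))"
  proof -
    have e: "1 - t / ?m n = real (Suc n) / ?m n" for n using pos[of n] by (simp add: field_simps)
    have "(\<Sum>n. f n 0) = (\<Sum>n. - (?G n * ((-1) ^ n * (real (Suc n) / ?m n))))"
      unfolding f_def e[symmetric] by simp
    also have "\<dots> = - (\<Sum>n. ?G n * ((-1) ^ n * (real (Suc n) / ?m n)))"
    proof (rule suminf_minus)
      have "summable (\<lambda>n. - f n 0)" using sf[of 0] by (intro summable_minus) auto
      then show "summable (\<lambda>n. ?G n * ((-1) ^ n * (real (Suc n) / ?m n)))"
        unfolding f_def e[symmetric] by simp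
    qed
    finally show ?thesis .
  qed
  ultimately show ?thesis by simp
qed

end


text \<open>The kernel series does not converge at q = 1, so the limit can only be taken in finitely
  many terms. The -1/x parts add up to at most 1/(2x) by \<open>theta4_nonneg\<close>. The remaining
  tail starts at n = 2m + 2 > x, where it alternates with decreasing moduli and a negative leading
  term.\<close>

lemma sine_kernel_tail_bound:
  fixes q x :: real
  assumes q: "0 < q" "q < 1" and x: "x > 0" "x \<notin> \<int>" and m: "x \<le> real (2*m+1)"
  shows "(\<Sum>n. q ^ (Suc n)\<^sup>2 * ((-1) ^ Suc n * (1 / (x - real (Suc n)) - 1 / x)))
     \<le> (\<Sum>j<2*m+1. q ^ (Suc j)\<^sup>2 * ((-1) ^ Suc j / (x - real (Suc j)))) + 1 / (2 * x)"
proof -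
  have xn: "x \<noteq> real n" for n using x by auto
  obtain d where d: "d > 0" "\<And>n. d \<le> \<bar>x - real n\<bar>"
  proof
    show "setdist {x} \<int> > 0" using x closed_Ints setdist_gt_0_compact_closed[of "{x}" "\<int>"] by auto
    show "setdist {x} \<int> \<le> \<bar>x - real n\<bar>" for n
      using setdist_le_dist[of x "{x}" "real n" \<int>] by (auto simp: dist_real_def)
  qed
  let ?b = "\<lambda>n. q ^ (Suc n)\<^sup>2 * ((-1) ^ Suc n / (x - real (Suc n)))"
  let ?c = "\<lambda>n. q ^ (Suc n)\<^sup>2 * (-1) ^ Suc n"
  have "norm ((-1) ^ Suc n / (x - real (Suc n))) \<le> (1/d) * real (Suc n) ^ 0" for n
    using d(1) d(2)[of "Suc n"] by (simp add: abs_divide frac_le del: of_nat_Suc)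
  from summable_theta[OF q this] have sb: "summable ?b" by (simp only: of_real_eq_id id_def)
  have sc: "summable ?c" using summable_theta[OF q, of "\<lambda>n. (-1::real) ^ Suc n" 1 0] by simp
  have "(\<Sum>n. q ^ (Suc n)\<^sup>2 * ((-1) ^ Suc n * (1 / (x - real (Suc n)) - 1 / x))) = (\<Sum>n. ?b n - ?c n / x)"
    by (simp add: right_diff_distrib del: of_nat_Suc power_Suc)
  also have "\<dots> = suminf ?b - suminf ?c / x"
    using suminf_diff[OF sb summable_divide[OF sc]] suminf_divide[OF sc] by simp
  also have "- (suminf ?c / x) \<le> 1 / (2 * x)"
    using theta4_nonneg[OF q] x by (simp add: field_simps del: power_Suc)
  then have "suminf ?b - suminf ?c / x \<le> suminf ?b + 1 / (2 * x)" by simp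
  also have "suminf ?b = (\<Sum>n. ?b (n + (2*m+1))) + (\<Sum>j<2*m+1. ?b j)"
    by (rule suminf_split_initial_segment[OF sb])
  also have "(\<Sum>n. ?b (n + (2*m+1))) \<le> 0"
  proof -
    let ?a = "\<lambda>i. q ^ (Suc (i + (2*m+1)))\<^sup>2 / (real (Suc (i + (2*m+1))) - x)"
    have pos: "real (Suc (i + (2*m+1))) - x > 0" for i using m by simp
    have e: "?b (i + (2*m+1)) = - ((-1) ^ i * ?a i)" for i
    proof -
      have "(-1::real) ^ Suc (i + (2*m+1)) = (-1) ^ i" by (simp add: power_add)
      moreover have "x - real (Suc (i + (2*m+1))) = - (real (Suc (i + (2*m+1))) - x)" by simp
      ultimately show ?thesis by (metis (no_types, lifting) minus_divide_right mult.commute mult_minus_right times_divide_eq_right)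
    qed
    have sa: "summable (\<lambda>i. (-1) ^ i * ?a i)"
      using summable_minus[OF summable_ignore_initial_segment[OF sb, of "2*m+1"]] unfolding e minus_minus .
    have "0 \<le> (\<Sum>i. (-1) ^ i * ?a i)"
    proof -
      have az: "?a \<longlonglongrightarrow> 0"
        using tendsto_rabs_zero[OF summable_LIMSEQ_zero[OF sa]] pos q
        by (subst tendsto_rabs_zero_iff[symmetric]) (simp add: abs_mult del: of_nat_Suc power_Suc)
      have "?a (Suc i) \<le> ?a i" for i
        using q pos[of i] by (intro frac_le power_decreasing) (auto simp del: power_Suc)
      then have "(\<Sum>i<2*0. (-1) ^ i * ?a i) \<le> (\<Sum>i. (-1) ^ i * ?a i)"
        using q pos by (intro summable_Leibniz'(2)[OF az]) (simp_all del: of_nat_Suc power_Suc add: less_imp_le)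
      then show ?thesis by simp
    qed
    then show ?thesis unfolding e using suminf_minus[OF sa] by simp
  qed
  finally show ?thesis by simp
qed

text \<open>Multiplication by exp(pi l x^2) turns the right-hand side into the constant pi/sin(pi x)
  and the n-th term into exp(pi l (x^2 - n^2)) times its coefficient. The l-derivative carries the
  factor x^2 - n^2, which cancels the pole at n and leaves the sums of
  \<open>theta_alternating_nonneg\<close> and \<open>theta_alternating_square_nonneg\<close>. So the
  product with \<open>T\<close> is nonincreasing in l, and it suffices to bound it as l ->
  0.\<close>

lemma sine_kernel_bound:
  fixes lam x :: real
  assumes x: "x > 0" "x \<notin> \<int>" and lam: "lam > 0"
  shows "(\<Sum>n. exp (-pi * lam) ^ (Suc n)\<^sup>2 * ((-1) ^ Suc n * (1 / (x - real (Suc n)) - 1 / x)))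
     \<le> pi * exp (-pi * lam * x\<^sup>2) / sin (pi * x)"
proof -
  let ?N = "\<lambda>n. real (Suc n) + (real (Suc n))\<^sup>2 / x"
  define Q where "Q l = exp (-pi * l)" for l :: real
  define c where "c n = (-1) ^ Suc n * (1 / (x - real (Suc n)) - 1 / x)" for n
  define T where "T l = (\<Sum>n. Q l ^ (Suc n)\<^sup>2 * c n)" for l
  define a where "a n l = exp (pi * l * (x\<^sup>2 - (real (Suc n))\<^sup>2)) * c n" for n l
  define a' where "a' n l = pi * exp (pi * l * x\<^sup>2) * (Q l ^ (Suc n)\<^sup>2 * ((-1) ^ n * (?N n)))" for n l
  have xn: "x \<noteq> real n" for n using x by auto
  have Q: "0 < Q l" "l > 0 \<Longrightarrow> Q l < 1" for l by (auto simp: Q_def)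
  have ex: "exp (pi * l * (x\<^sup>2 - (real (Suc n))\<^sup>2)) = exp (pi * l * x\<^sup>2) * Q l ^ (Suc n)\<^sup>2" for l n
    unfolding Q_def by (simp add: exp_of_nat_mult[symmetric] exp_add[symmetric] algebra_simps)
  have cN: "(x\<^sup>2 - (real (Suc n))\<^sup>2) * c n = - ((-1) ^ n * (?N n))" for n
  proof -
    have "(x\<^sup>2 - N\<^sup>2) * (1 / (x - N) - 1 / x) = N + N\<^sup>2 / x" if "x \<noteq> N" for N
      using that x by (simp add: divide_simps) (simp add: algebra_simps power2_eq_square)
    from this[OF xn, of "Suc n"] show ?thesis unfolding c_def
      by (simp only: mult.left_commute[of _ "(-1) ^ Suc n"] power_Suc) simp
  qed
  have da: "((\<lambda>l. - a n l) has_real_derivative a' n l) (at l within S)" for n l S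
  proof -
    have "a' n l = - (pi * (exp (pi * l * (x\<^sup>2 - (real (Suc n))\<^sup>2)) * ((x\<^sup>2 - (real (Suc n))\<^sup>2) * c n)))"
      unfolding cN ex a'_def by (simp only: mult_minus_right minus_minus mult_ac)
    then show ?thesis unfolding a_def
      by (auto intro!: derivative_eq_intros simp del: of_nat_Suc)
  qed
  obtain C where C: "\<And>n. \<bar>c n\<bar> \<le> C * real (Suc n) ^ 0"
  proof -
    have "(\<lambda>n. 1 / (x - real (Suc n)) - 1 / x) \<longlonglongrightarrow> 0 - 1 / x" by real_asymp
    then have "Bseq (\<lambda>n. 1 / (x - real (Suc n)) - 1 / x)" using convergentI convergent_imp_Bseq by blast
    then obtain K where "\<And>n. norm (1 / (x - real (Suc n)) - 1 / x) \<le> K" by (auto simp: Bseq_def)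
    then show ?thesis by (intro that[of K]) (simp add: c_def abs_mult del: of_nat_Suc)
  qed
  have sT: "summable (\<lambda>n. Q l ^ (Suc n)\<^sup>2 * c n)" if "l > 0" for l
    using summable_theta[OF Q(1) Q(2)[OF that], of c C 0] C by simp
  have ae: "a n l = exp (pi * l * x\<^sup>2) * (Q l ^ (Suc n)\<^sup>2 * c n)" for n l
    unfolding a_def ex by (simp only: mult.assoc)
  have aT: "(\<Sum>n. a n l) = exp (pi * l * x\<^sup>2) * T l" if "l > 0" for l
    unfolding ae T_def by (rule suminf_mult[OF sT[OF that]])
  have sa: "summable (\<lambda>n. a n l)" if "l > 0" for l
    unfolding ae by (rule summable_mult[OF sT[OF that]])
  have mono: "exp (pi * lam * x\<^sup>2) * T lam \<le> exp (pi * l * x\<^sup>2) * T l" if l: "0 < l" "l \<le> lam" for l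
  proof -
    have Nb: "?N n \<le> (1 + 1/x) * (real (Suc n))\<^sup>2" for n
    proof -
      have "real (Suc n) \<le> (real (Suc n))\<^sup>2" by (simp add: power2_eq_square)
      then show ?thesis by (simp add: distrib_right)
    qed
    have "(\<Sum>n. - a n l) \<le> (\<Sum>n. - a n lam)"
    proof (rule suminf_mono_interval[OF l(2) da])
      show "summable (\<lambda>n. pi * exp (pi * lam * x\<^sup>2) * (1 + 1/x) * ((real (Suc n))\<^sup>2 * Q l ^ (Suc n)\<^sup>2))"
        by (rule summable_mult[OF summable_theta_Suc[OF Q(1) Q(2)[OF l(1)]]])
      show "summable (\<lambda>n. - a n l)" using sa l by (intro summable_minus) auto
      fix n u assume u: "u \<in> {l..lam}"
      have "Q u ^ (Suc n)\<^sup>2 \<le> Q l ^ (Suc n)\<^sup>2" using u by (intro power_mono) (auto simp: Q_def)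
      moreover have "exp (pi * u * x\<^sup>2) \<le> exp (pi * lam * x\<^sup>2)" using u by (auto intro!: mult_right_mono)
      moreover have p: "0 \<le> ?N n" using x by simp
      ultimately have "pi * exp (pi * u * x\<^sup>2) * (Q u ^ (Suc n)\<^sup>2 * (?N n))
          \<le> pi * exp (pi * lam * x\<^sup>2) * (Q l ^ (Suc n)\<^sup>2 * ((1 + 1/x) * (real (Suc n))\<^sup>2))"
        using Nb[of n] Q(1)[of u] Q(1)[of l] by (intro mult_mono) (auto simp del: of_nat_Suc power_Suc simp: less_imp_le)
      moreover have "norm (a' n u) = pi * exp (pi * u * x\<^sup>2) * (Q u ^ (Suc n)\<^sup>2 * (?N n))"
        using Q(1)[of u] p unfolding a'_def by (simp add: abs_mult del: of_nat_Suc power_Suc)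
      ultimately show "norm (a' n u) \<le> pi * exp (pi * lam * x\<^sup>2) * (1 + 1/x) * ((real (Suc n))\<^sup>2 * Q l ^ (Suc n)\<^sup>2)"
        by (simp only: mult_ac)
    next
      fix u assume u: "u \<in> {l..lam}"
      then have u0: "u > 0" using l by simp
      let ?f = "\<lambda>n. Q u ^ (Suc n)\<^sup>2 * ((-1) ^ n * real (Suc n))"
      let ?g = "\<lambda>n. Q u ^ (Suc n)\<^sup>2 * ((-1) ^ n * (real (Suc n))\<^sup>2)"
      have f: "summable ?f" using summable_theta[OF Q(1) Q(2)[OF u0], of "\<lambda>n. (-1) ^ n * real (Suc n)" 1 1]
        by (simp add: abs_mult del: of_nat_Suc power_Suc)
      have g: "summable ?g" using summable_theta[OF Q(1) Q(2)[OF u0], of "\<lambda>n. (-1) ^ n * (real (Suc n))\<^sup>2" 1 2]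
        by (simp add: abs_mult del: of_nat_Suc power_Suc)
      have "(\<Sum>n. a' n u) = (\<Sum>n. pi * exp (pi * u * x\<^sup>2) * (?f n + ?g n / x))"
        unfolding a'_def by (simp add: distrib_left del: of_nat_Suc power_Suc)
      also have "\<dots> = pi * exp (pi * u * x\<^sup>2) * (suminf ?f + suminf ?g / x)"
        using suminf_mult[OF summable_add[OF f summable_divide[OF g]]] suminf_add[OF f summable_divide[OF g]] suminf_divide[OF g]
        by simp
      also have "\<dots> \<ge> 0"
        using theta_alternating_nonneg[OF Q(1) Q(2)[OF u0]] theta_alternating_square_nonneg[OF Q(1) Q(2)[OF u0]] x
        by (intro mult_nonneg_nonneg add_nonneg_nonneg divide_nonneg_nonneg) auto
      finally show "0 \<le> (\<Sum>n. a' n u)" .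
    qed
    then show ?thesis using suminf_minus[OF sa] l lam by (simp add: aT)
  qed
  define P where "P m = (\<Sum>j<m. (-1) ^ Suc j / (x - real (Suc j)))" for m
  \<comment> \<open>The bound by finitely many terms permits l -> 0: all powers of
    \<open>Q l\<close> tend to 1, and only 2m + 1 simple fractions and 1/(2x) remain.\<close>
  have le1: "exp (pi * lam * x\<^sup>2) * T lam \<le> P (2*m+1) + 1 / (2*x)" if m: "x \<le> real (2*m+1)" for m
  proof -
    let ?h = "\<lambda>l. exp (pi * l * x\<^sup>2) * ((\<Sum>j<2*m+1. Q l ^ (Suc j)\<^sup>2 * ((-1) ^ Suc j / (x - real (Suc j)))) + 1 / (2*x))"
    have "(?h \<longlongrightarrow> exp (pi * 0 * x\<^sup>2) * ((\<Sum>j<2*m+1. exp (-pi * 0) ^ (Suc j)\<^sup>2 * ((-1) ^ Suc j / (x - real (Suc j)))) + 1 / (2*x))) (at_right 0)"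
      unfolding Q_def by (intro tendsto_intros)
    then have "(?h \<longlongrightarrow> P (2*m+1) + 1 / (2*x)) (at_right 0)" by (simp add: P_def del: sum.lessThan_Suc)
    moreover have "eventually (\<lambda>l. exp (pi * lam * x\<^sup>2) * T lam \<le> ?h l) (at_right 0)"
      using eventually_at_right_real[OF lam]
    proof eventually_elim
      case (elim l)
      then have l: "0 < l" "l \<le> lam" by auto
      have "exp (pi * l * x\<^sup>2) * T l \<le> ?h l"
        unfolding T_def c_def using sine_kernel_tail_bound[OF Q(1) Q(2)[OF l(1)] x m] by (intro mult_left_mono) auto
      then show ?case using mono[OF l] by linarith
    qed
    ultimately show ?thesis by (rule tendsto_lowerbound) auto
  qed
  define R where "R m = (\<Sum>j<2*m. (-1) ^ j / (x + real j)) + P (2*m)" for m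
  have "R \<longlonglongrightarrow> pi / sin (pi * x)" unfolding R_def P_def by (rule pi_csc_partial_fractions[OF x(2)])
  moreover have "(\<lambda>m. 1 / (real (2*m+1) - x) + 1 / (2 * (x + real (2*m)))) \<longlonglongrightarrow> 0" by real_asymp
  ultimately have "(\<lambda>m. R m + (1 / (real (2*m+1) - x) + 1 / (2 * (x + real (2*m))))) \<longlonglongrightarrow> pi / sin (pi * x) + 0"
    by (rule tendsto_add)
  moreover have "eventually (\<lambda>m. exp (pi * lam * x\<^sup>2) * T lam \<le> R m + (1 / (real (2*m+1) - x) + 1 / (2 * (x + real (2*m))))) sequentially"
    using eventually_ge_at_top[of "nat \<lceil>x\<rceil>"]
  proof eventually_elim
    case (elim m)
    then have m: "x \<le> real (2*m+1)" by linarith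
    \<comment> \<open>The tail bound has an odd number of terms, the partial fractions an even one;
      the extra term tends to 0. The 1/(2x) is absorbed by the poles at the nonpositive
      integers.\<close>
    have "P (2*m+1) = P (2*m) + 1 / (real (2*m+1) - x)"
      unfolding P_def by (simp add: minus_divide_right)
    then show ?case using le1[OF m] alternating_sum_lower_bound[OF x(1), of m] unfolding R_def by linarith
  qed
  ultimately have "exp (pi * lam * x\<^sup>2) * T lam \<le> pi / sin (pi * x)"
    using tendsto_lowerbound[of _ "pi / sin (pi * x) + 0" sequentially] by simp
  then have "exp (- (pi * lam * x\<^sup>2)) * (exp (pi * lam * x\<^sup>2) * T lam) \<le> exp (- (pi * lam * x\<^sup>2)) * (pi / sin (pi * x))"
    by (intro mult_left_mono) auto
  then have "T lam \<le> exp (- (pi * lam * x\<^sup>2)) * (pi / sin (pi * x))"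
    by (simp add: mult.assoc[symmetric] exp_add[symmetric])
  then show ?thesis by (simp add: T_def c_def Q_def mult.commute)
qed

section \<open>The interpolant on the real line\<close>

lemma gauss_of_nat: "gauss lam (of_nat m) = of_real (exp (- pi * lam) ^ m\<^sup>2)"
proof -
  have "- of_real (pi * lam) * (of_nat m)\<^sup>2 = (of_real (real (m\<^sup>2) * (- pi * lam)) :: complex)" by simp
  then show ?thesis unfolding gauss_def by (simp only: exp_of_real exp_of_nat_mult)
qed

text \<open>Every term of the series in \<open>csinc\<close> is real on the real line; this form of
  the interpolant is valid at the integers too.\<close>

lemma gauss_interp_real:
  assumes lam: "lam > 0"
  shows "gauss_interp lam (of_real x) \<in> \<real>"
proof -
  let ?f = "\<lambda>n. gauss lam (of_nat (Suc n)) * (csinc (of_real x - of_nat (Suc n)) - (-1) ^ Suc n * csinc (of_real x))"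
  obtain C where C: "C > 0" "\<And>z. norm (csinc z) \<le> C * exp (pi * \<bar>Im z\<bar>)"
    using csinc_bound by blast
  have "summable ?f"
    by (rule summable_comparison_test'[OF _ gauss_interp_term_bound[OF C(2)]])
       (intro summable_mult2 summable_norm_gauss lam)
  then have s: "?f sums gauss_interp lam (of_real x)"
    unfolding gauss_interp_eq_entire[OF lam] gauss_interp_entire_def by (rule summable_sums)
  have c: "csinc (of_real y) \<in> \<real>" for y
    unfolding csinc_def by (auto simp flip: of_real_mult sin_of_real intro!: Reals_divide)
  have "?f n \<in> \<real>" for n
    using c[of "x - real (Suc n)"] c[of x] unfolding gauss_of_nat
    by (intro Reals_mult Reals_diff Reals_power Reals_minus) (simp_all del: of_nat_Suc)
  then have "Im (?f n) = 0" for n using complex_is_Real_iff by blast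
  then have "(\<lambda>n. 0) sums Im (gauss_interp lam (of_real x))" using sums_Im[OF s] by simp
  then show ?thesis by (simp add: complex_is_Real_iff sums_iff)
qed

text \<open>Here s stands for sin(pi x). The difference equals N/(x (x - N)), so x^2 times it is N +
  N^2/(x - N): the subtracted 1/x produces decay of order x^-2, and the zero of s at N keeps the
  bound uniform near the pole. The 4 collects |u| <= 2 and |u x^2| <= N + N^2 <= 2 N^2.\<close>

lemma kernel_term_bound:
  fixes x N :: real
  assumes "N \<ge> 1" "x \<noteq> N" "x \<noteq> 0" and s: "\<bar>s\<bar> \<le> 1" "\<bar>s\<bar> \<le> pi * \<bar>x\<bar>" "\<bar>s\<bar> \<le> pi * \<bar>x - N\<bar>"
  shows "\<bar>s / pi * (1 / (x - N) - 1 / x)\<bar> * (1 + x\<^sup>2) \<le> 4 * N\<^sup>2"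
proof -
  let ?u = "s / pi * (1 / (x - N) - 1 / x)"
  have a: "\<bar>s / (pi * x)\<bar> \<le> 1" "\<bar>s / (pi * (x - N))\<bar> \<le> 1"
    using s assms by (simp_all add: abs_mult abs_divide divide_le_eq)
  have "?u = s / (pi * (x - N)) - s / (pi * x)" by (simp add: right_diff_distrib)
  then have 1: "\<bar>?u\<bar> \<le> 2" using a by linarith
  have "?u * x\<^sup>2 = s / pi * N + N\<^sup>2 * (s / (pi * (x - N)))"
    using assms by (simp add: divide_simps) (simp add: algebra_simps power2_eq_square)
  moreover have "\<bar>s / pi * N\<bar> \<le> 1 * N"
    using s pi_gt3 assms(1) unfolding abs_mult by (intro mult_mono) (auto simp: abs_divide divide_le_eq)
  moreover have "\<bar>N\<^sup>2 * (s / (pi * (x - N)))\<bar> \<le> N\<^sup>2 * 1"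
    using a unfolding abs_mult by (intro mult_mono) auto
  ultimately have "\<bar>?u * x\<^sup>2\<bar> \<le> 1 * N + N\<^sup>2 * 1"
    by (simp only: order_trans[OF abs_triangle_ineq add_mono])
  then have "\<bar>?u * x\<^sup>2\<bar> \<le> N + N\<^sup>2" by (simp only: mult_1_left mult_1_right)
  moreover have "N \<le> N\<^sup>2" "1 \<le> N\<^sup>2" using assms(1) mult_mono[of 1 N 1 N] by (auto simp: power2_eq_square)
  ultimately show ?thesis using 1 by (simp add: distrib_left abs_mult)
qed

text \<open>The second bound holds off the integers, whose complement has full measure, and yields
  integrability of the interpolant; summability of n^2 q^(n^2) pays for the factor N^2 in
  \<open>kernel_term_bound\<close>.\<close>

lemma gauss_interp_real_series:
  assumes lam: "lam > 0" and x: "x \<notin> \<int>"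
  shows "gauss_interp lam (of_real x) = of_real (sin (pi * x) / pi *
      (\<Sum>n. exp (- pi * lam) ^ (Suc n)\<^sup>2 * ((-1) ^ Suc n * (1 / (x - real (Suc n)) - 1 / x))))"
    and "\<bar>Re (gauss_interp lam (of_real x))\<bar> \<le> 4 * (\<Sum>n. (real (Suc n))\<^sup>2 * exp (- pi * lam) ^ (Suc n)\<^sup>2) * inverse (1 + x\<^sup>2)"
proof -
  define q where "q = exp (- pi * lam)"
  have q: "0 < q" "q < 1" using lam by (auto simp: q_def)
  let ?t = "\<lambda>n. q ^ (Suc n)\<^sup>2 * ((-1) ^ Suc n * (1 / (x - real (Suc n)) - 1 / x))"
  let ?s = "sin (pi * x) / pi"
  have xn: "x \<noteq> 0" "x \<noteq> real n" for n using x by auto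
  have s0: "?s \<noteq> 0" using x by (auto simp: sin_zero_iff_int2 Ints_def)
  have sinb: "\<bar>sin (pi * x)\<bar> \<le> pi * \<bar>x - real n\<bar>" for n
  proof -
    have "\<bar>sin (pi * x)\<bar> = \<bar>sin (pi * (x - real n))\<bar>"
    proof (induction n)
      case (Suc n)
      have "sin (pi * (x - real (Suc n))) = sin (pi * (x - real n) - pi)" by (simp add: algebra_simps)
      then show ?case using Suc by (simp add: sin_diff)
    qed simp
    also have "\<dots> \<le> \<bar>pi * (x - real n)\<bar>" by (rule abs_sin_x_le_abs_x)
    finally show ?thesis by (simp add: abs_mult)
  qed
  have tb: "\<bar>?s * ?t n\<bar> * (1 + x\<^sup>2) \<le> 4 * ((real (Suc n))\<^sup>2 * q ^ (Suc n)\<^sup>2)" for n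
  proof -
    have "\<bar>?s * ?t n\<bar> * (1 + x\<^sup>2) = q ^ (Suc n)\<^sup>2 * (\<bar>?s * (1 / (x - real (Suc n)) - 1 / x)\<bar> * (1 + x\<^sup>2))"
      using q by (simp only: abs_mult power_abs abs_minus_cancel abs_one power_one mult_1_left abs_of_nonneg[OF zero_le_power[OF less_imp_le[OF q(1)]]] mult_ac)
    also have "\<dots> \<le> q ^ (Suc n)\<^sup>2 * (4 * (real (Suc n))\<^sup>2)"
      using sinb[of "Suc n"] sinb[of 0] xn xn(2)[of "Suc n"] q by (intro mult_left_mono kernel_term_bound) auto
    finally show ?thesis by (simp only: mult_ac)
  qed
  have p: "1 + x\<^sup>2 > 0" by (simp add: add_pos_nonneg)
  have tb': "\<bar>?s * ?t n\<bar> \<le> 4 * ((real (Suc n))\<^sup>2 * q ^ (Suc n)\<^sup>2) * inverse (1 + x\<^sup>2)" for n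
    using tb[of n] p by (simp only: pos_le_divide_eq[symmetric] divide_inverse[symmetric])
  have sq: "summable (\<lambda>n. 4 * ((real (Suc n))\<^sup>2 * q ^ (Suc n)\<^sup>2) * inverse (1 + x\<^sup>2))"
    by (intro summable_mult summable_mult2 summable_theta_Suc[OF q])
  have sst: "summable (\<lambda>n. ?s * ?t n)"
    by (rule summable_comparison_test'[OF sq]) (simp only: real_norm_def tb')
  then have st: "summable ?t" using s0 by (simp only: summable_cmult_iff) simp
  have "complex_of_real x \<notin> \<int>" using x by simp
  then have "gauss_interp lam (of_real x) = gauss_interp_series lam (of_real x)"
    by (rule gauss_interp_eq_series[OF lam])
  also have "\<dots> = of_real ?s * (\<Sum>n. of_real (?t n))"
  proof -
    have "(-1) ^ Suc n * (gauss lam (of_nat (Suc n)) / (of_real x - of_nat (Suc n)) - gauss lam (of_nat (Suc n)) / of_real x) = (of_real (?t n) :: complex)" for n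
      unfolding gauss_of_nat q_def[symmetric] by (simp add: right_diff_distrib mult.commute del: of_nat_Suc power_Suc)
    moreover have "sin (of_real pi * of_real x) = complex_of_real (sin (pi * x))"
      by (simp flip: sin_of_real)
    ultimately show ?thesis unfolding gauss_interp_series_def by (simp only: of_real_divide of_real_mult)
  qed
  also have "(\<Sum>n. of_real (?t n)) = (of_real (suminf ?t) :: complex)" by (rule suminf_of_real[OF st, symmetric])
  finally have *: "gauss_interp lam (of_real x) = of_real (?s * suminf ?t)" by (simp only: of_real_mult)
  then show "gauss_interp lam (of_real x) = of_real (sin (pi * x) / pi *
      (\<Sum>n. exp (- pi * lam) ^ (Suc n)\<^sup>2 * ((-1) ^ Suc n * (1 / (x - real (Suc n)) - 1 / x))))"
    by (simp only: q_def)
  have "\<bar>Re (gauss_interp lam (of_real x))\<bar> = \<bar>\<Sum>n. ?s * ?t n\<bar>"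
    unfolding * by (simp only: Re_complex_of_real suminf_mult[OF st])
  also have "\<dots> \<le> (\<Sum>n. 4 * ((real (Suc n))\<^sup>2 * q ^ (Suc n)\<^sup>2) * inverse (1 + x\<^sup>2))"
    using norm_suminf_le[OF _ sq, of "\<lambda>n. ?s * ?t n"] tb' by (simp only: real_norm_def)
  also have "\<dots> = 4 * (\<Sum>n. (real (Suc n))\<^sup>2 * q ^ (Suc n)\<^sup>2) * inverse (1 + x\<^sup>2)"
    by (simp only: suminf_mult2[OF summable_mult[OF summable_theta_Suc[OF q]], symmetric] suminf_mult[OF summable_theta_Suc[OF q]])
  finally show "\<bar>Re (gauss_interp lam (of_real x))\<bar> \<le> 4 * (\<Sum>n. (real (Suc n))\<^sup>2 * exp (- pi * lam) ^ (Suc n)\<^sup>2) * inverse (1 + x\<^sup>2)"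
    by (simp only: q_def)
qed

lemma gauss_interp_sign:
  assumes lam: "lam > 0"
  shows "sin (pi * x) * (trunc_gauss lam x - Re (gauss_interp lam (of_real x))) \<ge> 0"
proof (cases "x \<in> \<int>")
  case True
  then have "sin (pi * x) = 0" by (auto simp: sin_zero_iff_int2 Ints_def)
  then show ?thesis by simp
next
  case False
  let ?T = "\<Sum>n. exp (- pi * lam) ^ (Suc n)\<^sup>2 * ((-1) ^ Suc n * (1 / (x - real (Suc n)) - 1 / x))"
  have R: "Re (gauss_interp lam (of_real x)) = sin (pi * x) / pi * ?T"
    unfolding gauss_interp_real_series(1)[OF lam False] by (rule Re_complex_of_real)
  have s0: "sin (pi * x) \<noteq> 0" using False by (auto simp: sin_zero_iff_int2 Ints_def)
  have x0: "x \<noteq> 0" using False by auto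
  show ?thesis
  proof (cases "x > 0")
    case True
    \<comment> \<open>The factor sin^2/pi is nonnegative, which spares a distinction by the sign of
      the sine.\<close>
    have "(sin (pi * x))\<^sup>2 / pi * (pi * exp (- pi * lam * x\<^sup>2) / sin (pi * x) - ?T) \<ge> 0"
      using sine_kernel_bound[OF True False lam] by (intro mult_nonneg_nonneg) auto
    moreover have "(sin (pi * x))\<^sup>2 / pi * (pi * exp (- pi * lam * x\<^sup>2) / sin (pi * x) - T) =
        sin (pi * x) * (exp (- pi * lam * x\<^sup>2) - sin (pi * x) / pi * T)" for T
      using s0 by (simp add: field_simps power2_eq_square)
    ultimately show ?thesis unfolding R using True by (simp only: trunc_gauss_def if_True)
  next
    case False
    define t where "t = - x"
    have t: "t > 0" using False x0 by (simp add: t_def)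
    let ?q = "exp (- pi * lam)"
    let ?U = "\<lambda>n. ?q ^ (Suc n)\<^sup>2 * ((-1) ^ n * (real (Suc n) / (real (Suc n) + t)))"
    have q: "0 < ?q" "?q < 1" using lam by auto
    have "summable (\<lambda>n. of_real (?q ^ (Suc n)\<^sup>2) * ((-1) ^ n * (real (Suc n) / (real (Suc n) + t))))"
      using t by (intro summable_theta[OF q, of _ 1 0]) (simp add: abs_mult)
    then have sU: "summable ?U" by (simp only: of_real_eq_id id_def)
    have "?T = (\<Sum>n. (- 1 / t) * ?U n)"
    proof (intro suminf_cong)
      fix n
      have "1 / (x - N) - 1 / x = N / (N + t) * (1 / t)" if "N > 0" for N
        using that t by (simp add: t_def divide_simps) (simp add: algebra_simps)
      from this[of "real (Suc n)"]
      have e: "1 / (x - real (Suc n)) - 1 / x = real (Suc n) / (real (Suc n) + t) * (1 / t)" by simp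
      show "?q ^ (Suc n)\<^sup>2 * ((-1) ^ Suc n * (1 / (x - real (Suc n)) - 1 / x)) = (- 1 / t) * ?U n"
        unfolding e by (simp del: of_nat_Suc)
    qed
    also have "\<dots> = (- 1 / t) * suminf ?U" by (rule suminf_mult[OF sU])
    also have "\<dots> \<le> 0" using theta_kernel_nonneg[OF q t] t by (simp add: mult_nonpos_nonneg)
    finally have "?T \<le> 0" .
    then have "(sin (pi * x))\<^sup>2 / pi * (- ?T) \<ge> 0" by (intro mult_nonneg_nonneg) auto
    then show ?thesis unfolding R using False x0 by (simp add: trunc_gauss_def power2_eq_square)
  qed
qed

lemma integrable_gauss_interp:
  assumes lam: "lam > 0"
  shows "integrable lborel (\<lambda>x. gauss_interp lam (of_real x))"
proof (rule Bochner_Integration.integrable_bound)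
  let ?S = "4 * (\<Sum>n. (real (Suc n))\<^sup>2 * exp (- pi * lam) ^ (Suc n)\<^sup>2)"
  show "integrable lborel (\<lambda>x. ?S * inverse (1 + x\<^sup>2))"
    using integrable_inverse_1_plus_square by (intro integrable_mult_right) (simp add: set_integrable_def einterval_def)
  show "(\<lambda>x. gauss_interp lam (of_real x)) \<in> borel_measurable lborel"
    by (auto intro!: borel_measurable_continuous_onI continuous_on_compose2[OF holomorphic_on_imp_continuous_on[OF gauss_interp_holomorphic[OF lam]]] continuous_intros)
  have "AE x in lborel. x \<notin> (\<int> :: real set)"
    by (intro AE_not_in countable_imp_null_set_lborel) (auto simp: Ints_def)
  then show "AE x in lborel. norm (gauss_interp lam (of_real x)) \<le> norm (?S * inverse (1 + x\<^sup>2))"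
  proof eventually_elim
    case (elim x)
    have "norm (gauss_interp lam (of_real x)) = \<bar>Re (gauss_interp lam (of_real x))\<bar>"
      using gauss_interp_real[OF lam] by (metis norm_of_real of_real_Re)
    also have "\<dots> \<le> ?S * inverse (1 + x\<^sup>2)" by (rule gauss_interp_real_series(2)[OF lam elim])
    finally show ?case by simp
  qed
qed

section \<open>Functions of exponential type\<close>

lemma norm_le_by_limit:
  fixes c :: real
  assumes "\<And>d::real. d > 0 \<Longrightarrow> c \<le> g d" "(g \<longlongrightarrow> l) (at_right 0)"
  shows "c \<le> l"
proof (rule tendsto_lowerbound[OF assms(2)])
  show "eventually (\<lambda>d. c \<le> g d) (at_right 0)"
    unfolding eventually_at_filter by (intro always_eventually) (use assms(1) in auto)
qed auto

text \<open>The bound is checked outside some open subset T of S, because the frontier of S cannot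
  meet T. This avoids computing the frontiers of quarter and half discs.\<close>

lemma maximum_modulus_closed:
  assumes S: "closed S" "bounded S" and T: "open T" "T \<subseteq> S"
    and F: "F holomorphic_on S" and le: "\<And>w. w \<in> S \<Longrightarrow> w \<notin> T \<Longrightarrow> norm (F w) \<le> M"
    and z: "z \<in> S"
  shows "norm (F z) \<le> M"
proof (rule maximum_modulus_frontier[OF _ _ S(2) _ z])
  show "F holomorphic_on interior S" using F interior_subset by (rule holomorphic_on_subset)
  show "continuous_on (closure S) F" using F S by (simp add: holomorphic_on_imp_continuous_on closure_closed)
  fix w assume "w \<in> frontier S"
  then have "w \<in> S" "w \<notin> interior S" using S by (auto simp: frontier_def closure_closed)
  then show "norm (F w) \<le> M" using le interior_maximal[OF T(2,1)] by blast
qed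

text \<open>The comparison factor exp(-d v^(3/2)) has order 3/2, between the order 1 of f and the
  critical order 2 of a quadrant. It beats exp(a |z|) on a large arc, has modulus at most 1 on the
  axes, and disappears as d -> 0.\<close>

lemma PL_quadrant:
  assumes hol: "f holomorphic_on UNIV"
    and growth: "\<And>z. norm (f z) \<le> C * exp (a * norm z)"
    and M: "M > 0"
    and re: "\<And>x. x \<ge> 0 \<Longrightarrow> norm (f (of_real x)) \<le> M"
    and im: "\<And>y. y \<ge> 0 \<Longrightarrow> norm (f (\<i> * of_real y)) \<le> M"
    and z: "Re z \<ge> 0" "Im z \<ge> 0"
  shows "norm (f z) \<le> M"
proof -
  \<comment> \<open>The rotation centres the quadrant at the positive axis, so |arg| <= pi/4; the
    shift by 1 preserves this and keeps the branch point of \<open>Ln\<close> away from the values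
    of \<open>v\<close>.\<close>
  define v where "v z = cis (-pi/4) * z + 1" for z
  define \<zeta> where "\<zeta> z = exp (3/2 * Ln (v z))" for z
  \<comment> \<open>3 pi/8 is 3/2 times pi/4, still below pi/2, so the real part of
    \<open>\<zeta> z\<close> dominates a positive multiple of |z|^(3/2).\<close>
  define \<kappa> where "\<kappa> = cos (3 * pi / 8)"
  have kpos: "\<kappa> > 0" unfolding \<kappa>_def by (intro cos_gt_zero) auto
  have v: "Re (v z) > 0" "\<bar>Im (v z)\<bar> \<le> Re (v z)" "norm (v z) \<ge> norm z" if "Re z \<ge> 0" "Im z \<ge> 0" for z
  proof -
    have e: "Re (v z) = sqrt 2 / 2 * (Re z + Im z) + 1" "Im (v z) = sqrt 2 / 2 * (Im z - Re z)"
      by (simp_all add: v_def cos_45 sin_45 algebra_simps)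
    then show 1: "Re (v z) > 0" using that by (simp add: add_nonneg_pos)
    have "sqrt 2 / 2 * \<bar>Im z - Re z\<bar> \<le> sqrt 2 / 2 * (Re z + Im z)"
      using that by (intro mult_left_mono) auto
    then show "\<bar>Im (v z)\<bar> \<le> Re (v z)" unfolding e
    proof -
      have "\<bar>sqrt 2 / 2 * (Im z - Re z)\<bar> = sqrt 2 / 2 * \<bar>Im z - Re z\<bar>" by (simp add: abs_mult)
      then show "\<bar>sqrt 2 / 2 * (Im z - Re z)\<bar> \<le> sqrt 2 / 2 * (Re z + Im z) + 1"
        using \<open>sqrt 2 / 2 * \<bar>Im z - Re z\<bar> \<le> sqrt 2 / 2 * (Re z + Im z)\<close> by linarith
    qed
    have n: "norm z = norm (cis (-pi/4) * z)" by (simp add: norm_mult)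
    also have "norm (cis (-pi/4) * z) \<le> norm (v z)"
      unfolding cmod_def real_sqrt_le_iff
    proof (intro add_mono)
      have "Re (cis (-pi/4) * z) = sqrt 2 / 2 * (Re z + Im z)"
        by (simp add: cos_45 sin_45 algebra_simps)
      moreover have "0 \<le> sqrt 2 / 2 * (Re z + Im z)" using that by simp
      ultimately have "0 \<le> Re (cis (-pi/4) * z)" by (simp only:)
      then show "(Re (cis (-pi/4) * z))\<^sup>2 \<le> (Re (v z))\<^sup>2"
        by (intro power_mono) (auto simp: v_def)
    qed (simp add: v_def)
    finally show "norm (v z) \<ge> norm z" .
  qed
  have Re\<zeta>: "Re (\<zeta> z) \<ge> \<kappa> * norm z powr (3/2)" if "Re z \<ge> 0" "Im z \<ge> 0" for z
  proof -
    note v = v[OF that]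
    have v0: "v z \<noteq> 0" using v(1) by auto
    have "\<bar>Im (Ln (v z))\<bar> \<le> pi / 4"
    proof -
      have "Im (Ln (v z)) = arctan (Im (v z) / Re (v z))"
        using v(1) by (metis Arg_def arg_conv_arctan v0 Arg_eq_Im_Ln)
      moreover have "\<bar>Im (v z) / Re (v z)\<bar> \<le> 1" using v by (simp add: abs_divide divide_le_eq)
      then have "Im (v z) / Re (v z) \<le> 1" "-1 \<le> Im (v z) / Re (v z)" by linarith+
      then have "arctan (Im (v z) / Re (v z)) \<le> arctan 1" "arctan (-1) \<le> arctan (Im (v z) / Re (v z))"
        by (simp_all only: arctan_le_iff)
      ultimately show ?thesis by (simp add: arctan_one arctan_minus)
    qed
    then have "cos (3 * pi / 8) \<le> cos \<bar>3/2 * Im (Ln (v z))\<bar>"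
      by (intro cos_monotone_0_pi_le) (auto simp: abs_mult)
    then have c: "\<kappa> \<le> cos (3/2 * Im (Ln (v z)))" unfolding \<kappa>_def cos_abs_real .
    have "Re (\<zeta> z) = norm (v z) powr (3/2) * cos (3/2 * Im (Ln (v z)))"
      unfolding \<zeta>_def Re_exp using v0 by (simp add: powr_def)
    also have "\<dots> \<ge> norm z powr (3/2) * \<kappa>"
      using v c kpos by (intro mult_mono powr_mono2) auto
    finally show ?thesis by (simp add: mult.commute)
  qed
  have main: "norm (f z) \<le> M * exp (d * norm (\<zeta> z))" if d: "d > 0" for d
  proof -
    have "((\<lambda>R. C * exp (a * R - d * \<kappa> * R powr (3/2))) \<longlongrightarrow> 0) at_top"
      using d kpos by real_asymp
    then have "eventually (\<lambda>R. C * exp (a * R - d * \<kappa> * R powr (3/2)) < M) at_top"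
      using M by (rule order_tendstoD)
    then have "eventually (\<lambda>R. C * exp (a * R - d * \<kappa> * R powr (3/2)) < M \<and> norm z \<le> R) at_top"
      using eventually_ge_at_top by (rule eventually_conj)
    then obtain R where R: "C * exp (a * R - d * \<kappa> * R powr (3/2)) < M" "norm z \<le> R"
      using eventually_happens'[OF trivial_limit_at_top_linorder] by blast
    define S where "S = {w. Re w \<ge> 0 \<and> Im w \<ge> 0 \<and> norm w \<le> R}"
    define F where "F w = f w * exp (- of_real d * \<zeta> w)" for w
    have clS: "closed S" unfolding S_def
      by (intro closed_Collect_conj closed_Collect_le continuous_intros)
    have bS: "bounded S" unfolding S_def by (auto simp: bounded_iff)
    have zS: "z \<in> S" using z R by (simp add: S_def)
    have nF: "norm (F w) \<le> norm (f w) * exp (- (d * \<kappa> * norm w powr (3/2)))" if "w \<in> S" for w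
    proof -
      have "d * (\<kappa> * norm w powr (3/2)) \<le> d * Re (\<zeta> w)"
        using Re\<zeta>[of w] that d by (intro mult_left_mono) (auto simp: S_def)
      then show ?thesis unfolding F_def norm_mult norm_exp_eq_Re by (intro mult_left_mono) (auto simp: mult.assoc)
    qed
    have hF: "F holomorphic_on S"
      unfolding F_def \<zeta>_def v_def
    proof (intro holomorphic_intros holomorphic_on_subset[OF hol])
      fix w assume "w \<in> S"
      then have "Re (v w) > 0" using v(1)[of w] by (simp add: S_def)
      then show "cis (-pi/4) * w + 1 \<notin> \<real>\<^sub>\<le>\<^sub>0" unfolding v_def by (auto simp: complex_nonpos_Reals_iff)
    qed auto
    have "norm (F z) \<le> M"
    proof (rule maximum_modulus_closed[OF clS bS _ _ hF _ zS])
      let ?T = "{w. Re w > 0 \<and> Im w > 0 \<and> norm w < R}"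
      show "open ?T" by (intro open_Collect_conj open_Collect_less continuous_intros)
      show "?T \<subseteq> S" by (auto simp: S_def)
      fix w assume wS: "w \<in> S" and "w \<notin> ?T"
      then consider "Re w = 0" | "Im w = 0" | "norm w = R" unfolding S_def by fastforce
      then show "norm (F w) \<le> M"
      proof cases
        case 3
        have "norm (F w) \<le> C * exp (a * R) * exp (- (d * \<kappa> * R powr (3/2)))"
        proof -
          have "norm (f w) * exp (- (d * \<kappa> * norm w powr (3/2))) \<le> C * exp (a * R) * exp (- (d * \<kappa> * R powr (3/2)))"
            unfolding 3 by (rule mult_right_mono) (use growth[of w] 3 in auto)
          then show ?thesis using nF[OF wS] by linarith
        qed
        also have "\<dots> = C * exp (a * R - d * \<kappa> * R powr (3/2))" by (simp add: exp_diff exp_minus field_simps)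
        finally show ?thesis using R by simp
      next
        case 1
        then have "w = \<i> * of_real (Im w)" by (simp add: complex_eq_iff)
        then have "norm (f w) \<le> M" using im[of "Im w"] wS by (simp add: S_def)
        moreover have "exp (- (d * \<kappa> * norm w powr (3/2))) \<le> 1" using d kpos by simp
        ultimately show ?thesis using nF[OF wS] by (meson M mult_left_le norm_ge_zero order_trans)
      next
        case 2
        then have "w = of_real (Re w)" by (simp add: complex_eq_iff)
        then have "norm (f w) \<le> M" using re[of "Re w"] wS by (simp add: S_def)
        moreover have "exp (- (d * \<kappa> * norm w powr (3/2))) \<le> 1" using d kpos by simp
        ultimately show ?thesis using nF[OF wS] by (meson M mult_left_le norm_ge_zero order_trans)
      qed
    qed
    moreover have "norm (F z) \<ge> norm (f z) * exp (- (d * norm (\<zeta> z)))"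
    proof -
      have "d * Re (\<zeta> z) \<le> d * norm (\<zeta> z)" using d complex_Re_le_cmod by (intro mult_left_mono) auto
      then show ?thesis unfolding F_def norm_mult norm_exp_eq_Re by (intro mult_left_mono) auto
    qed
    ultimately have "norm (f z) * exp (- (d * norm (\<zeta> z))) \<le> M" by linarith
    then have "norm (f z) * exp (- (d * norm (\<zeta> z))) * exp (d * norm (\<zeta> z)) \<le> M * exp (d * norm (\<zeta> z))"
      by (intro mult_right_mono) auto
    then show ?thesis by (simp add: mult.assoc exp_add[symmetric])
  qed
  have "((\<lambda>d. M * exp (d * norm (\<zeta> z))) \<longlongrightarrow> M * exp (0 * norm (\<zeta> z))) (at_right 0)"
    by (intro tendsto_intros)
  then show ?thesis using norm_le_by_limit[OF main] by simp
qed

text \<open>The factor exp(i (\<sigma> + e) z) makes f bounded on the positive imaginary axis, at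
  the price of a constant C that depends on e. The two quadrants give the bound B = max M C in the
  half plane; a second comparison, with 1/(1 - i d z), improves B to M, so that e -> 0 is
  possible.\<close>

lemma Phragmen_Lindelof_half_plane:
  assumes hol: "f holomorphic_on UNIV" and type: "exp_type_le \<sigma> f" and "\<sigma> \<ge> 0"
    and M: "M > 0" and re: "\<And>x. norm (f (of_real x)) \<le> M"
    and z: "Im z \<ge> 0"
  shows "norm (f z) \<le> M * exp (\<sigma> * Im z)"
proof -
  have main: "norm (f z) \<le> M * exp ((\<sigma> + e) * Im z)" if e: "e > 0" for e
  proof -
    obtain C where C: "C > 0" "\<And>z. norm (f z) \<le> C * exp ((\<sigma> + e) * norm z)"
      using type e unfolding exp_type_le_def by blast
    define g where "g z = f z * exp (\<i> * of_real (\<sigma> + e) * z)" for z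
    have ng: "norm (g z) = norm (f z) * exp (- ((\<sigma> + e) * Im z))" for z
      by (simp add: g_def norm_mult algebra_simps)
    have holg: "g holomorphic_on UNIV" unfolding g_def using hol by (intro holomorphic_intros)
    define B where "B = max M C"
    have B: "B > 0" "M \<le> B" "C \<le> B" using M by (auto simp: B_def)
    have gg: "norm (g z) \<le> C * exp (2 * (\<sigma> + e) * norm z)" for z
    proof -
      have "- ((\<sigma> + e) * Im z) \<le> (\<sigma> + e) * norm z"
        using mult_left_mono[of "- Im z" "norm z" "\<sigma> + e"] abs_Im_le_cmod[of z] e \<open>\<sigma> \<ge> 0\<close> by simp
      then have "norm (g z) \<le> (C * exp ((\<sigma> + e) * norm z)) * exp ((\<sigma> + e) * norm z)"
        unfolding ng using C by (intro mult_mono) auto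
      also have "\<dots> = C * exp (2 * (\<sigma> + e) * norm z)" by (simp add: exp_add[symmetric] algebra_simps)
      finally show ?thesis .
    qed
    have im: "norm (g (\<i> * of_real y)) \<le> B" if "y \<ge> 0" for y
    proof -
      have "norm (g (\<i> * of_real y)) \<le> C * exp ((\<sigma> + e) * y) * exp (- ((\<sigma> + e) * y))"
        using C(2)[of "\<i> * of_real y"] that unfolding ng by (simp add: norm_mult)
      also have "\<dots> = C" by (simp add: mult.assoc exp_add[symmetric])
      finally show ?thesis using B by simp
    qed
    have reg: "norm (g (of_real x)) \<le> M" for x using re[of x] by (simp add: ng)
    have bounded: "norm (g w) \<le> B" if w: "Im w \<ge> 0" for w
    proof (cases "Re w \<ge> 0")
      case True
      show ?thesis
        by (rule PL_quadrant[OF holg gg B(1)]) (use reg B im w True order_trans in blast)+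
    next
      case False
      \<comment> \<open>Multiplication by i carries the first quadrant to the second, so the
        quadrant result applies to \<open>h\<close> at -i w.\<close>
      define h where "h z = g (\<i> * z)" for z
      have "norm (h (- \<i> * w)) \<le> B"
      proof (rule PL_quadrant[of h])
        show "h holomorphic_on UNIV" unfolding h_def
          by (rule holomorphic_on_compose_gen[OF _ holg, unfolded o_def]) (auto intro!: holomorphic_intros)
        show "norm (h z) \<le> C * exp (2 * (\<sigma> + e) * norm z)" for z
          using gg[of "\<i> * z"] by (simp add: h_def norm_mult)
        show "norm (h (of_real x)) \<le> B" if "x \<ge> 0" for x
          using im[OF that] by (simp add: h_def)
        show "norm (h (\<i> * of_real y)) \<le> B" if "y \<ge> 0" for y
          using reg[of "-y"] B by (simp add: h_def flip: mult.assoc)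
      qed (use B w False in auto)
      then show ?thesis by (simp add: h_def flip: mult.assoc)
    qed
    \<comment> \<open>As g is bounded by B, the quotient g/(1 - i d w) is below M on a large arc,
      where |1 - i d w| >= d R - 1, and also on the real line, where the denominator has modulus at
      least 1.\<close>
    have "norm (g z) \<le> M * norm (1 - \<i> * of_real d * z)" if d: "d > 0" for d
    proof -
      have "((\<lambda>R. B / (d * R - 1)) \<longlongrightarrow> 0) at_top" using d by real_asymp
      then have "eventually (\<lambda>R. B / (d * R - 1) < M) at_top" using M by (rule order_tendstoD)
      then have "eventually (\<lambda>R. B / (d * R - 1) < M \<and> norm z \<le> R \<and> 1 / d < R) at_top"
        using eventually_ge_at_top[of "norm z"] eventually_gt_at_top[of "1/d"] by eventually_elim auto
      then obtain R where R: "B / (d * R - 1) < M" "norm z \<le> R" "1 / d < R"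
        using eventually_happens'[OF trivial_limit_at_top_linorder] by blast
      define S where "S = {w. Im w \<ge> 0 \<and> norm w \<le> R}"
      define F where "F w = g w / (1 - \<i> * of_real d * w)" for w
      have den: "norm (1 - \<i> * of_real d * w) \<ge> 1" if "Im w \<ge> 0" for w
      proof -
        have "1 + d * Im w \<le> norm (1 - \<i> * of_real d * w)"
          using complex_Re_le_cmod[of "1 - \<i> * of_real d * w"] by simp
        moreover have "0 \<le> d * Im w" using that d by simp
        ultimately show ?thesis by linarith
      qed
      have clS: "closed S" unfolding S_def
        by (intro closed_Collect_conj closed_Collect_le continuous_intros)
      have bS: "bounded S" unfolding S_def by (auto simp: bounded_iff)
      have zS: "z \<in> S" using z R by (simp add: S_def)
      have hF: "F holomorphic_on S"
        unfolding F_def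
      proof (intro holomorphic_intros holomorphic_on_subset[OF holg])
        fix w assume "w \<in> S"
        then show "1 - \<i> * of_real d * w \<noteq> 0" using den[of w] unfolding S_def
          by (metis (mono_tags, lifting) mem_Collect_eq norm_zero not_one_le_zero)
      qed auto
      have "norm (F z) \<le> M"
      proof (rule maximum_modulus_closed[OF clS bS _ _ hF _ zS])
        let ?T = "{w. Im w > 0 \<and> norm w < R}"
        show "open ?T" by (intro open_Collect_conj open_Collect_less continuous_intros)
        show "?T \<subseteq> S" by (auto simp: S_def)
        fix w assume wS: "w \<in> S" and "w \<notin> ?T"
        then have "Im w = 0 \<or> norm w = R" by (auto simp: S_def)
        then show "norm (F w) \<le> M"
        proof
          assume "Im w = 0"
          then have "w = of_real (Re w)" by (simp add: complex_eq_iff)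
          then have "norm (g w) \<le> M" using reg[of "Re w"] by simp
          then have "norm (g w) / norm (1 - \<i> * of_real d * w) \<le> M / 1"
            using den[of w] \<open>Im w = 0\<close> M by (intro frac_le) auto
          then show ?thesis by (simp add: F_def norm_divide)
        next
          assume nw: "norm w = R"
          have "d * R - 1 \<le> norm (1 - \<i> * of_real d * w)"
            using norm_triangle_ineq2[of "\<i> * of_real d * w" 1] nw d by (simp add: norm_mult norm_minus_commute)
          moreover have "d * R - 1 > 0" using R d by (simp add: field_simps)
          ultimately have "norm (g w) / norm (1 - \<i> * of_real d * w) \<le> B / (d * R - 1)"
            using bounded[of w] wS B by (intro frac_le) (auto simp: S_def)
          then show ?thesis using R by (simp add: F_def norm_divide)
        qed
      qed
      then have "norm (g z) / norm (1 - \<i> * of_real d * z) \<le> M" by (simp add: F_def norm_divide)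
      moreover have "norm (1 - \<i> * of_real d * z) > 0" using den[OF z] by linarith
      ultimately show ?thesis by (simp add: divide_le_eq)
    qed
    moreover have "((\<lambda>d. M * norm (1 - \<i> * of_real d * z)) \<longlongrightarrow> M * norm (1 - \<i> * of_real 0 * z)) (at_right 0)"
      by (intro tendsto_intros)
    ultimately have "norm (g z) \<le> M" using norm_le_by_limit by fastforce
    then have "norm (f z) * exp (- ((\<sigma> + e) * Im z)) * exp ((\<sigma> + e) * Im z) \<le> M * exp ((\<sigma> + e) * Im z)"
      unfolding ng by (intro mult_right_mono) auto
    then show ?thesis by (simp add: mult.assoc exp_add[symmetric])
  qed
  have "((\<lambda>e. M * exp ((\<sigma> + e) * Im z)) \<longlongrightarrow> M * exp ((\<sigma> + 0) * Im z)) (at_right 0)"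
    by (intro tendsto_intros)
  then show ?thesis using norm_le_by_limit[OF main] by simp
qed

lemma exp_type_bound_of_bounded:
  assumes hol: "f holomorphic_on UNIV" and type: "exp_type_le \<sigma> f" and "\<sigma> \<ge> 0"
    and M: "M > 0" and re: "\<And>x. norm (f (of_real x)) \<le> M"
  shows "norm (f z) \<le> M * exp (\<sigma> * \<bar>Im z\<bar>)"
proof (cases "Im z \<ge> 0")
  case True
  then show ?thesis using Phragmen_Lindelof_half_plane[OF assms] by simp
next
  case False
  have "norm (f (- (- z))) \<le> M * exp (\<sigma> * Im (- z))"
  proof (rule Phragmen_Lindelof_half_plane[of "\<lambda>z. f (- z)"])
    show "(\<lambda>z. f (- z)) holomorphic_on UNIV"
      by (rule holomorphic_on_compose_gen[OF _ hol, unfolded o_def]) (auto intro!: holomorphic_intros)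
    show "exp_type_le \<sigma> (\<lambda>z. f (- z))"
      using type unfolding exp_type_le_def by (metis norm_minus_cancel)
    show "norm (f (- of_real x)) \<le> M" for x using re[of "-x"] by simp
  qed (use False assms in auto)
  then show ?thesis using False by simp
qed


lemma exp_type_le_diff:
  assumes "exp_type_le \<sigma> f" "exp_type_le \<sigma> g"
  shows "exp_type_le \<sigma> (\<lambda>z. f z - g z)"
  unfolding exp_type_le_def
proof (intro allI impI)
  fix e :: real assume e: "e > 0"
  obtain C D where C: "C > 0" "\<And>z. norm (f z) \<le> C * exp ((\<sigma> + e) * norm z)"
    and D: "D > 0" "\<And>z. norm (g z) \<le> D * exp ((\<sigma> + e) * norm z)"
    using assms e unfolding exp_type_le_def by meson
  have "norm (f z - g z) \<le> (C + D) * exp ((\<sigma> + e) * norm z)" for z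
    using norm_triangle_ineq4[of "f z" "g z"] C(2)[of z] D(2)[of z] by (simp add: distrib_right)
  then show "\<exists>C>0. \<forall>z. norm (f z - g z) \<le> C * exp ((\<sigma> + e) * norm z)"
    using C D by (intro exI[of _ "C + D"]) auto
qed

lemma entire_primitive:
  assumes hol: "J holomorphic_on UNIV"
  obtains F where "\<And>z. (F has_field_derivative J z) (at z)" "F 0 = 0"
proof -
  obtain g where g: "\<And>z. (g has_field_derivative J z) (at z)"
    using holomorphic_convex_primitive'[OF convex_UNIV open_UNIV hol] by auto
  show ?thesis
  proof
    show "((\<lambda>z. g z - g 0) has_field_derivative J z) (at z)" for z
      using g by (auto intro!: derivative_eq_intros)
  qed simp
qed

lemma exp_type_le_primitive:
  assumes F: "\<And>z. (F has_field_derivative J z) (at z)" "F 0 = 0"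
    and type: "exp_type_le \<sigma> J" and \<sigma>: "\<sigma> \<ge> 0"
  shows "exp_type_le \<sigma> F"
  unfolding exp_type_le_def
proof (intro allI impI)
  fix e :: real assume e: "e > 0"
  obtain C where C: "C > 0" "\<And>z. norm (J z) \<le> C * exp ((\<sigma> + e/2) * norm z)"
    using type e unfolding exp_type_le_def by (meson half_gt_zero)
  have "norm (F z) \<le> C * (2/e) * exp ((\<sigma> + e) * norm z)" for z
  proof -
    have "norm (F z - F 0) \<le> C * exp ((\<sigma> + e/2) * norm z) * norm (z - 0)"
    proof (rule field_differentiable_bound[of "cball 0 (norm z)"])
      fix w :: complex assume w: "w \<in> cball 0 (norm z)"
      show "(F has_field_derivative J w) (at w within cball 0 (norm z))"
        using F(1) by (rule has_field_derivative_at_within)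
      have "exp ((\<sigma> + e/2) * norm w) \<le> exp ((\<sigma> + e/2) * norm z)"
        using w \<sigma> e by (auto intro!: mult_left_mono)
      then show "norm (J w) \<le> C * exp ((\<sigma> + e/2) * norm z)"
        using C by (meson mult_left_mono less_imp_le order_trans)
    qed auto
    \<comment> \<open>The length |z| of the path from 0 is paid for with the second half of
      e.\<close>
    moreover have "norm z \<le> (2/e) * exp (e/2 * norm z)"
      using exp_ge_add_one_self[of "e/2 * norm z"] e by (simp add: field_simps)
    then have "C * exp ((\<sigma> + e/2) * norm z) * norm z \<le> C * exp ((\<sigma> + e/2) * norm z) * ((2/e) * exp (e/2 * norm z))"
      using C by (intro mult_left_mono) auto
    ultimately have "norm (F z) \<le> C * exp ((\<sigma> + e/2) * norm z) * ((2/e) * exp (e/2 * norm z))"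
      using F(2) by (simp only: diff_zero)
    also have "\<dots> = C * (2/e) * (exp ((\<sigma> + e/2) * norm z) * exp (e/2 * norm z))" by simp
    also have "exp ((\<sigma> + e/2) * norm z) * exp (e/2 * norm z) = exp ((\<sigma> + e) * norm z)"
      by (simp add: exp_add[symmetric] algebra_simps)
    finally show ?thesis .
  qed
  then show "\<exists>C>0. \<forall>z. norm (F z) \<le> C * exp ((\<sigma> + e) * norm z)"
    using C e by (intro exI[of _ "C * (2/e)"]) auto
qed

lemma primitive_bounded_on_reals:
  fixes F J :: "complex \<Rightarrow> complex"
  assumes F: "\<And>z. (F has_field_derivative J z) (at z)" "F 0 = 0"
    and int: "integrable lborel (\<lambda>x. J (of_real x))"
  shows "norm (F (of_real x)) \<le> (\<integral>x. norm (J (of_real x)) \<partial>lborel)"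
proof -
  let ?j = "\<lambda>x::real. J (of_real x)" and ?I = "\<integral>x. norm (J (of_real x)) \<partial>lborel"
  have FTC: "norm (F (of_real b) - F (of_real a)) \<le> ?I" if "a \<le> b" for a b :: real
  proof -
    have "(?j has_integral F (of_real b) - F (of_real a)) {a..b}"
    proof (rule fundamental_theorem_of_calculus[OF that])
      fix t
      show "((\<lambda>x. F (of_real x)) has_vector_derivative ?j t) (at t within {a..b})"
        by (rule has_vector_derivative_real_field[OF F(1)])
    qed
    moreover have si: "set_integrable lborel {a..b} ?j"
      unfolding set_integrable_def using int by (intro integrable_mult_indicator) auto
    ultimately have "F (of_real b) - F (of_real a) = (LINT x:{a..b}|lborel. ?j x)"
      by (metis set_borel_integral_eq_integral(2) integral_unique)
    also have "norm \<dots> \<le> (LINT x:{a..b}|lborel. norm (?j x))"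
      using si by (rule set_integral_norm_bound)
    also have "\<dots> \<le> ?I"
      unfolding set_lebesgue_integral_def
    proof (rule integral_mono)
      show "integrable lborel (\<lambda>x. indicator {a..b} x *\<^sub>R norm (?j x))"
        using set_integrable_norm[OF si] by (simp only: set_integrable_def)
      show "integrable lborel (\<lambda>x. norm (?j x))" using int by (rule integrable_norm)
    qed (simp add: indicator_def)
    finally show ?thesis .
  qed
  show ?thesis using FTC[of 0 x] FTC[of x 0] F(2) by (cases "x \<ge> 0") auto
qed

text \<open>Integrability on the line does not directly bound J there pointwise, but it bounds the
  primitive of J. The Phragmen-Lindelof bound is applied to the primitive, and Cauchy's inequality
  on unit discs returns to J; moving by 1 in the imaginary direction costs the factor exp
  \<sigma>.\<close>

lemma exp_type_bound_of_integrable: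
  assumes hol: "J holomorphic_on UNIV" and type: "exp_type_le \<sigma> J" and \<sigma>: "\<sigma> \<ge> 0"
    and int: "integrable lborel (\<lambda>x. J (of_real x))"
  obtains M where "M > 0" "\<And>z. norm (J z) \<le> M * exp (\<sigma> * \<bar>Im z\<bar>)"
proof -
  obtain F where F: "\<And>z. (F has_field_derivative J z) (at z)" "F 0 = 0"
    using entire_primitive[OF hol] by blast
  define B where "B = (\<integral>x. norm (J (of_real x)) \<partial>lborel) + 1"
  have B: "B > 0" unfolding B_def by (intro add_nonneg_pos Bochner_Integration.integral_nonneg) auto
  have holF: "F holomorphic_on UNIV"
    using F(1) by (auto simp: holomorphic_on_def field_differentiable_def intro: has_field_derivative_at_within)
  have bF: "norm (F z) \<le> B * exp (\<sigma> * \<bar>Im z\<bar>)" for z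
  proof (rule exp_type_bound_of_bounded[OF holF exp_type_le_primitive[OF F type \<sigma>] \<sigma> B])
    show "norm (F (of_real x)) \<le> B" for x
      using primitive_bounded_on_reals[OF F int, of x] by (simp add: B_def)
  qed
  show ?thesis
  proof
    show "B * exp \<sigma> > 0" using B by simp
    fix z
    have "norm ((deriv ^^ 1) F z) \<le> fact 1 * (B * exp \<sigma> * exp (\<sigma> * \<bar>Im z\<bar>)) / 1 ^ 1"
    proof (rule Cauchy_inequality)
      show "F holomorphic_on ball z 1" using holF by (rule holomorphic_on_subset) auto
      show "continuous_on (cball z 1) F" using holF by (meson holomorphic_on_imp_continuous_on holomorphic_on_subset subset_UNIV)
      fix w assume "norm (z - w) = 1"
      then have "\<bar>Im w\<bar> \<le> \<bar>Im z\<bar> + 1" using abs_Im_le_cmod[of "z - w"] by simp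
      then have "\<sigma> * \<bar>Im w\<bar> \<le> \<sigma> * (\<bar>Im z\<bar> + 1)" using \<sigma> by (rule mult_left_mono)
      then have "exp (\<sigma> * \<bar>Im w\<bar>) \<le> exp \<sigma> * exp (\<sigma> * \<bar>Im z\<bar>)"
        by (simp add: exp_add[symmetric] algebra_simps)
      then have "B * exp (\<sigma> * \<bar>Im w\<bar>) \<le> B * (exp \<sigma> * exp (\<sigma> * \<bar>Im z\<bar>))"
        using B by (intro mult_left_mono) auto
      then show "norm (F w) \<le> B * exp \<sigma> * exp (\<sigma> * \<bar>Im z\<bar>)" using bF[of w] by simp
    qed simp
    moreover have "deriv F z = J z" using F(1) by (rule DERIV_imp_deriv)
    ultimately show "norm (J z) \<le> B * exp \<sigma> * exp (\<sigma> * \<bar>Im z\<bar>)" by simp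
  qed
qed

section \<open>Vanishing of high-frequency Fourier integrals\<close>

lemma integral_tendsto_truncated:
  fixes f :: "real \<Rightarrow> 'a :: {banach, second_countable_topology}"
  assumes "integrable lborel f"
  shows "(\<lambda>n. LINT x:{-real n..real n}|lborel. f x) \<longlonglongrightarrow> (\<integral>x. f x \<partial>lborel)"
  unfolding set_lebesgue_integral_def
proof (rule integral_dominated_convergence[where w = "\<lambda>x. norm (f x)"])
  show "AE x in lborel. (\<lambda>n. indicator {-real n..real n} x *\<^sub>R f x) \<longlonglongrightarrow> f x"
  proof (rule AE_I2)
    fix x :: real
    have "eventually (\<lambda>n. f x = indicator {-real n..real n} x *\<^sub>R f x) sequentially"
      using eventually_ge_at_top[of "nat \<lceil>\<bar>x\<bar>\<rceil>"]
      by eventually_elim (auto simp: indicator_def)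
    then show "(\<lambda>n. indicator {-real n..real n} x *\<^sub>R f x) \<longlonglongrightarrow> f x"
      by (rule Lim_transform_eventually[OF tendsto_const])
  qed
qed (use assms in \<open>auto simp: indicator_def\<close>)

text \<open>Cauchy's theorem on the rectangle with base [-X, X] and height X. The top side decays
  exponentially because w > \<sigma>. On the vertical sides the undamped integrand is controlled
  only to order 1/(w - \<sigma>), uniformly in X; the damping factor, whose pole -i/d lies below the
  real line, supplies the missing 1/(d X).\<close>

lemma damped_Fourier_integral_zero:
  assumes hol: "J holomorphic_on UNIV"
    and M: "M > 0" "\<And>z. norm (J z) \<le> M * exp (\<sigma> * \<bar>Im z\<bar>)"
    and int: "integrable lborel (\<lambda>x. J (of_real x))"
    and w: "w > \<sigma>" and d: "d > 0"
  shows "integrable lborel (\<lambda>x. J (of_real x) * exp (\<i> * of_real w * of_real x) / (1 - \<i> * of_real d * of_real x))"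
    and "(\<integral>x. J (of_real x) * exp (\<i> * of_real w * of_real x) / (1 - \<i> * of_real d * of_real x) \<partial>lborel) = 0"
proof -
  define h where "h z = J z * exp (\<i> * of_real w * z) / (1 - \<i> * of_real d * z)" for z
  define U where "U = {z. Im z > - (1/d)}"
  have U: "convex U" "open U" unfolding U_def by (auto simp: convex_halfspace_Im_gt open_halfspace_Im_gt)
  have den: "1 - \<i> * of_real d * z \<noteq> 0" if "z \<in> U" for z
  proof -
    have "- 1 < d * Im z" using that d by (simp add: U_def field_simps)
    then have "Re (1 - \<i> * of_real d * z) > 0" by simp
    then show ?thesis by force
  qed
  have holh: "h holomorphic_on U" unfolding h_def
    by (intro holomorphic_intros den holomorphic_on_subset[OF hol]) auto
  \<comment> \<open>A primitive on the convex half plane takes the place of contour integrals: each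
    side of the rectangle becomes a difference of values of \<open>H\<close>.\<close>
  obtain H where H: "\<And>z. z \<in> U \<Longrightarrow> (H has_field_derivative h z) (at z)"
    using holomorphic_convex_primitive'[OF U holh] at_within_open[OF _ U(2)] by metis
  have inU: "z \<in> U" if "Im z \<ge> 0" for z
  proof -
    have "- (1/d) < 0" using d by simp
    then have "- (1/d) < Im z" using that by linarith
    then show ?thesis by (simp add: U_def)
  qed
  have nh: "norm (h z) \<le> M * exp ((\<sigma> - w) * Im z) / c"
    if z: "Im z \<ge> 0" and c: "c > 0" "c \<le> norm (1 - \<i> * of_real d * z)" for z c
  proof -
    have "norm (J z * exp (\<i> * of_real w * z)) \<le> (M * exp (\<sigma> * Im z)) * exp (- (w * Im z))"
      using M(2)[of z] z by (simp add: norm_mult)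
    also have "\<dots> = M * exp ((\<sigma> - w) * Im z)" by (simp add: mult.assoc exp_add[symmetric] algebra_simps)
    finally show ?thesis unfolding h_def norm_divide using c M(1) by (intro frac_le) (auto simp: less_imp_le)
  qed
  have den1: "1 \<le> norm (1 - \<i> * of_real d * z)" if "Im z \<ge> 0" for z
  proof -
    have "1 + d * Im z \<le> norm (1 - \<i> * of_real d * z)"
      using complex_Re_le_cmod[of "1 - \<i> * of_real d * z"] by simp
    moreover have "0 \<le> d * Im z" using that d by simp
    ultimately show ?thesis by linarith
  qed
  have denX: "d * \<bar>Re z\<bar> \<le> norm (1 - \<i> * of_real d * z)" for z
    using abs_Im_le_cmod[of "1 - \<i> * of_real d * z"] d by (simp add: abs_mult)
  have hr: "norm (h (of_real x)) \<le> norm (J (of_real x))" for x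
  proof -
    have "norm (h (of_real x)) = norm (J (of_real x)) / norm (1 - \<i> * of_real d * of_real x)"
      unfolding h_def by (simp add: norm_mult norm_divide)
    also have "\<dots> \<le> norm (J (of_real x)) / 1" using den1[of "of_real x"] by (intro frac_le) auto
    finally show ?thesis by simp
  qed
  have conth: "continuous_on UNIV (\<lambda>x. h (of_real x))"
    by (rule continuous_on_compose2[OF holomorphic_on_imp_continuous_on[OF holh]])
       (auto intro!: continuous_intros inU)
  show inth: "integrable lborel (\<lambda>x. J (of_real x) * exp (\<i> * of_real w * of_real x) / (1 - \<i> * of_real d * of_real x))"
    unfolding h_def[symmetric]
    by (rule Bochner_Integration.integrable_bound[OF int])
       (use conth hr in \<open>auto intro: borel_measurable_continuous_onI\<close>)
  have side: "norm (H (of_real a + \<i> * of_real X) - H (of_real a)) \<le> M / (d * X * (w - \<sigma>))" if X: "X > 0" "\<bar>a\<bar> = X" for a X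
  proof -
    \<comment> \<open>\<open>\<phi>\<close> is an antiderivative of the bound M exp((\<sigma> - w)
      y)/(d X) along a vertical side; its increase over [0, X] is at most M/(d X (w -
      \<sigma>)).\<close>
    define \<phi> where "\<phi> y = - (M / (d * X * (w - \<sigma>))) * exp ((\<sigma> - w) * y)" for y
    have "norm (H (of_real a + \<i> * of_real X) - H (of_real a + \<i> * of_real 0)) \<le> \<phi> X - \<phi> 0"
    proof (rule differentiable_bound_general[OF X(1)])
      show dH: "((\<lambda>y. H (of_real a + \<i> * of_real y)) has_vector_derivative h (of_real a + \<i> * of_real y) * \<i>) (at y)"
        if "0 < y" "y < X" for y
      proof -
        have "((\<lambda>z. H (of_real a + \<i> * z)) has_field_derivative h (of_real a + \<i> * of_real y) * \<i>) (at (of_real y))"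
          by (rule DERIV_chain2[where f=H]) (use that in \<open>auto intro!: H inU derivative_eq_intros\<close>)
        then show ?thesis by (rule has_vector_derivative_real_field)
      qed
      have ch: "isCont H z" if "z \<in> U" for z using H[OF that] by (rule DERIV_isCont)
      show "continuous_on {0..X} (\<lambda>y. H (of_real a + \<i> * of_real y))"
      proof (rule continuous_on_compose2[of U H])
        show "continuous_on U H" using ch by (intro continuous_at_imp_continuous_on) auto
        show "(\<lambda>y. of_real a + \<i> * of_real y) ` {0..X} \<subseteq> U" by (auto intro: inU)
      qed (intro continuous_intros)
      show "continuous_on {0..X} \<phi>" unfolding \<phi>_def by (intro continuous_intros)
      show "(\<phi> has_vector_derivative M * exp ((\<sigma> - w) * y) / (d * X)) (at y)" for y
      proof -
        have "(\<phi> has_real_derivative - (M / (d * X * (w - \<sigma>))) * (exp ((\<sigma> - w) * y) * (\<sigma> - w))) (at y)"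
          unfolding \<phi>_def by (intro DERIV_cmult) (auto intro!: derivative_eq_intros)
        also have "- (M / (d * X * (w - \<sigma>))) * (exp ((\<sigma> - w) * y) * (\<sigma> - w)) = M * exp ((\<sigma> - w) * y) / (d * X)"
        proof -
          have "- (M / (d * X * u)) * (E * (- u)) = M * E / (d * X)" if "u \<noteq> 0" for u E
            using that by simp
          from this[of "w - \<sigma>" "exp ((\<sigma> - w) * y)"] show ?thesis using w by simp
        qed
        finally show ?thesis by (simp add: has_real_derivative_iff_has_vector_derivative)
      qed
      show "norm (h (of_real a + \<i> * of_real y) * \<i>) \<le> M * exp ((\<sigma> - w) * y) / (d * X)" if "0 < y" "y < X" for y
        using nh[of "of_real a + \<i> * of_real y" "d * X"] denX[of "of_real a + \<i> * of_real y"] that X d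
        by (simp add: norm_mult)
    qed
    also have "\<phi> X - \<phi> 0 \<le> M / (d * X * (w - \<sigma>))"
      using X M w d by (simp add: \<phi>_def)
    finally show ?thesis by simp
  qed
  have top: "norm (H (of_real X + \<i> * of_real X) - H (of_real (-X) + \<i> * of_real X)) \<le> M * exp ((\<sigma> - w) * X) * (2 * X)" if X: "X > 0" for X
  proof -
    let ?S = "closed_segment (of_real (-X) + \<i> * of_real X) (of_real X + \<i> * of_real X)"
    have im: "Im z = X" if "z \<in> ?S" for z
    proof -
      obtain u where "z = (1 - u) *\<^sub>R (of_real (-X) + \<i> * of_real X) + u *\<^sub>R (of_real X + \<i> * of_real X)"
        using \<open>z \<in> ?S\<close> unfolding in_segment by blast
      then have "Im z = (1 - u) * X + u * X" by simp
      then show ?thesis by (simp add: algebra_simps)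
    qed
    have "norm (H (of_real X + \<i> * of_real X) - H (of_real (-X) + \<i> * of_real X)) \<le>
       M * exp ((\<sigma> - w) * X) * norm ((of_real X + \<i> * of_real X) - (of_real (-X) + \<i> * of_real X) :: complex)"
    proof (rule field_differentiable_bound[of ?S])
      fix z assume z: "z \<in> ?S"
      show "(H has_field_derivative h z) (at z within ?S)"
        by (rule has_field_derivative_at_within[OF H[OF inU]]) (use im[OF z] X in simp)
      show "norm (h z) \<le> M * exp ((\<sigma> - w) * X)"
        using nh[of z 1] den1[of z] im[OF z] X by simp
    qed auto
    also have "norm ((of_real X + \<i> * of_real X) - (of_real (-X) + \<i> * of_real X) :: complex) = 2 * X"
    proof -
      have "(of_real X + \<i> * of_real X) - (of_real (-X) + \<i> * of_real X) = complex_of_real (2 * X)" by simp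
      then show ?thesis using X by (simp only: norm_of_real)
    qed
    finally show ?thesis .
  qed
  have trunc: "norm (LINT x:{-X..X}|lborel. h (of_real x)) \<le> 2 * (M / (d * X * (w - \<sigma>))) + M * exp ((\<sigma> - w) * X) * (2 * X)" if X: "X > 0" for X
  proof -
    have "((\<lambda>x. h (of_real x)) has_integral H (of_real X) - H (of_real (-X))) {-X..X}"
      using X by (intro fundamental_theorem_of_calculus has_vector_derivative_real_field H inU) auto
    moreover have "set_integrable lborel {-X..X} (\<lambda>x. h (of_real x))"
      using conth by (intro borel_integrable_atLeastAtMost') (auto intro: continuous_on_subset)
    ultimately have "(LINT x:{-X..X}|lborel. h (of_real x)) = H (of_real X) - H (of_real (-X))"
      by (metis set_borel_integral_eq_integral(2) integral_unique)
    also have "\<dots> = (H (of_real (-X) + \<i> * of_real X) - H (of_real (-X))) - (H (of_real X + \<i> * of_real X) - H (of_real X)) +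
       (H (of_real X + \<i> * of_real X) - H (of_real (-X) + \<i> * of_real X))" by simp
    also have "norm \<dots> \<le> 2 * (M / (d * X * (w - \<sigma>))) + M * exp ((\<sigma> - w) * X) * (2 * X)"
    proof -
      have t: "norm (A - B + C) \<le> 2 * s + t" if "norm A \<le> s" "norm B \<le> s" "norm C \<le> t" for A B C :: complex and s t
        using that norm_triangle_ineq[of "A - B" C] norm_triangle_ineq4[of A B] by linarith
      show ?thesis by (rule t) (use side[of X X] side[of X "-X"] top[of X] X in auto)
    qed
    finally show ?thesis .
  qed
  have "(\<lambda>n. LINT x:{-real n..real n}|lborel. h (of_real x)) \<longlonglongrightarrow> 0"
  proof (rule Lim_null_comparison)
    show "eventually (\<lambda>n. norm (LINT x:{-real n..real n}|lborel. h (of_real x)) \<le>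
       2 * (M / (d * real n * (w - \<sigma>))) + M * exp ((\<sigma> - w) * real n) * (2 * real n)) sequentially"
      using eventually_gt_at_top[of 0] by eventually_elim (rule trunc, simp)
    show "(\<lambda>n. 2 * (M / (d * real n * (w - \<sigma>))) + M * exp ((\<sigma> - w) * real n) * (2 * real n)) \<longlonglongrightarrow> 0"
      using w d M by real_asymp
  qed
  then show "(\<integral>x. J (of_real x) * exp (\<i> * of_real w * of_real x) / (1 - \<i> * of_real d * of_real x) \<partial>lborel) = 0"
    using integral_tendsto_truncated[of "\<lambda>x. h (of_real x)"] inth unfolding h_def by (blast intro: LIMSEQ_unique)
qed

text \<open>The borderline w = \<sigma> matters because the square wave contains the frequency pi.
  One null sequence \<open>d n\<close> serves both as damping parameter and as excess frequency, and
  |J| dominates.\<close>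

lemma Fourier_integral_zero:
  assumes hol: "J holomorphic_on UNIV"
    and M: "M > 0" "\<And>z. norm (J z) \<le> M * exp (\<sigma> * \<bar>Im z\<bar>)"
    and int: "integrable lborel (\<lambda>x. J (of_real x))"
    and w: "w \<ge> \<sigma>"
  shows "(\<integral>x. J (of_real x) * exp (\<i> * of_real w * of_real x) \<partial>lborel) = 0"
proof -
  let ?j = "\<lambda>x::real. J (of_real x)"
  define d where "d n = 1 / real (Suc n)" for n
  have d: "d n > 0" "d \<longlonglongrightarrow> 0" for n unfolding d_def by (simp, real_asymp)
  let ?g = "\<lambda>n x. ?j x * exp (\<i> * of_real (w + d n) * of_real x) / (1 - \<i> * of_real (d n) * of_real x)"
  have "(\<lambda>n. \<integral>x. ?g n x \<partial>lborel) \<longlonglongrightarrow> (\<integral>x. ?j x * exp (\<i> * of_real w * of_real x) \<partial>lborel)"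
  proof (rule integral_dominated_convergence[where w = "\<lambda>x. norm (?j x)"])
    show "(\<lambda>x. ?j x * exp (\<i> * of_real w * of_real x)) \<in> borel_measurable lborel"
      using int by measurable
    show "?g n \<in> borel_measurable lborel" for n using int by measurable
    show "AE x in lborel. (\<lambda>n. ?g n x) \<longlonglongrightarrow> ?j x * exp (\<i> * of_real w * of_real x)"
    proof (rule AE_I2)
      fix x :: real
      have "(\<lambda>n. ?g n x) \<longlonglongrightarrow> ?j x * exp (\<i> * of_real (w + 0) * of_real x) / (1 - \<i> * of_real 0 * of_real x)"
        by (intro tendsto_intros d) auto
      then show "(\<lambda>n. ?g n x) \<longlonglongrightarrow> ?j x * exp (\<i> * of_real w * of_real x)" by simp
    qed
    fix n
    show "AE x in lborel. norm (?g n x) \<le> norm (?j x)"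
    proof (rule AE_I2)
      fix x :: real
      have "1 \<le> norm (1 - \<i> * of_real (d n) * of_real x)"
        using complex_Re_le_cmod[of "1 - \<i> * of_real (d n) * of_real x"] by simp
      then have "norm (?j x) / norm (1 - \<i> * of_real (d n) * of_real x) \<le> norm (?j x) / 1"
        by (intro frac_le) auto
      then show "norm (?g n x) \<le> norm (?j x)" by (simp add: norm_mult norm_divide)
    qed
  qed (use int in auto)
  moreover have "(\<integral>x. ?g n x \<partial>lborel) = 0" for n
    using damped_Fourier_integral_zero(2)[OF hol M int, of "w + d n" "d n"] d w by (simp add: add_strict_increasing2 add.commute)
  ultimately show ?thesis by (simp add: LIMSEQ_const_iff)
qed

lemma sine_integral_zero:
  assumes hol: "J holomorphic_on UNIV" and type: "exp_type_le \<sigma> J" and \<sigma>: "\<sigma> \<ge> 0"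
    and int: "integrable lborel (\<lambda>x. J (of_real x))"
    and w: "w \<ge> \<sigma>"
  shows "(\<integral>x. J (of_real x) * of_real (sin (w * x)) \<partial>lborel) = 0"
proof -
  obtain M where M: "M > 0" "\<And>z. norm (J z) \<le> M * exp (\<sigma> * \<bar>Im z\<bar>)"
    using exp_type_bound_of_integrable[OF hol type \<sigma> int] by blast
  have plus: "(\<integral>x. J (of_real x) * exp (\<i> * of_real w * of_real x) \<partial>lborel) = 0"
    by (rule Fourier_integral_zero[OF hol M int w])
  \<comment> \<open>Negative frequencies come from the reflected function J(-z).\<close>
  have "(\<integral>x. J (- of_real x) * exp (\<i> * of_real w * of_real x) \<partial>lborel) = 0"
  proof (rule Fourier_integral_zero[of "\<lambda>z. J (- z)"])
    show "(\<lambda>z. J (- z)) holomorphic_on UNIV"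
      by (rule holomorphic_on_compose_gen[OF _ hol, unfolded o_def]) (auto intro!: holomorphic_intros)
    show "norm (J (- z)) \<le> M * exp (\<sigma> * \<bar>Im z\<bar>)" for z using M(2)[of "- z"] by simp
    show "integrable lborel (\<lambda>x. J (- of_real x))"
      using lborel_integrable_real_affine[OF int, of "-1" 0] by simp
  qed (use M w in auto)
  then have minus: "(\<integral>x. J (of_real x) * exp (- (\<i> * of_real w * of_real x)) \<partial>lborel) = 0"
    using lborel_integral_real_affine[of "-1" "\<lambda>x. J (of_real x) * exp (- (\<i> * of_real w * of_real x))" 0] by simp
  have i: "integrable lborel (\<lambda>x. J (of_real x) * exp (\<i> * of_real w * of_real x))"
    "integrable lborel (\<lambda>x. J (of_real x) * exp (- (\<i> * of_real w * of_real x)))"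
    by (rule Bochner_Integration.integrable_bound[OF int]; use int in \<open>auto simp: norm_mult\<close>)+
  have "J (of_real x) * of_real (sin (w * x)) = (J (of_real x) * exp (\<i> * of_real w * of_real x) - J (of_real x) * exp (- (\<i> * of_real w * of_real x))) / (2 * \<i>)" for x
    by (simp add: sin_of_real[symmetric] sin_exp_eq field_simps)
  then show ?thesis using plus minus by (simp add: Bochner_Integration.integral_diff[OF i])
qed

section \<open>Uniqueness of interpolation\<close>

text \<open>From |sin(pi z)|^2 = (cosh(2 pi Im z) - cos(2 pi Re z))/2. The hypothesis describes
  points at height at least 1 and vertical lines with half-integer real part; together they contain
  the boundaries of the boxes used in \<open>exp_type_pi_zero\<close>.\<close>

lemma norm_sin_pi_ge:
  assumes "\<bar>Im z\<bar> \<ge> 1 \<or> cos (2 * pi * Re z) = -1"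
  shows "exp (pi * \<bar>Im z\<bar>) / 4 \<le> norm (sin (of_real pi * z))"
proof -
  define t where "t = pi * \<bar>Im z\<bar>"
  have n: "(norm (sin (of_real pi * z)))\<^sup>2 = (exp (2 * (pi * Im z)) + inverse (exp (2 * (pi * Im z))) - 2 * cos (2 * pi * Re z)) / 4"
    by (simp add: norm_sin_squared mult.assoc)
  have e: "exp (2 * (pi * Im z)) + inverse (exp (2 * (pi * Im z))) = exp (2 * t) + inverse (exp (2 * t))"
    unfolding t_def by (cases "Im z \<ge> 0") (auto simp: exp_minus add.commute)
  have "(exp t / 4)\<^sup>2 \<le> (norm (sin (of_real pi * z)))\<^sup>2"
  proof -
    have sq: "(exp t / 4)\<^sup>2 = exp (2 * t) / 16" by (simp add: power_divide exp_double)
    have i: "inverse (exp (2 * t)) > 0" by simp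
    show ?thesis
    proof (cases "cos (2 * pi * Re z) = -1")
      case True
      have "exp (2 * t) / 16 \<le> (exp (2 * t) + inverse (exp (2 * t)) - 2 * (-1)) / 4"
      proof -
        have "E / 16 \<le> (E + I - 2 * (-1)) / 4" if "E > 0" "I > 0" for E I :: real
          using that by simp
        then show ?thesis using i exp_gt_zero by blast
      qed
      then show ?thesis unfolding n e sq True .
    next
      case False
      then have "\<bar>Im z\<bar> \<ge> 1" using assms by simp
      then have "t \<ge> pi * 1" unfolding t_def by (intro mult_left_mono) auto
      then have "2 * t \<ge> 3" using pi_gt3 by linarith
      then have "exp (2 * t) \<ge> 4" using exp_ge_add_one_self[of "2*t"] by linarith
      then have "exp (2 * t) / 16 \<le> (exp (2 * t) + inverse (exp (2 * t)) - 2 * cos (2 * pi * Re z)) / 4"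
      proof -
        have "E / 16 \<le> (E + I - 2 * c) / 4" if "E \<ge> 4" "I > 0" "c \<le> 1" for E I c :: real
          using that by simp
        then show ?thesis using i cos_le_one \<open>exp (2 * t) \<ge> 4\<close> by blast
      qed
      then show ?thesis unfolding n e sq .
    qed
  qed
  then show ?thesis unfolding t_def by (rule power2_le_imp_le) simp
qed

lemma integrable_dyadic_tendsto_0:
  fixes f :: "real \<Rightarrow> real"
  assumes "integrable lborel f"
  shows "(\<lambda>n. LINT x:{real n..2 * real n}|lborel. f x) \<longlonglongrightarrow> 0"
proof -
  have "(\<lambda>n. LINT x:{real n..2 * real n}|lborel. f x) \<longlonglongrightarrow> (\<integral>x. 0 \<partial>(lborel :: real measure))"
    unfolding set_lebesgue_integral_def
  proof (rule integral_dominated_convergence[where w = "\<lambda>x. norm (f x)"])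
    show "AE x in lborel. (\<lambda>n. indicator {real n..2 * real n} x *\<^sub>R f x) \<longlonglongrightarrow> 0"
    proof (rule AE_I2)
      fix x :: real
      have "eventually (\<lambda>n. 0 = indicator {real n..2 * real n} x *\<^sub>R f x) sequentially"
        using eventually_gt_at_top[of "nat \<lceil>\<bar>x\<bar>\<rceil>"]
      proof eventually_elim
        case (elim n)
        then have "x < real n" by linarith
        then show ?case by (simp add: indicator_def)
      qed
      then show "(\<lambda>n. indicator {real n..2 * real n} x *\<^sub>R f x) \<longlonglongrightarrow> 0"
        by (rule Lim_transform_eventually[OF tendsto_const])
    qed
  qed (use assms in \<open>auto simp: indicator_def\<close>)
  then show ?thesis by simp
qed

text \<open>Every interval [n, 2n] contributes at least c/4: on it 1/x >= 1/(2n), and the integral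
  of sin^2 over it is n/2. For an integrable function these contributions tend to 0.\<close>

lemma not_integrable_sin_over:
  fixes f :: "real \<Rightarrow> complex"
  assumes int: "integrable lborel f"
    and c: "c > 0" and le: "\<And>x. x \<ge> R \<Longrightarrow> c * (sin (pi * x))\<^sup>2 / x \<le> norm (f x)"
  shows False
proof -
  have "eventually (\<lambda>n. c / 4 \<le> (LINT x:{real n..2 * real n}|lborel. norm (f x))) sequentially"
    using eventually_ge_at_top[of "nat \<lceil>R\<rceil>"] eventually_gt_at_top[of 0]
  proof eventually_elim
    case (elim n)
    then have n: "real n \<ge> R" "real n > 0" by linarith+
    let ?s = "\<lambda>x. c / (2 * real n) * (sin (pi * x))\<^sup>2"
    let ?F = "\<lambda>x. c / (2 * real n) * (x / 2 - sin (2 * pi * x) / (4 * pi))"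
    have si: "set_integrable lborel {real n..2 * real n} ?s"
      using n by (intro borel_integrable_atLeastAtMost' continuous_intros) auto
    have "(?s has_integral ?F (2 * real n) - ?F (real n)) {real n..2 * real n}"
    proof (rule fundamental_theorem_of_calculus)
      fix x :: real
      have "(?F has_real_derivative c / (2 * real n) * (1/2 - cos (2 * pi * x) / 2)) (at x within {real n..2 * real n})"
        by (intro DERIV_cmult) (auto intro!: derivative_eq_intros)
      also have "1/2 - cos (2 * pi * x) / 2 = (sin (pi * x))\<^sup>2"
        using cos_double_sin[of "pi * x"] by (simp add: mult.assoc diff_divide_distrib)
      finally show "(?F has_vector_derivative ?s x) (at x within {real n..2 * real n})"
        by (simp add: has_real_derivative_iff_has_vector_derivative)
    qed simp
    moreover have "sin (2 * pi * (2 * real n)) = 0" "sin (2 * pi * real n) = 0"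
      using sin_npi2[of "4 * n"] sin_npi2[of "2 * n"] by (simp_all add: mult_ac)
    ultimately have "(?s has_integral c / 4) {real n..2 * real n}"
      using n by (simp add: field_simps)
    then have "c / 4 = (LINT x:{real n..2 * real n}|lborel. ?s x)"
      using si by (simp only: set_borel_integral_eq_integral(2)[OF si] integral_unique)
    also have "\<dots> \<le> (LINT x:{real n..2 * real n}|lborel. norm (f x))"
    proof (rule set_integral_mono[OF si])
      show "set_integrable lborel {real n..2 * real n} (\<lambda>x. norm (f x))"
        unfolding set_integrable_def using int by (intro integrable_mult_indicator integrable_norm) auto
      fix x assume x: "x \<in> {real n..2 * real n}"
      have "?s x = c * (sin (pi * x))\<^sup>2 / (2 * real n)" by simp
      also have "\<dots> \<le> c * (sin (pi * x))\<^sup>2 / x"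
        using x n c by (intro divide_left_mono) auto
      also have "\<dots> \<le> norm (f x)" using le x n by simp
      finally show "?s x \<le> norm (f x)" .
    qed
    finally show ?case .
  qed
  then have "c / 4 \<le> 0"
    by (rule tendsto_lowerbound[OF integrable_dyadic_tendsto_0[OF integrable_norm[OF int]]]) simp
  then show False using c by simp
qed

text \<open>A zero at 0 is not assumed because G+ jumps there and K(0) is not determined; the factor
  z in \<open>f\<close> makes up for it and costs one power of growth. In the affine case J(x) = (a
  + b x) sin(pi x)/x, which is integrable only for a = b = 0.\<close>

lemma exp_type_pi_zero:
  assumes hol: "J holomorphic_on UNIV" and type: "exp_type_le pi J"
    and int: "integrable lborel (\<lambda>x. J (of_real x))"
    and zero: "\<And>n::int. n \<noteq> 0 \<Longrightarrow> J (of_int n) = 0"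
  shows "J = (\<lambda>z. 0)"
proof -
  obtain M where M: "M > 0" "\<And>z. norm (J z) \<le> M * exp (pi * \<bar>Im z\<bar>)"
    using exp_type_bound_of_integrable[OF hol type _ int] by auto
  define f where "f z = z * J z / sin (of_real pi * z)" for z
  define L where "L = remove_sings f"
  have s0: "sin (of_real pi * z) \<noteq> 0" if "z \<notin> \<int>" for z :: complex
    using that by (auto simp: sin_eq_0 Ints_def)
  have opI: "open (- \<int> :: complex set)" by (simp add: open_Compl closed_Ints)
  have holf: "f holomorphic_on - \<int>" unfolding f_def
    by (intro holomorphic_intros holomorphic_on_subset[OF hol]) (auto simp: s0)
  have anf: "f analytic_on {z}" if "z \<notin> \<int>" for z
    using holf opI that by (metis ComplI analytic_on_open analytic_on_subset empty_subsetI insert_subset)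
  have anL: "L analytic_on {z}" for z
  proof (cases "z \<in> \<int>")
    case False
    then show ?thesis unfolding L_def by (intro remove_sings_analytic_on anf)
  next
    case True
    then obtain n where n: "z = of_int n" by (auto simp: Ints_def)
    have iso: "isolated_singularity_at f z"
      unfolding isolated_singularity_at_def
    proof (intro exI[of _ 1] conjI)
      have "ball z 1 - {z} \<subseteq> - \<int>"
      proof
        fix w assume w: "w \<in> ball z 1 - {z}"
        have "w \<notin> \<int>"
        proof
          assume "w \<in> \<int>"
          then obtain m where m: "w = of_int m" by (auto simp: Ints_def)
          have "norm (of_int (n - m) :: complex) < 1" using w by (simp add: n m dist_norm)
          then have "\<bar>n - m\<bar> < 1" by (metis norm_of_int of_int_less_1_iff of_int_abs)
          then show False using w n m by auto
        qed
        then show "w \<in> - \<int>" by simp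
      qed
      then show "f analytic_on ball z 1 - {z}"
        using holf opI by (metis analytic_on_open analytic_on_subset)
    qed simp
    have Jd: "((\<lambda>w. w * J w) has_field_derivative deriv (\<lambda>w. w * J w) z) (at z)"
      by (rule holomorphic_derivI[of _ UNIV]) (auto intro!: holomorphic_intros hol)
    have zz: "z * J z = 0" using zero[of n] by (cases "n = 0") (auto simp: n)
    have sz: "sin (of_real pi * z) = 0" using sin_eq_0[of "of_real pi * z"] by (auto simp: n)
    have cz: "cos (of_real pi * z) \<noteq> 0"
      using sz sin_cos_squared_add[of "of_real pi * z"] by auto
    have "((\<lambda>w. sin (of_real pi * w)) has_field_derivative of_real pi * cos (of_real pi * z)) (at z)"
      by (auto intro!: derivative_eq_intros)
    then have "(\<lambda>w. (sin (of_real pi * w) - sin (of_real pi * z)) / (w - z)) \<midarrow>z\<rightarrow> of_real pi * cos (of_real pi * z)"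
      by (simp only: has_field_derivative_iff)
    moreover have "(\<lambda>w. (w * J w - z * J z) / (w - z)) \<midarrow>z\<rightarrow> deriv (\<lambda>w. w * J w) z"
      using Jd by (simp only: has_field_derivative_iff)
    \<comment> \<open>Numerator and denominator both vanish at the integer z and the zero of the
      sine is simple, so a quotient of difference quotients gives the removable value.\<close>
    ultimately have "(\<lambda>w. ((w * J w - z * J z) / (w - z)) / ((sin (of_real pi * w) - sin (of_real pi * z)) / (w - z))) \<midarrow>z\<rightarrow>
        deriv (\<lambda>w. w * J w) z / (of_real pi * cos (of_real pi * z))"
      using cz by (intro tendsto_divide) auto
    then have "f \<midarrow>z\<rightarrow> deriv (\<lambda>w. w * J w) z / (of_real pi * cos (of_real pi * z))"
    proof (rule Lim_transform_eventually)
      show "eventually (\<lambda>w. ((w * J w - z * J z) / (w - z)) / ((sin (of_real pi * w) - sin (of_real pi * z)) / (w - z)) = f w) (at z)"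
        using eventually_neq_at_within[of z z UNIV]
        by eventually_elim (simp only: zz sz diff_zero f_def, simp)
    qed
    then show ?thesis unfolding L_def by (rule remove_sings_analytic_at[OF iso])
  qed
  have holL: "L holomorphic_on UNIV"
    using anL analytic_on_analytic_at analytic_imp_holomorphic by blast
  have Lf: "L z = f z" if "z \<notin> \<int>" for z using anf[OF that] by (simp add: L_def)
  have bound1: "norm (L z) \<le> 4 * M * norm z" if "\<bar>Im z\<bar> \<ge> 1 \<or> cos (2 * pi * Re z) = -1" for z
  proof -
    note s = norm_sin_pi_ge[OF that]
    have sn: "sin (of_real pi * z) \<noteq> 0" using s exp_gt_zero[of "pi * \<bar>Im z\<bar>"] by (metis divide_pos_pos norm_zero not_le zero_less_numeral)
    then have "z \<notin> \<int>" by (auto simp: sin_eq_0 Ints_def)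
    then have "norm (L z) = norm (z * J z) / norm (sin (of_real pi * z))" by (simp add: Lf f_def norm_divide)
    also have "\<dots> \<le> (norm z * (M * exp (pi * \<bar>Im z\<bar>))) / (exp (pi * \<bar>Im z\<bar>) / 4)"
      using M s by (intro frac_le) (auto simp: norm_mult intro!: mult_left_mono)
    finally show ?thesis by (simp add: mult_ac)
  qed
  have bound: "norm (L z) \<le> 4 * M * (norm z + 4)" for z
  proof (cases "\<bar>Im z\<bar> \<ge> 1")
    case True
    then have "norm (L z) \<le> 4 * M * norm z" using bound1 by blast
    also have "\<dots> \<le> 4 * M * (norm z + 4)" using M by (intro mult_left_mono) auto
    finally show ?thesis .
  next
    case False
    \<comment> \<open>The box has half-integer vertical sides and horizontal sides at height 1 and
      -1, so \<open>bound1\<close> holds on its whole boundary. Boundary points lie within distance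
      4 of z, which is the 4 in \<open>bound\<close>.\<close>
    define m where "m = \<lfloor>Re z\<rfloor>"
    let ?a = "Complex (of_int m - 1/2) (-1)" and ?b = "Complex (of_int m + 3/2) 1"
    have zin: "z \<in> cbox ?a ?b" using False unfolding m_def in_cbox_complex_iff by (simp, linarith)
    show ?thesis
    proof (rule maximum_modulus_frontier[OF _ _ _ _ zin])
      fix w assume w: "w \<in> frontier (cbox ?a ?b)"
      have wc: "w \<in> cbox ?a ?b" using w by (simp add: frontier_def closure_closed closed_cbox)
      have wb: "w \<notin> box ?a ?b" using w by (simp add: frontier_def interior_cbox)
      have "\<bar>Im w\<bar> \<ge> 1 \<or> cos (2 * pi * Re w) = -1"
      proof (rule ccontr)
        assume *: "\<not> ?thesis"
        have "Re w \<noteq> of_int m - 1/2" "Re w \<noteq> of_int m + 3/2"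
        proof -
          have "cos (2 * pi * (of_int k + 1/2)) = -1" for k :: int
          proof -
            have "2 * pi * (of_int k + 1/2) = pi + (2 * pi) * of_int k" by (simp add: algebra_simps)
            then show ?thesis by (simp only: cos_add cos_int_2pin sin_int_2pin cos_pi sin_pi mult_1_right mult_zero_left diff_zero)
          qed
          from this[of "m - 1"] this[of "m + 1"] * show "Re w \<noteq> of_int m - 1/2" "Re w \<noteq> of_int m + 3/2"
            by (auto simp: add.commute)
        qed
        then show False using wb wc * unfolding in_cbox_complex_iff in_box_complex_iff by auto
      qed
      then have "norm (L w) \<le> 4 * M * norm w" by (rule bound1)
      also have "norm w \<le> norm z + 4"
      proof -
        have "norm (w - z) \<le> \<bar>Re (w - z)\<bar> + \<bar>Im (w - z)\<bar>" by (rule cmod_le)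
        moreover have "\<bar>Re (w - z)\<bar> \<le> 2" "\<bar>Im (w - z)\<bar> \<le> 2"
          using wc zin unfolding in_cbox_complex_iff by auto
        ultimately show ?thesis using norm_triangle_sub[of w z] by linarith
      qed
      then have "4 * M * norm w \<le> 4 * M * (norm z + 4)" using M by (intro mult_left_mono) auto
      finally show "norm (L w) \<le> 4 * M * (norm z + 4)" .
    qed (use holL in \<open>auto intro: holomorphic_on_subset holomorphic_on_imp_continuous_on\<close>)
  qed
  have bound20: "norm (L z) \<le> 20 * M * norm z ^ 1" if "1 \<le> norm z" for z
  proof -
    have "4 * M * (norm z + 4) \<le> 4 * M * (5 * norm z)" using M that by (intro mult_left_mono) auto
    then show ?thesis using bound[of z] by simp
  qed
  define a b where "a = L 0" and "b = deriv L 0"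
  have ab: "L z = a + b * z" for z
  proof -
    have "L z = (\<Sum>k\<le>1. (deriv ^^ k) L 0 / fact k * z ^ k)"
      by (rule Liouville_polynomial[where A = 1 and B = "20 * M" and n = 1, OF holL bound20])
    also have "\<dots> = a + b * z" by (simp add: a_def b_def)
    finally show ?thesis .
  qed
  have eq: "z * J z = (a + b * z) * sin (of_real pi * z)" if "z \<notin> \<int>" for z
    using Lf[OF that] s0[OF that] ab[of z] by (simp add: f_def field_simps)
  have eqr: "of_real x * J (of_real x) = (a + b * of_real x) * of_real (sin (pi * x))" for x :: real
  proof (cases "x \<in> \<int>")
    case True
    then obtain n where n: "x = of_int n" by (auto simp: Ints_def)
    have "sin (pi * x) = 0" using sin_zero_iff_int2[of "pi * x"] by (auto simp: n)
    moreover have "of_real x * J (of_real x) = 0" using zero[of n] by (cases "n = 0") (auto simp: n)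
    ultimately show ?thesis by simp
  next
    case False
    then show ?thesis using eq[of "of_real x"] by (simp flip: sin_of_real)
  qed
  have ab0: "a = 0 \<and> b = 0"
  proof (rule ccontr)
    assume nz: "\<not> ?thesis"
    obtain c R where c: "c > 0" "R \<ge> 1" "\<And>x. x \<ge> R \<Longrightarrow> c \<le> norm (a + b * of_real x)"
    proof (cases "b = 0")
      case True
      then show ?thesis using nz by (intro that[of "norm a" 1]) auto
    next
      case False
      show ?thesis
      proof (rule that[of 1 "max 1 ((norm a + 1) / norm b)"])
        fix x assume x: "x \<ge> max 1 ((norm a + 1) / norm b)"
        then have "norm a + 1 \<le> norm b * x" using False by (simp add: divide_le_eq mult.commute)
        also have "\<dots> = norm (b * of_real x)" using x by (simp add: norm_mult)
        finally show "1 \<le> norm (a + b * of_real x)"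
          using norm_triangle_ineq2[of "b * of_real x" "- a"] by (simp add: add.commute)
      qed auto
    qed
    show False
    proof (rule not_integrable_sin_over[OF int c(1)])
      fix x assume x: "x \<ge> R"
      then have x0: "x > 0" using c by simp
      have "norm (of_real x * J (of_real x)) = norm (a + b * of_real x) * \<bar>sin (pi * x)\<bar>"
        unfolding eqr by (simp add: norm_mult)
      then have nJ: "norm (J (of_real x)) = norm (a + b * of_real x) * \<bar>sin (pi * x)\<bar> / x"
        using x0 by (simp add: norm_mult field_simps)
      have "(sin (pi * x))\<^sup>2 \<le> \<bar>sin (pi * x)\<bar>"
        by (metis abs_sin_le_one abs_ge_zero mult_left_le power2_abs power2_eq_square)
      then have "c * (sin (pi * x))\<^sup>2 \<le> norm (a + b * of_real x) * \<bar>sin (pi * x)\<bar>"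
        using c(1) c(3)[OF x] by (intro mult_mono) auto
      then show "c * (sin (pi * x))\<^sup>2 / x \<le> norm (J (of_real x))"
        unfolding nJ using x0 by (intro divide_right_mono) auto
    qed
  qed
  have Jz: "J z = 0" if "z \<notin> \<int>" for z
    using eq[OF that] ab0 that by auto
  show ?thesis
  proof
    fix z
    show "J z = 0"
    proof (cases "z = 0")
      case False
      show ?thesis
      proof (cases "z \<in> \<int>")
        case True
        then obtain n where "z = of_int n" by (auto simp: Ints_def)
        then show ?thesis using zero[of n] False by auto
      qed (rule Jz)
    next
      case z: True
      have "isCont J 0" using holomorphic_on_imp_continuous_on[OF hol]
        by (simp add: continuous_on_eq_continuous_at)
      then have "J \<midarrow>0\<rightarrow> J 0" by (simp add: isCont_def)
      \<comment> \<open>J vanishes off the integers, hence near 0 except possibly at 0 itself;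
        continuity supplies the value there.\<close>
      moreover have "J \<midarrow>0\<rightarrow> 0"
      proof (rule Lim_transform_eventually[OF tendsto_const])
        have "eventually (\<lambda>w. w \<in> ball 0 1 - {0}) (at (0::complex))"
          by (intro eventually_at_in_open) auto
        then show "eventually (\<lambda>w. 0 = J w) (at 0)"
        proof eventually_elim
          case (elim w)
          have "w \<notin> \<int>"
          proof
            assume "w \<in> \<int>"
            then obtain k where k: "w = of_int k" by (auto simp: Ints_def)
            have "norm (of_int k :: complex) < 1" using elim k by simp
            then have "\<bar>k\<bar> < 1" by (metis norm_of_int of_int_less_1_iff of_int_abs)
            then show False using elim k by auto
          qed
          then show ?case using Jz by simp
        qed
      qed
      ultimately show ?thesis using z LIM_unique by blast
    qed
  qed
qed

section \<open>The square wave\<close>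

text \<open>Abel means of the sine series of (pi/4) sgn(sin t). For r < 1 the coefficients decay
  geometrically, so the series may be integrated term by term.\<close>

definition abel_wave :: "real \<Rightarrow> real \<Rightarrow> real" where
  "abel_wave r t = (\<Sum>k. r ^ (2*k+1) / real (2*k+1) * sin (real (2*k+1) * t))"

lemma summable_odd_power_over:
  fixes r :: real assumes "0 \<le> r" "r < 1" shows "summable (\<lambda>k. r ^ (2*k+1) / real (2*k+1))"
proof (rule summable_comparison_test')
  show "summable (\<lambda>k. r ^ k)" using assms by (intro summable_geometric) auto
  show "norm (r ^ (2*k+1) / real (2*k+1)) \<le> r ^ k" for k
  proof -
    have "r ^ (2*k+1) / real (2*k+1) \<le> r ^ (2*k+1) / 1" using assms by (intro frac_le) auto
    also have "\<dots> \<le> r ^ k" using assms by (simp only: div_by_1, intro power_decreasing) auto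
    finally show ?thesis using assms by (simp add: abs_mult)
  qed
qed

text \<open>With w = r exp(it) this is the imaginary part of artanh w, obtained from the
  \<open>Arctan\<close> series at i w.\<close>

lemma abel_wave_eq:
  assumes r: "0 \<le> r" "r < 1"
  shows "abel_wave r t = Im (Ln ((1 + of_real r * cis t) / (1 - of_real r * cis t))) / 2"
proof -
  define w where "w = of_real r * cis t"
  have nw: "norm (\<i> * w) < 1" using r by (simp add: w_def norm_mult)
  have "(\<lambda>n. - \<i> * ((-1)^n / of_nat (2*n+1) * (\<i> * w)^(2*n+1))) sums (- \<i> * Arctan (\<i> * w))"
    by (intro sums_mult Arctan_series(2)[OF nw])
  moreover have "- \<i> * ((-1)^n / of_nat (2*n+1) * (\<i> * w)^(2*n+1)) = w ^ (2*n+1) / of_nat (2*n+1)" for n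
  proof -
    have "\<i> ^ (2*n+1) = \<i> * (-1) ^ n" by (simp add: power_mult)
    then have "(\<i> * w)^(2*n+1) = \<i> * (-1) ^ n * w ^ (2*n+1)" by (simp only: power_mult_distrib)
    then have "- \<i> * ((-1)^n / of_nat (2*n+1) * (\<i> * w)^(2*n+1)) = ((-1)^n * (-1)^n) * (w ^ (2*n+1) / of_nat (2*n+1))"
      by (simp only:) (simp add: mult_ac)
    then show ?thesis by (simp add: power_mult_distrib[symmetric])
  qed
  moreover have "- \<i> * Arctan (\<i> * w) = Ln ((1 + w) / (1 - w)) / 2"
    by (simp add: Arctan_def mult.assoc[symmetric])
  ultimately have "(\<lambda>n. w ^ (2*n+1) / of_nat (2*n+1)) sums (Ln ((1 + w) / (1 - w)) / 2)" by (simp only:)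
  then have "(\<lambda>n. Im (w ^ (2*n+1) / of_nat (2*n+1))) sums Im (Ln ((1 + w) / (1 - w)) / 2)"
    by (rule sums_Im)
  moreover have "Im (w ^ (2*n+1) / of_nat (2*n+1)) = r ^ (2*n+1) / real (2*n+1) * sin (real (2*n+1) * t)" for n
  proof -
    have "w ^ (2*n+1) = of_real (r ^ (2*n+1)) * cis (real (2*n+1) * t)"
      unfolding w_def power_mult_distrib Complex.DeMoivre of_real_power ..
    then have "w ^ (2*n+1) / of_nat (2*n+1) = of_real (r ^ (2*n+1) / real (2*n+1)) * cis (real (2*n+1) * t)"
      by (simp del: power_Suc of_nat_Suc of_nat_add)
    then show ?thesis
      by (simp only: times_complex.sel Re_complex_of_real Im_complex_of_real cis.sel mult_zero_left add_0_right)
  qed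
  ultimately show ?thesis unfolding abel_wave_def w_def[symmetric] by (simp add: sums_iff)
qed

text \<open>The Cayley map (1 + w)/(1 - w) sends the unit disc to the right half plane, so its
  argument stays below pi/2 in modulus. The bound is independent of r and supplies the dominating
  function.\<close>

lemma abel_wave_bound:
  assumes r: "0 \<le> r" "r < 1"
  shows "\<bar>abel_wave r t\<bar> \<le> pi / 4"
proof -
  define w where "w = of_real r * cis t"
  have nw: "norm w < 1" using r by (simp add: w_def norm_mult)
  have w1: "1 - w \<noteq> 0" using nw by auto
  have "Re ((1 + w) / (1 - w)) = Re ((1 + w) * cnj (1 - w)) / (norm (1 - w))\<^sup>2"
    by (subst complex_div_cnj) (simp only: Re_divide_of_real of_real_power[symmetric])
  also have "Re ((1 + w) * cnj (1 - w)) = 1 - (norm w)\<^sup>2"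
    unfolding cmod_power2 by (simp add: algebra_simps power2_eq_square)
  also have "(1 - (norm w)\<^sup>2) / (norm (1 - w))\<^sup>2 > 0"
    using nw w1 by (simp add: power_less_one_iff abs_square_less_1)
  finally have "\<bar>Im (Ln ((1 + w) / (1 - w)))\<bar> < pi / 2" by (rule Re_Ln_pos_lt_imp)
  then show ?thesis unfolding abel_wave_eq[OF r] w_def[symmetric] by simp
qed

text \<open>At r = 1 the Cayley map gives i cot(t/2), a point of the imaginary axis on the side
  determined by the sign of sin t, and \<open>Ln\<close> is continuous there. At the zeros of sin t
  every term of the series vanishes.\<close>

lemma abel_wave_limit:
  assumes r: "\<And>n. 0 \<le> r n" "\<And>n. r n < 1" "r \<longlonglongrightarrow> 1"
  shows "(\<lambda>n. abel_wave (r n) t) \<longlonglongrightarrow> pi / 4 * sgn (sin t)"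
proof (cases "sin t = 0")
  case True
  have "abel_wave s t = 0" for s
  proof -
    have "sin (real k * t) = 0" for k
    proof (induction k)
      case (Suc k)
      then show ?case using True by (simp add: distrib_right sin_add)
    qed simp
    then show ?thesis unfolding abel_wave_def by (simp del: of_nat_add of_nat_Suc)
  qed
  then show ?thesis using True by simp
next
  case False
  define u where "u = cis t"
  have u1: "1 - u \<noteq> 0"
  proof
    assume "1 - u = 0" then have "Im u = 0" by simp
    then show False using False by (simp add: u_def)
  qed
  define c where "c = sin t / (1 - cos t)"
  have ct: "1 - cos t > 0"
  proof -
    have "cos t \<noteq> 1" using False cos_one_sin_zero by blast
    then show ?thesis using cos_le_one[of t] by linarith
  qed
  have "c * (1 - cos t) = sin t" using ct by (simp add: c_def)
  moreover have "c * sin t = 1 + cos t"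
  proof -
    have "sin t * sin t = (1 - cos t) * (1 + cos t)" using sin_cos_squared_add3[of t] by (simp add: algebra_simps)
    then show ?thesis using ct by (simp add: c_def)
  qed
  ultimately have "\<i> * of_real c * (1 - u) = 1 + u"
    by (simp add: complex_eq_iff u_def)
  then have q: "(1 + u) / (1 - u) = \<i> * of_real c" using u1 by (simp add: divide_eq_eq)
  have c0: "c \<noteq> 0" "sgn c = sgn (sin t)" using False ct by (auto simp: c_def sgn_divide)
  have "(\<lambda>n. Im (Ln ((1 + of_real (r n) * u) / (1 - of_real (r n) * u))) / 2) \<longlonglongrightarrow> Im (Ln ((1 + of_real 1 * u) / (1 - of_real 1 * u))) / 2"
  proof (intro tendsto_intros r isCont_tendsto_compose[of _ Ln] continuous_at_Ln)
    show "1 - of_real 1 * u \<noteq> 0" using u1 by simp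
    show "(1 + of_real 1 * u) / (1 - of_real 1 * u) \<notin> \<real>\<^sub>\<le>\<^sub>0"
      using q c0 by (auto simp: complex_nonpos_Reals_iff)
  qed simp
  moreover have "Im (Ln ((1 + of_real 1 * u) / (1 - of_real 1 * u))) / 2 = pi / 4 * sgn (sin t)"
  proof (cases "c > 0")
    case True
    then have "Im (Ln (\<i> * of_real c)) = pi / 2" by (subst Im_Ln_eq_pi_half) auto
    then show ?thesis using q c0 True by simp
  next
    case f: False
    then have "c < 0" using c0 by simp
    then have "Im (Ln (\<i> * of_real c)) = - pi / 2" by (subst Im_Ln_eq_pi_half) auto
    then show ?thesis using q c0 \<open>c < 0\<close> by (simp flip: c0(2))
  qed
  ultimately show ?thesis unfolding abel_wave_eq[OF r(1,2)] u_def by (simp only:)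
qed

text \<open>Abel means take the place of Fourier partial sums: sum and integral commute for each r <
  1 by absolute convergence, and the uniform bound pi/4 on the means justifies r -> 1.\<close>

lemma square_wave_integral_limit:
  fixes f :: "real \<Rightarrow> complex"
  assumes f: "integrable lborel f"
    and r: "\<And>n. 0 \<le> r n" "\<And>n. r n < 1" "r \<longlonglongrightarrow> 1"
  shows "(\<lambda>n. \<Sum>k. of_real (r n ^ (2*k+1) / real (2*k+1)) * (\<integral>x. f x * of_real (sin (real (2*k+1) * pi * x)) \<partial>lborel))
      \<longlonglongrightarrow> (\<integral>x. f x * of_real (pi / 4 * sgn (sin (pi * x))) \<partial>lborel)"
proof -
  let ?S = "\<lambda>k x. complex_of_real (sin (real (2*k+1) * pi * x))"
  let ?c = "\<lambda>n k. r n ^ (2*k+1) / real (2*k+1)"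
  have fs: "integrable lborel (\<lambda>x. f x * of_real (sin (c * x)))" for c
    by (rule Bochner_Integration.integrable_bound[OF f]) (use f in \<open>auto simp: norm_mult mult_left_le\<close>)
  have eq: "(\<Sum>k. of_real (?c n k) * (\<integral>x. f x * ?S k x \<partial>lborel))
     = (\<integral>x. f x * of_real (abel_wave (r n) (pi * x)) \<partial>lborel)" for n
  proof -
    let ?g = "\<lambda>k x. of_real (?c n k) * (f x * ?S k x)"
    have sc: "summable (?c n)" using summable_odd_power_over[OF r(1,2)] .
    have nn: "norm (?g k x) \<le> ?c n k * norm (f x)" for k x
    proof -
      have "norm (?g k x) = ?c n k * (norm (f x) * \<bar>sin (real (2*k+1) * pi * x)\<bar>)"
        using r(1)[of n] by (simp add: norm_mult norm_divide norm_power del: of_nat_Suc of_nat_add power_Suc)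
      also have "\<dots> \<le> ?c n k * (norm (f x) * 1)"
        using r(1)[of n] by (intro mult_left_mono) auto
      finally show ?thesis by simp
    qed
    have gi: "integrable lborel (?g k)" for k using fs by (rule integrable_mult_right)
    have "(\<lambda>k. integral\<^sup>L lborel (?g k)) sums (\<integral>x. (\<Sum>k. ?g k x) \<partial>lborel)"
    proof (rule sums_integral)
      show "AE x in lborel. summable (\<lambda>k. norm (?g k x))"
      proof (rule AE_I2)
        fix x
        show "summable (\<lambda>k. norm (?g k x))"
          by (rule summable_comparison_test'[OF summable_mult2[OF sc, of "norm (f x)"]]) (use nn in auto)
      qed
      show "summable (\<lambda>k. \<integral>x. norm (?g k x) \<partial>lborel)"
      proof (rule summable_comparison_test'[OF summable_mult2[OF sc, of "\<integral>x. norm (f x) \<partial>lborel"]])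
        fix k
        have "(\<integral>x. norm (?g k x) \<partial>lborel) \<le> (\<integral>x. ?c n k * norm (f x) \<partial>lborel)"
        proof (rule integral_mono)
          show "integrable lborel (\<lambda>x. norm (?g k x))" using gi by (rule integrable_norm)
          show "integrable lborel (\<lambda>x. ?c n k * norm (f x))" using f by (intro integrable_mult_right integrable_norm)
          show "norm (?g k x) \<le> ?c n k * norm (f x)" for x by (rule nn)
        qed
        also have "\<dots> = ?c n k * (\<integral>x. norm (f x) \<partial>lborel)" by simp
        finally show "norm (\<integral>x. norm (?g k x) \<partial>lborel) \<le> ?c n k * (\<integral>x. norm (f x) \<partial>lborel)"
          by (simp add: Bochner_Integration.integral_nonneg)
      qed
    qed (rule gi)
    moreover have "(\<Sum>k. ?g k x) = f x * of_real (abel_wave (r n) (pi * x))" for x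
    proof -
      let ?s = "\<lambda>k. ?c n k * sin (real (2*k+1) * (pi * x))"
      have ss: "summable ?s"
      proof (rule summable_comparison_test'[OF sc])
        fix k
        have "0 \<le> ?c n k" using r(1)[of n] by simp
        then have "?c n k * \<bar>sin (real (2*k+1) * (pi * x))\<bar> \<le> ?c n k" by (intro mult_left_le) auto
        then show "norm (?s k) \<le> ?c n k" using \<open>0 \<le> ?c n k\<close> by (simp only: real_norm_def abs_mult abs_of_nonneg)
      qed
      have "(\<Sum>k. ?g k x) = (\<Sum>k. f x * of_real (?s k))"
        by (intro suminf_cong) (simp only: of_real_mult mult_ac)
      also have "\<dots> = f x * (\<Sum>k. of_real (?s k))"
        using ss by (intro suminf_mult) (simp only: summable_of_real)
      also have "(\<Sum>k. of_real (?s k)) = (of_real (suminf ?s) :: complex)"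
        using ss by (rule suminf_of_real[symmetric])
      finally show ?thesis unfolding abel_wave_def .
    qed
    moreover have "integral\<^sup>L lborel (?g k) = of_real (?c n k) * (\<integral>x. f x * ?S k x \<partial>lborel)" for k
      by (rule Bochner_Integration.integral_mult_right) (rule fs)
    ultimately show ?thesis by (simp only: sums_iff)
  qed
  show ?thesis unfolding eq
  proof (rule integral_dominated_convergence[where w = "\<lambda>x. norm (f x) * (pi / 4)"])
    show "(\<lambda>x. f x * of_real (abel_wave (r n) (pi * x))) \<in> borel_measurable lborel" for n
      unfolding abel_wave_def using f by measurable
    show "AE x in lborel. (\<lambda>n. f x * of_real (abel_wave (r n) (pi * x))) \<longlonglongrightarrow> f x * of_real (pi / 4 * sgn (sin (pi * x)))"
      by (intro AE_I2 tendsto_intros abel_wave_limit r)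
    show "AE x in lborel. norm (f x * of_real (abel_wave (r n) (pi * x))) \<le> norm (f x) * (pi / 4)" for n
      unfolding norm_mult norm_of_real using abel_wave_bound[OF r(1,2)]
      by (intro AE_I2 mult_left_mono) auto
  qed (use f in auto)
qed

lemma square_wave_orthogonal:
  assumes hol: "J holomorphic_on UNIV" and type: "exp_type_le pi J"
    and int: "integrable lborel (\<lambda>x. J (of_real x))"
  shows "(\<integral>x. J (of_real x) * of_real (sgn (sin (pi * x))) \<partial>lborel) = 0"
proof -
  define r where "r n = 1 - 1 / real (Suc n)" for n
  have r: "0 \<le> r n" "r n < 1" "r \<longlonglongrightarrow> 1" for n
  proof -
    show "r \<longlonglongrightarrow> 1" unfolding r_def by real_asymp
  qed (auto simp: r_def)
  have "(\<integral>x. J (of_real x) * of_real (sin (real (2*k+1) * pi * x)) \<partial>lborel) = 0" for k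
    using sine_integral_zero[OF hol type _ int, of "real (2*k+1) * pi"] by simp
  then have "(\<lambda>n. 0) \<longlonglongrightarrow> (\<integral>x. J (of_real x) * of_real (pi / 4 * sgn (sin (pi * x))) \<partial>lborel)"
    using square_wave_integral_limit[OF int r] by simp
  then have "(\<integral>x. J (of_real x) * of_real (pi / 4 * sgn (sin (pi * x))) \<partial>lborel) = 0"
    by (simp add: LIMSEQ_const_iff)
  moreover have "(\<integral>x. J (of_real x) * of_real (pi / 4 * sgn (sin (pi * x))) \<partial>lborel)
     = (\<integral>x. of_real (pi / 4) * (J (of_real x) * of_real (sgn (sin (pi * x)))) \<partial>lborel)"
    by (simp only: of_real_mult mult_ac)
  ultimately show ?thesis by simp
qed

section \<open>The extremal value as a theta integral\<close>

lemma integrable_trunc_gauss: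
  assumes "lam > 0"
  shows "integrable lborel (trunc_gauss lam)"
proof (rule Bochner_Integration.integrable_bound)
  show "integrable lborel (\<lambda>x. sqrt (1/lam) * normal_density 0 (sqrt (1/(2*pi*lam))) x)"
    using assms by (intro integrable_mult_right integrable_normal_density) auto
  have "exp (- pi * lam * x\<^sup>2) = sqrt (1/lam) * normal_density 0 (sqrt (1/(2*pi*lam))) x" for x
    using assms by (simp add: normal_density_def real_sqrt_mult real_sqrt_divide field_simps)
  moreover have "norm (trunc_gauss lam x) \<le> exp (- pi * lam * x\<^sup>2)" for x
    by (auto simp: trunc_gauss_def)
  ultimately show "AE x in lborel. norm (trunc_gauss lam x) \<le> norm (sqrt (1/lam) * normal_density 0 (sqrt (1/(2*pi*lam))) x)"
    by (intro AE_I2) (metis abs_ge_self order_trans real_norm_def)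
qed (simp add: trunc_gauss_def[abs_def])

(* Shift the contour of exp (- a z^2) to the line Im z = - h, where completing the square
   absorbs the oscillation. *)
lemma trunc_gauss_sine_integral:
  fixes lam c :: real
  assumes lam: "lam > 0"
  defines "a \<equiv> pi * lam"
  defines "h \<equiv> c / (2 * a)"
  shows "(\<integral>x. trunc_gauss lam x * sin (c * x) \<partial>lborel) = h * integral {0..1} (\<lambda>y. exp (- (a * h\<^sup>2 * (1 - y\<^sup>2))))"
proof -
  have a: "a > 0" using lam by (simp add: a_def)
  have c: "c = 2 * a * h" using a by (simp add: h_def)
  define g where "g z = exp (- of_real a * z\<^sup>2)" for z :: complex
  have "g holomorphic_on UNIV" unfolding g_def by (intro holomorphic_intros)
  then obtain P where P: "\<And>z. (P has_field_derivative g z) (at z)" "P 0 = 0" using entire_primitive by blast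
  let ?I = "h * integral {0..1} (\<lambda>y. exp (a * h\<^sup>2 * y\<^sup>2))"
  let ?R = "\<lambda>n. P (of_real (real n) - \<i> * of_real h) - P (of_real (real n))"
  \<comment> \<open>g is real on the real axis, so the real segment adds nothing to the imaginary
    part.\<close>
  have ImP: "Im (P (of_real X)) = 0" if "X \<ge> 0" for X
  proof -
    have "((\<lambda>x. g (of_real x)) has_integral P (of_real X) - P (of_real 0)) {0..X}"
      using that by (intro fundamental_theorem_of_calculus has_vector_derivative_real_field P) auto
    then have "((\<lambda>x. Im (g (of_real x))) has_integral Im (P (of_real X) - P (of_real 0))) {0..X}"
      by (rule has_integral_Im)
    then have "((\<lambda>x. Im (g (of_real x))) has_integral Im (P (of_real X))) {0..X}"
      by (simp only: of_real_0 P(2) diff_zero)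
    moreover have "Im (g (of_real x)) = 0" for x
    proof -
      have "g (of_real x) = of_real (exp (- a * x\<^sup>2))" by (simp add: g_def exp_of_real[symmetric])
      then show ?thesis by simp
    qed
    ultimately have "((\<lambda>x. 0) has_integral Im (P (of_real X))) {0..X}" by simp
    then show ?thesis by (simp add: has_integral_0_eq)
  qed
  \<comment> \<open>On the segment from 0 to -ih the exponent is a h^2 y^2; this side alone carries
    the Dawson integral.\<close>
  have Pih: "P (- \<i> * of_real h) = - \<i> * of_real ?I"
  proof -
    have "((\<lambda>y. g (- \<i> * of_real h * of_real y) * (- \<i> * of_real h)) has_integral P (- \<i> * of_real h * of_real 1) - P (- \<i> * of_real h * of_real 0)) {0..1}"
    proof (rule fundamental_theorem_of_calculus)
      fix y :: real
      have "((\<lambda>z. P (- \<i> * of_real h * z)) has_field_derivative g (- \<i> * of_real h * of_real y) * (- \<i> * of_real h)) (at (of_real y))"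
        by (rule DERIV_chain2[where f=P]) (auto intro!: P derivative_eq_intros)
      then show "((\<lambda>y. P (- \<i> * of_real h * of_real y)) has_vector_derivative g (- \<i> * of_real h * of_real y) * (- \<i> * of_real h)) (at y within {0..1})"
        by (rule has_vector_derivative_real_field)
    qed simp
    moreover have "g (- \<i> * of_real h * of_real y) * (- \<i> * of_real h) = (- \<i> * of_real h) * of_real (exp (a * h\<^sup>2 * y\<^sup>2))" for y
      by (simp add: g_def exp_of_real[symmetric] power_mult_distrib mult_ac)
    ultimately have "((\<lambda>y. (- \<i> * of_real h) * of_real (exp (a * h\<^sup>2 * y\<^sup>2))) has_integral P (- \<i> * of_real h)) {0..1}"
      by (simp only: P(2) of_real_0 mult_zero_right of_real_1 mult_1_right diff_zero)
    moreover have "((\<lambda>y. exp (a * h\<^sup>2 * y\<^sup>2)) has_integral integral {0..1} (\<lambda>y. exp (a * h\<^sup>2 * y\<^sup>2))) {0..1}"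
      by (intro integrable_integral integrable_continuous_interval continuous_intros)
    then have "((\<lambda>y. (- \<i> * of_real h) * of_real (exp (a * h\<^sup>2 * y\<^sup>2))) has_integral (- \<i> * of_real h) * of_real (integral {0..1} (\<lambda>y. exp (a * h\<^sup>2 * y\<^sup>2)))) {0..1}"
      by (intro has_integral_mult_right has_integral_of_real)
    ultimately show ?thesis by (simp only: has_integral_unique of_real_mult mult.assoc)
  qed
  define D where "D = h * integral {0..1} (\<lambda>y. exp (- (a * h\<^sup>2 * (1 - y\<^sup>2))))"
  have D: "D = exp (- (a * h\<^sup>2)) * ?I"
  proof -
    have "exp (- (a * h\<^sup>2 * (1 - y\<^sup>2))) = exp (- (a * h\<^sup>2)) * exp (a * h\<^sup>2 * y\<^sup>2)" for y
      by (simp add: exp_add[symmetric] algebra_simps)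
    then show ?thesis unfolding D_def by simp
  qed
  have trunc: "(LINT x:{-real n..real n}|lborel. trunc_gauss lam x * sin (c * x)) =
      exp (- (a * h\<^sup>2)) * Im (?R n) + D" for n
  proof -
    have "((\<lambda>x. g (of_real x - \<i> * of_real h)) has_integral P (of_real (real n) - \<i> * of_real h) - P (of_real 0 - \<i> * of_real h)) {0..real n}"
    proof (rule fundamental_theorem_of_calculus)
      fix x :: real
      have "((\<lambda>z. P (z - \<i> * of_real h)) has_field_derivative g (of_real x - \<i> * of_real h) * 1) (at (of_real x))"
        by (rule DERIV_chain2[where f=P]) (auto intro!: P derivative_eq_intros)
      then show "((\<lambda>x. P (of_real x - \<i> * of_real h)) has_vector_derivative g (of_real x - \<i> * of_real h)) (at x within {0..real n})"
        by (intro has_vector_derivative_real_field) (simp only: mult_1_right)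
    qed simp
    then have "((\<lambda>x. exp (- (a * h\<^sup>2)) * Im (g (of_real x - \<i> * of_real h))) has_integral
        exp (- (a * h\<^sup>2)) * Im (P (of_real (real n) - \<i> * of_real h) - P (of_real 0 - \<i> * of_real h))) {0..real n}"
      by (intro has_integral_mult_right has_integral_Im)
    moreover have "exp (- (a * h\<^sup>2)) * Im (g (of_real x - \<i> * of_real h)) = exp (- (a * x\<^sup>2)) * sin (c * x)" for x
    proof -
      have "- of_real a * (of_real x - \<i> * of_real h)\<^sup>2 = Complex (a * h\<^sup>2 - a * x\<^sup>2) (c * x)"
        by (simp add: complex_eq_iff c power2_eq_square algebra_simps)
      then have "Im (g (of_real x - \<i> * of_real h)) = exp (a * h\<^sup>2 - a * x\<^sup>2) * sin (c * x)"
        unfolding g_def by (simp add: Im_exp)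
      then show ?thesis by (simp add: mult.assoc[symmetric] exp_add[symmetric])
    qed
    moreover have "Im (P (of_real 0 - \<i> * of_real h)) = - ?I"
      using Pih by simp
    ultimately have I: "((\<lambda>x. exp (- (a * x\<^sup>2)) * sin (c * x)) has_integral
        exp (- (a * h\<^sup>2)) * Im (?R n) + D) {0..real n}"
      using ImP[of "real n"] by (simp add: D algebra_simps)
    have si: "set_integrable lborel {0..real n} (\<lambda>x. exp (- (a * x\<^sup>2)) * sin (c * x))"
      by (intro borel_integrable_atLeastAtMost' continuous_intros)
    have "(LINT x:{0..real n}|lborel. exp (- (a * x\<^sup>2)) * sin (c * x)) =
        exp (- (a * h\<^sup>2)) * Im (?R n) + D"
      by (simp only: set_borel_integral_eq_integral(2)[OF si] integral_unique[OF I])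
    moreover have "(LINT x:{0..real n}|lborel. exp (- (a * x\<^sup>2)) * sin (c * x)) = (LINT x:{-real n..real n}|lborel. trunc_gauss lam x * sin (c * x))"
      unfolding set_lebesgue_integral_def
      by (rule Bochner_Integration.integral_cong) (auto simp: trunc_gauss_def indicator_def a_def)
    ultimately show ?thesis by simp
  qed
  \<comment> \<open>\<open>?R n\<close> is the right-hand vertical side, where Re z = n, so it
    decays like exp(-a n^2).\<close>
  have P0: "(\<lambda>n. ?R n) \<longlonglongrightarrow> 0"
  proof (rule Lim_null_comparison)
    show "(\<lambda>n. exp (a * h\<^sup>2 - a * (real n)\<^sup>2) * \<bar>h\<bar>) \<longlonglongrightarrow> 0" using a by real_asymp
    show "eventually (\<lambda>n. norm (?R n) \<le> exp (a * h\<^sup>2 - a * (real n)\<^sup>2) * \<bar>h\<bar>) sequentially"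
    proof (rule always_eventually, rule allI)
    fix n :: nat
    let ?S = "closed_segment (of_real (real n)) (of_real (real n) - \<i> * of_real h)"
    have "norm (?R n) \<le>
        exp (a * h\<^sup>2 - a * (real n)\<^sup>2) * norm ((of_real (real n) - \<i> * of_real h) - of_real (real n) :: complex)"
    proof (rule field_differentiable_bound[of ?S])
      fix z assume "z \<in> ?S"
      then obtain u where u: "0 \<le> u" "u \<le> 1" "z = (1 - u) *\<^sub>R of_real (real n) + u *\<^sub>R (of_real (real n) - \<i> * of_real h)"
        unfolding in_segment by blast
      show "(P has_field_derivative g z) (at z within ?S)" using P(1) by (rule has_field_derivative_at_within)
      have z: "Re z = real n" "Im z = - (u * h)" unfolding u(3) by (simp_all add: algebra_simps)
      have "u\<^sup>2 \<le> 1" using u by (simp add: power_le_one)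
      then have "a * (u\<^sup>2 * h\<^sup>2) \<le> a * (1 * h\<^sup>2)" using a by (intro mult_left_mono mult_right_mono) auto
      then show "norm (g z) \<le> exp (a * h\<^sup>2 - a * (real n)\<^sup>2)"
        unfolding g_def norm_exp_eq_Re by (simp add: z power2_eq_square algebra_simps)
    qed auto
    then show "norm (?R n) \<le> exp (a * h\<^sup>2 - a * (real n)\<^sup>2) * \<bar>h\<bar>"
      by (simp add: norm_mult)
    qed
  qed
  have "(\<lambda>n. exp (- (a * h\<^sup>2)) * Im (?R n) + D) \<longlonglongrightarrow> exp (- (a * h\<^sup>2)) * Im 0 + D"
    by (intro tendsto_add tendsto_mult tendsto_const tendsto_Im P0)
  then have "(\<lambda>n. LINT x:{-real n..real n}|lborel. trunc_gauss lam x * sin (c * x)) \<longlonglongrightarrow> D" unfolding trunc by simp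
  moreover have "(\<lambda>n. LINT x:{-real n..real n}|lborel. trunc_gauss lam x * sin (c * x)) \<longlonglongrightarrow> (\<integral>x. trunc_gauss lam x * sin (c * x) \<partial>lborel)"
    by (rule integral_tendsto_truncated, rule Bochner_Integration.integrable_bound[OF integrable_trunc_gauss[OF lam]])
       (auto simp: abs_mult mult_left_le trunc_gauss_def[abs_def])
  ultimately show ?thesis unfolding D_def by (rule LIMSEQ_unique[rotated])
qed


text \<open>For B > 0 this is D(sqrt B)/sqrt B with the Dawson function D(s), that is, exp(-s^2)
  times the integral of exp(v^2) over [0, s]. The form over [0, 1] keeps the variable y of the theta
  integral.\<close>

definition gauss_weight :: "real \<Rightarrow> real" where
  "gauss_weight B = integral {0..1} (\<lambda>y. exp (- (B * (1 - y\<^sup>2))))"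

lemma has_integral_gauss_weight:
  "((\<lambda>y. exp (- (B * (1 - y\<^sup>2)))) has_integral gauss_weight B) {0..1}"
  unfolding gauss_weight_def
  by (intro integrable_integral integrable_continuous_interval continuous_intros)

text \<open>On [0, 1] one has y^2 <= y, and the integral of exp(-B (1 - y)) is explicit. The decay
  1/B suffices because B will grow like k^2.\<close>

lemma gauss_weight_bounds:
  assumes "B > 0"
  shows "0 \<le> gauss_weight B" "gauss_weight B \<le> 1 / B"
proof -
  show "0 \<le> gauss_weight B" by (rule has_integral_nonneg[OF has_integral_gauss_weight]) auto
  have "((\<lambda>y. exp (- (B * (1 - y)))) has_integral exp (- (B * (1 - 1))) / B - exp (- (B * (1 - 0))) / B) {0..1}"
    using assms
    by (intro fundamental_theorem_of_calculus)
       (auto simp: has_real_derivative_iff_has_vector_derivative[symmetric] intro!: derivative_eq_intros)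
  then have "gauss_weight B \<le> exp (- (B * (1 - 1))) / B - exp (- (B * (1 - 0))) / B"
  proof (rule has_integral_le[OF has_integral_gauss_weight])
    fix y :: real assume "y \<in> {0..1}"
    then have "y\<^sup>2 \<le> y" by (simp add: power2_eq_square mult_left_le)
    then show "exp (- (B * (1 - y\<^sup>2))) \<le> exp (- (B * (1 - y)))" using assms by simp
  qed
  also have "\<dots> \<le> 1 / B" using assms by simp
  finally show "gauss_weight B \<le> 1 / B" .
qed

lemma summable_gauss_weight:
  assumes "lam > 0"
  shows "summable (\<lambda>k. gauss_weight (pi * (real k + 1/2)\<^sup>2 / lam))"
proof -
  have B: "pi * (real k + 1/2)\<^sup>2 / lam > 0" for k
    using assms by (intro divide_pos_pos mult_pos_pos zero_less_power) auto
  show ?thesis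
  proof (rule summable_comparison_test'[where N=1])
    show "summable (\<lambda>k. lam / pi * inverse (real k ^ 2))"
      by (intro summable_mult inverse_power_summable) auto
    fix k :: nat assume k: "k \<ge> 1"
    have "norm (gauss_weight (pi * (real k + 1/2)\<^sup>2 / lam)) \<le> 1 / (pi * (real k + 1/2)\<^sup>2 / lam)"
      using gauss_weight_bounds[OF B] by simp
    also have "\<dots> = lam / (pi * (real k + 1/2)\<^sup>2)" by simp
    also have "\<dots> \<le> lam / (pi * (real k)\<^sup>2)"
      using assms k by (intro divide_left_mono mult_left_mono power_mono mult_pos_pos zero_less_power) auto
    finally show "norm (gauss_weight (pi * (real k + 1/2)\<^sup>2 / lam)) \<le> lam / pi * inverse (real k ^ 2)"
      by (simp add: inverse_eq_divide)
  qed
qed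

text \<open>The sine integral carries the factor 2k + 1, which cancels the Fourier coefficient 1/(2k
  + 1). Convergence therefore rests on \<open>summable_gauss_weight\<close>, which yields the
  Tannery majorant for r -> 1. The constant is 4/pi from the square wave times 1/(2 lam) from the
  sine integral.\<close>

lemma trunc_gauss_square_wave_integral:
  assumes lam: "lam > 0"
  shows "(\<integral>x. trunc_gauss lam x * sgn (sin (pi * x)) \<partial>lborel) = 2 / (pi * lam) * (\<Sum>k. gauss_weight (pi * (real k + 1/2)\<^sup>2 / lam))"
proof -
  let ?I = "\<integral>x. complex_of_real (trunc_gauss lam x) * of_real (pi / 4 * sgn (sin (pi * x))) \<partial>lborel"
  let ?J = "\<lambda>k. \<integral>x. complex_of_real (trunc_gauss lam x) * of_real (sin (real (2*k+1) * pi * x)) \<partial>lborel"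
  define E where "E k = gauss_weight (pi * (real k + 1/2)\<^sup>2 / lam)" for k
  have E0: "E k \<ge> 0" for k
    unfolding E_def using lam by (intro gauss_weight_bounds(1) divide_pos_pos mult_pos_pos zero_less_power) auto
  have sE: "summable E" unfolding E_def by (rule summable_gauss_weight[OF lam])
  define r where "r n = 1 - 1 / real (Suc n)" for n
  have r: "0 \<le> r n" "r n < 1" "r \<longlonglongrightarrow> 1" for n
  proof -
    show "r \<longlonglongrightarrow> 1" unfolding r_def by real_asymp
  qed (auto simp: r_def)
  have coeff: "of_real (r n ^ (2*k+1) / real (2*k+1)) * ?J k
      = (of_real (r n ^ (2*k+1) * (E k / (2 * lam))) :: complex)" for n k
  proof -
    have h: "real (2*k+1) * pi / (2 * (pi * lam)) = real (2*k+1) / (2 * lam)" by simp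
    have b: "pi * lam * (real (2*k+1) / (2 * lam))\<^sup>2 = pi * (real k + 1/2)\<^sup>2 / lam"
      using lam by (simp add: field_simps power2_eq_square)
    have "?J k =
       (of_real (\<integral>x. trunc_gauss lam x * sin (real (2*k+1) * pi * x) \<partial>lborel) :: complex)"
      unfolding of_real_mult[symmetric] by (rule integral_complex_of_real)
    also have "\<dots> = of_real (real (2*k+1) / (2 * lam) * E k)"
      unfolding trunc_gauss_sine_integral[OF lam] h b E_def gauss_weight_def ..
    finally have "of_real (r n ^ (2*k+1) / real (2*k+1)) * ?J k =
      (of_real (r n ^ (2*k+1) / real (2*k+1) * (real (2*k+1) / (2 * lam) * E k)) :: complex)"
      by (simp only: of_real_mult)
    also have "r n ^ (2*k+1) / real (2*k+1) * (real (2*k+1) / (2 * lam) * E k) = r n ^ (2*k+1) * (E k / (2 * lam))"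
      by (simp del: of_nat_Suc of_nat_add power_Suc)
    finally show ?thesis .
  qed
  have "(\<lambda>n. \<Sum>k. (of_real (r n ^ (2*k+1) * (E k / (2 * lam))) :: complex)) \<longlonglongrightarrow> ?I"
    using square_wave_integral_limit[of "\<lambda>x. of_real (trunc_gauss lam x)", OF _ r] integrable_trunc_gauss[OF lam]
    unfolding coeff by simp
  moreover have "(\<lambda>n. \<Sum>k. (of_real (r n ^ (2*k+1) * (E k / (2 * lam))) :: complex)) \<longlonglongrightarrow> (\<Sum>k. of_real (E k / (2 * lam)))"
  proof (rule tannerys_theorem[THEN conjunct2, THEN conjunct2])
    fix k
    have "(\<lambda>n. of_real (r n ^ (2*k+1) * (E k / (2 * lam)))) \<longlonglongrightarrow> (of_real (1 ^ (2*k+1) * (E k / (2 * lam))) :: complex)"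
      by (intro tendsto_intros r)
    then show "(\<lambda>n. of_real (r n ^ (2*k+1) * (E k / (2 * lam)))) \<longlonglongrightarrow> (of_real (E k / (2 * lam)) :: complex)" by simp
  next
    have "norm (of_real (r n ^ (2*k+1) * (E k / (2 * lam))) :: complex) \<le> E k / (2 * lam)" for n k
    proof -
      have "r n ^ (2*k+1) * (E k / (2 * lam)) \<le> 1 * (E k / (2 * lam))"
        using r(1)[of n] r(2)[of n] E0[of k] lam by (intro mult_right_mono power_le_one) auto
      then show ?thesis unfolding norm_of_real using r(1)[of n] E0[of k] lam by simp
    qed
    then show "eventually (\<lambda>(k,n). norm (of_real (r n ^ (2*k+1) * (E k / (2 * lam))) :: complex) \<le> E k / (2 * lam)) (at_top \<times>\<^sub>F sequentially)"
      by (intro always_eventually) (simp only: split_paired_All prod.case HOL.simp_thms)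
    show "summable (\<lambda>k. E k / (2 * lam))" using sE by (rule summable_divide)
  qed auto
  ultimately have "?I = (\<Sum>k. of_real (E k / (2 * lam)) :: complex)"
    by (rule LIMSEQ_unique)
  also have "\<dots> = of_real (\<Sum>k. E k / (2 * lam))"
    using summable_divide[OF sE] by (rule suminf_of_real[symmetric])
  also have "?I
     = (of_real (\<integral>x. trunc_gauss lam x * (pi / 4 * sgn (sin (pi * x))) \<partial>lborel) :: complex)"
    unfolding of_real_mult[symmetric] by (rule integral_complex_of_real)
  finally have "(\<integral>x. trunc_gauss lam x * (pi / 4 * sgn (sin (pi * x))) \<partial>lborel) = (\<Sum>k. E k / (2 * lam))"
    by (simp only: of_real_eq_iff)
  also have "\<dots> = suminf E / (2 * lam)" using sE by (rule suminf_divide)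
  also have "(\<integral>x. trunc_gauss lam x * (pi / 4 * sgn (sin (pi * x))) \<partial>lborel) = (\<integral>x. pi / 4 * (trunc_gauss lam x * sgn (sin (pi * x))) \<partial>lborel)"
    by (simp only: mult_ac)
  also have "\<dots> = pi / 4 * (\<integral>x. trunc_gauss lam x * sgn (sin (pi * x)) \<partial>lborel)" by simp
  finally show ?thesis using lam unfolding E_def by (simp add: field_simps)
qed

text \<open>The exponent (n + 1/2)^2 is invariant under n -> -n - 1, which exchanges the nonnegative
  and the negative integers; hence the factor 2 and a one-sided series.\<close>

lemma theta1_zero:
  assumes t: "t > 0"
  shows "theta1 0 (\<i> * of_real t) = of_real (2 * (\<Sum>k. exp (- (pi * t * (real k + 1/2)\<^sup>2))))"
    and "summable (\<lambda>k. exp (- (pi * t * (real k + 1/2)\<^sup>2)))"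
proof -
  let ?e = "\<lambda>k. exp (- (pi * t * (real k + 1/2)\<^sup>2))"
  let ?f = "\<lambda>n::int. of_real (exp (- (pi * t * (of_int n + 1/2)\<^sup>2))) :: complex"
  show s: "summable ?e"
  proof (rule summable_comparison_test')
    show "summable (\<lambda>k. exp (- (pi * t)) ^ k)" using t by (intro summable_geometric) auto
    fix k :: nat
    have "real k \<le> (real k + 1/2)\<^sup>2" by (simp add: power2_eq_square algebra_simps)
    then have "pi * t * real k \<le> pi * t * (real k + 1/2)\<^sup>2" using t by (intro mult_left_mono) auto
    then show "norm (?e k) \<le> exp (- (pi * t)) ^ k"
      by (simp add: exp_of_nat_mult[symmetric] mult.commute)
  qed
  have e: "exp (of_real pi * \<i> * (\<i> * of_real t) * (of_int n + 1/2)\<^sup>2) * exp ((2 * of_int n + 1) * of_real pi * \<i> * 0) = ?f n" for n :: int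
  proof -
    have "of_real pi * \<i> * (\<i> * of_real t) * (of_int n + 1/2)\<^sup>2 = (of_real (- (pi * t * (of_int n + 1/2)\<^sup>2)) :: complex)"
      by (simp add: mult.assoc[symmetric]) (simp add: mult_ac)
    then show ?thesis by (simp only: exp_of_real mult_zero_right exp_zero mult_1_right)
  qed
  have hs: "((\<lambda>k. of_real (?e k) :: complex) has_sum of_real (suminf ?e)) UNIV"
    using s by (intro norm_summable_imp_has_sum sums_of_real summable_sums) simp_all
  have "(?f has_sum of_real (suminf ?e)) (int ` UNIV)"
    by (subst has_sum_reindex) (use hs in \<open>simp_all add: o_def\<close>)
  moreover have "(?f has_sum of_real (suminf ?e)) ((\<lambda>k. - int k - 1) ` UNIV)"
  proof (subst has_sum_reindex)
    have "(- real k - 1 + 1/2)\<^sup>2 = (real k + 1/2)\<^sup>2" for k by (simp add: power2_eq_square algebra_simps)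
    then show "(?f \<circ> (\<lambda>k. - int k - 1) has_sum of_real (suminf ?e)) UNIV"
      using hs by (simp only: o_def of_int_diff of_int_minus of_int_of_nat_eq of_int_1)
  qed (auto simp: inj_on_def)
  moreover have "int ` UNIV \<inter> (\<lambda>k. - int k - 1) ` UNIV = {}" by auto
  ultimately have "(?f has_sum (of_real (suminf ?e) + of_real (suminf ?e))) (int ` UNIV \<union> (\<lambda>k. - int k - 1) ` UNIV)"
    by (rule has_sum_Un_disjoint)
  moreover have "int ` UNIV \<union> (\<lambda>k. - int k - 1) ` UNIV = UNIV"
  proof -
    have "n \<in> int ` UNIV \<union> (\<lambda>k. - int k - 1) ` UNIV" for n
    proof (cases "n \<ge> 0")
      case True
      then have "n = int (nat n)" by simp
      then show ?thesis by blast
    next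
      case False
      then have "n = - int (nat (- n - 1)) - 1" by simp
      then show ?thesis by blast
    qed
    then show ?thesis by blast
  qed
  ultimately have "(?f has_sum (of_real (2 * suminf ?e))) UNIV" by simp
  then show "theta1 0 (\<i> * of_real t) = of_real (2 * suminf ?e)"
    unfolding theta1_def e by (rule infsumI)
qed

lemma theta1_integral:
  assumes lam: "lam > 0"
  shows "(LBINT y=0..1. Re (theta1 0 (\<i> * of_real (1 / lam * (1 - y\<^sup>2))))) =
     2 * (\<Sum>k. gauss_weight (pi * (real k + 1/2)\<^sup>2 / lam))"
proof -
  let ?T = "\<lambda>y. Re (theta1 0 (\<i> * of_real (1 / lam * (1 - y\<^sup>2))))"
  let ?B = "\<lambda>k. pi * (real k + 1/2)\<^sup>2 / lam"
  let ?e = "\<lambda>k y. exp (- (?B k * (1 - y\<^sup>2)))"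
  \<comment> \<open>The interval is open because y = 1 means tau = 0, where the theta series
    diverges. The terms are nonnegative with summable integrals, which allows the
    interchange.\<close>
  let ?g = "\<lambda>k y. indicator {0<..<1} y * (2 * ?e k y)"
  have gw: "has_bochner_integral lborel (?g k) (2 * gauss_weight (?B k))" for k
  proof -
    have si: "set_integrable lborel {0<..<1} (?e k)"
      by (rule set_integrable_subset[OF borel_integrable_atLeastAtMost'[of 0 1]]) (use lam in \<open>auto intro!: continuous_intros\<close>)
    have "(LINT y:{0<..<1}|lborel. ?e k y) = integral {0<..<1} (?e k)"
      by (rule set_borel_integral_eq_integral(2)[OF si])
    also have "\<dots> = gauss_weight (?B k)"
      unfolding gauss_weight_def by (rule integral_open_interval_real[symmetric])
    finally have "has_bochner_integral lborel (\<lambda>y. indicator {0<..<1} y *\<^sub>R ?e k y) (gauss_weight (?B k))"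
      using si unfolding set_integrable_def set_lebesgue_integral_def by (simp add: has_bochner_integral_iff)
    then have "has_bochner_integral lborel (\<lambda>y. 2 * (indicator {0<..<1} y *\<^sub>R ?e k y)) (2 * gauss_weight (?B k))"
      by (rule has_bochner_integral_mult_right)
    then show ?thesis by (simp add: mult.left_commute)
  qed
  have th: "indicator {0<..<1} y * ?T y = (\<Sum>k. ?g k y)"
    and sg: "summable (\<lambda>k. norm (?g k y))" for y
  proof -
    show "indicator {0<..<1} y * ?T y = (\<Sum>k. ?g k y)"
    proof (cases "y \<in> {0<..<1}")
      case True
      then have t: "1 / lam * (1 - y\<^sup>2) > 0" using lam by (simp add: power_less_one_iff abs_square_less_1)
      have "pi * (1 / lam * (1 - y\<^sup>2)) * (real k + 1/2)\<^sup>2 = ?B k * (1 - y\<^sup>2)" for k by simp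
      then show ?thesis using theta1_zero[OF t] True by (simp only: Re_complex_of_real indicator_simps mult_1_left suminf_mult)
    qed simp
    show "summable (\<lambda>k. norm (?g k y))"
    proof (cases "y \<in> {0<..<1}")
      case True
      then have t: "1 / lam * (1 - y\<^sup>2) > 0" using lam by (simp add: power_less_one_iff abs_square_less_1)
      have "pi * (1 / lam * (1 - y\<^sup>2)) * (real k + 1/2)\<^sup>2 = ?B k * (1 - y\<^sup>2)" for k by simp
      then have "summable (\<lambda>k. 2 * ?e k y)"
        using summable_mult[OF theta1_zero(2)[OF t], of 2] by (simp only:)
      moreover have "norm (?g k y) = 2 * ?e k y" for k using True by (simp add: abs_mult)
      ultimately show ?thesis by (simp only:)
    qed simp
  qed
  have "(\<lambda>k. integral\<^sup>L lborel (?g k)) sums (\<integral>y. (\<Sum>k. ?g k y) \<partial>lborel)"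
  proof (rule sums_integral)
    show "integrable lborel (?g k)" for k using gw by (rule integrable.intros)
    show "AE y in lborel. summable (\<lambda>k. norm (?g k y))" using sg by simp
    have "norm (?g k y) = ?g k y" for k y by simp
    then have "(\<integral>y. norm (?g k y) \<partial>lborel) = 2 * gauss_weight (?B k)" for k
      using has_bochner_integral_integral_eq[OF gw] by (simp only:)
    then show "summable (\<lambda>k. \<integral>y. norm (?g k y) \<partial>lborel)"
      using summable_mult[OF summable_gauss_weight[OF lam], of 2] by (simp only:)
  qed
  then have "(\<lambda>k. 2 * gauss_weight (?B k)) sums (\<integral>y. indicator {0<..<1} y * ?T y \<partial>lborel)"
    unfolding th has_bochner_integral_integral_eq[OF gw] .
  then have "(\<integral>y. indicator {0<..<1} y * ?T y \<partial>lborel) = (\<Sum>k. 2 * gauss_weight (?B k))"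
    by (simp add: sums_iff)
  also have "\<dots> = 2 * (\<Sum>k. gauss_weight (?B k))"
    by (rule suminf_mult[OF summable_gauss_weight[OF lam]])
  finally show ?thesis
    by (simp add: interval_lebesgue_integral_def set_lebesgue_integral_def zero_ereal_def one_ereal_def)
qed

section \<open>The extremal problem\<close>

lemma zero_on_open_if_AE_zero:
  fixes g :: "real \<Rightarrow> real"
  assumes ae: "AE x in lborel. x \<in> U \<longrightarrow> g x = 0" and U: "open U" and g: "continuous_on U g" and x: "x \<in> U"
  shows "g x = 0"
proof (rule ccontr)
  assume gx: "g x \<noteq> 0"
  have "open (g -` (- {0}) \<inter> U)"
    using g U by (metis continuous_on_open_vimage open_Compl closed_singleton)
  moreover have "x \<in> g -` (- {0}) \<inter> U" using gx x by simp
  ultimately have nn: "\<not> negligible (g -` (- {0}) \<inter> U)" using open_not_negligible by blast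
  obtain N where N: "N \<in> null_sets lborel" "{x \<in> space lborel. \<not> (x \<in> U \<longrightarrow> g x = 0)} \<subseteq> N"
    using ae by (auto simp: eventually_ae_filter)
  have "negligible N" using N(1) negligible_iff_null_sets null_sets_completionI by blast
  moreover have "g -` (- {0}) \<inter> U \<subseteq> N" using N(2) by auto
  ultimately show False using nn negligible_subset by blast
qed

text \<open>The value is (-1)^m, written as a cosine so that negative m are covered.\<close>

lemma sgn_sin_pi:
  assumes "of_int m < x" "x < of_int m + 1"
  shows "sgn (sin (pi * x)) = cos (pi * of_int m)" "\<bar>cos (pi * of_int m)\<bar> = 1"
proof -
  define u where "u = x - of_int m"
  have s0: "sin (pi * of_int m) = 0" by (simp add: sin_zero_iff_int2)
  then have c: "(cos (pi * of_int m))\<^sup>2 = 1" using sin_cos_squared_add[of "pi * of_int m"] by simp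
  then show a: "\<bar>cos (pi * of_int m)\<bar> = 1" by (auto simp: power2_eq_1_iff)
  have "pi * u < pi * 1" using assms by (intro mult_strict_left_mono) (auto simp: u_def)
  moreover have "pi * u > 0" using assms by (simp add: u_def)
  ultimately have su: "sin (pi * u) > 0" by (intro sin_gt_zero) auto
  have "pi * x = pi * of_int m + pi * u" by (simp add: u_def algebra_simps)
  then have "sin (pi * x) = cos (pi * of_int m) * sin (pi * u)" by (simp add: sin_add s0)
  then have "sgn (sin (pi * x)) = sgn (cos (pi * of_int m))" using su by (simp add: sgn_mult)
  also have "\<dots> = cos (pi * of_int m)" using a by (auto simp: sgn_if abs_if split: if_splits)
  finally show "sgn (sin (pi * x)) = cos (pi * of_int m)" .
qed

lemma continuous_trunc_gauss:
  assumes "x \<noteq> 0" shows "isCont (trunc_gauss lam) x"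
proof (cases "x > 0")
  case True
  have "isCont (\<lambda>x. exp (- pi * lam * x\<^sup>2)) x" by (intro continuous_intros)
  moreover have "eventually (\<lambda>y. exp (- pi * lam * y\<^sup>2) = trunc_gauss lam y) (nhds x)"
    using eventually_nhds_in_open[of "{0<..}" x] True
    by (auto simp: trunc_gauss_def elim!: eventually_mono)
  then have "isCont (\<lambda>x. exp (- pi * lam * x\<^sup>2)) x \<longleftrightarrow> isCont (trunc_gauss lam) x" by (rule isCont_cong)
  ultimately show ?thesis by simp
next
  case False
  have "eventually (\<lambda>y. 0 = trunc_gauss lam y) (nhds x)"
    using eventually_nhds_in_open[of "{..<0}" x] False assms
    by (auto simp: trunc_gauss_def elim!: eventually_mono)
  then have "isCont (\<lambda>_. 0 :: real) x \<longleftrightarrow> isCont (trunc_gauss lam) x" by (rule isCont_cong)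
  then show ?thesis by simp
qed

text \<open>The sign of sin(pi x) is constant between integers and \<open>D\<close> is continuous
  off 0, so the almost everywhere identity holds pointwise between integers. At n \<noteq> 0 the two
  one-sided limits give |D(n)| = c Re D(n) = -c Re D(n), hence D(n) = 0. At n = 0 the jump of G+
  breaks this argument.\<close>

lemma interpolation_of_sign_condition:
  assumes hol: "K holomorphic_on UNIV"
    and ae: "AE x in lborel. norm (of_real (trunc_gauss lam x) - K (of_real x)) =
       Re (of_real (trunc_gauss lam x) - K (of_real x)) * sgn (sin (pi * x))"
    and n: "n \<noteq> (0::int)"
  shows "K (of_int n) = of_real (trunc_gauss lam (of_int n))"
proof -
  define D where "D x = of_real (trunc_gauss lam x) - K (of_real x)" for x
  have cD: "isCont D x" if "x \<noteq> 0" for x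
  proof -
    have "continuous_on UNIV (\<lambda>x. K (complex_of_real x))"
      by (rule continuous_on_compose2[OF holomorphic_on_imp_continuous_on[OF hol]]) (auto intro!: continuous_intros)
    then have "isCont (\<lambda>x. K (of_real x)) x"
      by (simp add: continuous_on_eq_continuous_at)
    then show ?thesis unfolding D_def using continuous_trunc_gauss[OF that]
      by (intro continuous_intros)
  qed
  have int: "norm (D x) - Re (D x) * cos (pi * of_int m) = 0" if "x \<in> {of_int m<..<of_int m + 1}" for x and m :: int
  proof (rule zero_on_open_if_AE_zero[where U = "{of_int m<..<of_int m + 1}"
        and g = "\<lambda>x. norm (D x) - Re (D x) * cos (pi * of_int m)"])
    show "AE x in lborel. x \<in> {of_int m<..<of_int m + 1} \<longrightarrow> norm (D x) - Re (D x) * cos (pi * of_int m) = 0"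
      using ae by eventually_elim (auto simp: D_def sgn_sin_pi)
    have "y \<noteq> 0" if "y \<in> {of_int m<..<of_int m + (1::real)}" for y
    proof
      assume "y = 0"
      then have "of_int m < (0::real)" "(0::real) < of_int (m + 1)" using that by auto
      then show False by simp
    qed
    then show "continuous_on {of_int m<..<of_int m + 1} (\<lambda>x. norm (D x) - Re (D x) * cos (pi * of_int m))"
      by (intro continuous_at_imp_continuous_on ballI continuous_intros cD) auto
  qed (use that in auto)
  have Dn: "(D \<longlongrightarrow> D (of_int n)) (at (of_int n))" using cD[of "of_int n"] n by (simp add: isCont_def)
  have lim: "((\<lambda>x. norm (D x) - Re (D x) * c) \<longlongrightarrow> norm (D (of_int n)) - Re (D (of_int n)) * c) (at (of_int n) within S)" for c S
    by (intro tendsto_intros tendsto_within_subset[OF Dn]) auto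
  have "norm (D (of_int n)) - Re (D (of_int n)) * cos (pi * of_int n) = 0"
  proof (rule tendsto_unique[OF _ lim])
    have "eventually (\<lambda>x. x \<in> {of_int n<..<of_int n + 1}) (at_right (of_int n :: real))"
      by (rule eventually_at_right_real) simp
    then have "eventually (\<lambda>x. 0 = norm (D x) - Re (D x) * cos (pi * of_int n)) (at_right (of_int n))"
      by eventually_elim (use int in simp)
    then show "((\<lambda>x. norm (D x) - Re (D x) * cos (pi * of_int n)) \<longlongrightarrow> 0) (at_right (of_int n))"
      by (rule Lim_transform_eventually[OF tendsto_const])
  qed simp
  moreover have "norm (D (of_int n)) - Re (D (of_int n)) * cos (pi * of_int (n - 1)) = 0"
  proof (rule tendsto_unique[OF _ lim])
    have "eventually (\<lambda>x. x \<in> {of_int n - 1<..<of_int n}) (at_left (of_int n :: real))"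
      by (rule eventually_at_left_real) simp
    then have "eventually (\<lambda>x. 0 = norm (D x) - Re (D x) * cos (pi * of_int (n - 1))) (at_left (of_int n))"
    proof eventually_elim
      case (elim x)
      then show ?case using int[of x "n - 1"] by simp
    qed
    then show "((\<lambda>x. norm (D x) - Re (D x) * cos (pi * of_int (n - 1))) \<longlongrightarrow> 0) (at_left (of_int n))"
      by (rule Lim_transform_eventually[OF tendsto_const])
  qed simp
  moreover have "cos (pi * of_int (n - 1)) = - cos (pi * of_int n)"
    by (simp add: right_diff_distrib cos_diff)
  ultimately have "norm (D (of_int n)) = 0" by simp
  then show ?thesis by (simp add: D_def)
qed

text \<open>Integrability of G+ - K forces that of K, and \<open>square_wave_orthogonal\<close>
  removes K. The pairing is thus the same for every competitor at finite distance.\<close>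

lemma sign_integral:
  assumes lam: "lam > 0" and hol: "K holomorphic_on UNIV" and type: "exp_type_le pi K"
    and int: "integrable lborel (\<lambda>x. of_real (trunc_gauss lam x) - K (of_real x))"
  shows "(\<integral>x. Re (of_real (trunc_gauss lam x) - K (of_real x)) * sgn (sin (pi * x)) \<partial>lborel)
     = (\<integral>x. trunc_gauss lam x * sgn (sin (pi * x)) \<partial>lborel)"
proof -
  let ?D = "\<lambda>x. complex_of_real (trunc_gauss lam x) - K (of_real x)" and ?s = "\<lambda>x. sgn (sin (pi * x))"
  have ig: "integrable lborel (\<lambda>x. complex_of_real (trunc_gauss lam x))"
    using integrable_trunc_gauss[OF lam] by simp
  have iK: "integrable lborel (\<lambda>x. K (of_real x))"
    using Bochner_Integration.integrable_diff[OF ig int] by simp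
  have iS: "integrable lborel (\<lambda>x. f x * of_real (?s x))" if "integrable lborel f" for f :: "real \<Rightarrow> complex"
    by (rule Bochner_Integration.integrable_bound[OF that]) (use that in \<open>auto simp: norm_mult abs_sgn_eq\<close>)
  have "(\<integral>x. ?D x * of_real (?s x) \<partial>lborel)
    = (\<integral>x. of_real (trunc_gauss lam x) * of_real (?s x) \<partial>lborel) - (\<integral>x. K (of_real x) * of_real (?s x) \<partial>lborel)"
    unfolding left_diff_distrib by (rule Bochner_Integration.integral_diff[OF iS[OF ig] iS[OF iK]])
  also have "(\<integral>x. K (of_real x) * of_real (?s x) \<partial>lborel) = 0"
    by (rule square_wave_orthogonal[OF hol type iK])
  also have "(\<integral>x. of_real (trunc_gauss lam x) * of_real (?s x) \<partial>lborel) =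
      complex_of_real (\<integral>x. trunc_gauss lam x * ?s x \<partial>lborel)"
    unfolding of_real_mult[symmetric] by (rule integral_complex_of_real)
  finally have "Re (\<integral>x. ?D x * of_real (?s x) \<partial>lborel)
     = (\<integral>x. trunc_gauss lam x * ?s x \<partial>lborel)" by simp
  moreover have "Re (\<integral>x. ?D x * of_real (?s x) \<partial>lborel)
    = (\<integral>x. Re (?D x * of_real (?s x)) \<partial>lborel)"
    by (rule integral_Re[OF iS[OF int], symmetric])
  moreover have "Re (z * of_real c) = Re z * c" for z c by simp
  ultimately show ?thesis by (simp only:)
qed

text \<open>N is an extended nonnegative integral, so competitors at infinite distance are included.
  Only the real part of the error D enters the pairing, through sgn(sin(pi x)) Re D <= |D|; equality
  makes D real with the sign of the sine almost everywhere.\<close>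

lemma L1_distance_ge_iff:
  fixes lam :: real
  assumes lam: "lam > 0" and hol: "K holomorphic_on UNIV" and type: "exp_type_le pi K"
  defines "V \<equiv> (\<integral>x. trunc_gauss lam x * sgn (sin (pi * x)) \<partial>lborel)"
  defines "N \<equiv> (\<integral>\<^sup>+x. ennreal (cmod (of_real (trunc_gauss lam x) - K (of_real x))) \<partial>lborel)"
  shows "N \<ge> ennreal V" "N = ennreal V \<longleftrightarrow> K = gauss_interp lam"
proof -
  let ?D = "\<lambda>K x. complex_of_real (trunc_gauss lam x) - K (of_real x)"
  let ?s = "\<lambda>x. sgn (sin (pi * x))"
  let ?G = "?D (gauss_interp lam)"
  note holG = gauss_interp_holomorphic[OF lam] and typeG = gauss_interp_exp_type[OF lam]
  have ig: "integrable lborel (\<lambda>x. complex_of_real (trunc_gauss lam x))"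
    using integrable_trunc_gauss[OF lam] by simp
  have iG: "integrable lborel (?G)"
    by (rule Bochner_Integration.integrable_diff[OF ig integrable_gauss_interp[OF lam]])
  have aeG: "AE x in lborel. norm (?G x) = Re (?G x) * ?s x"
  proof -
    have "AE x in lborel. x \<notin> (\<int> :: real set)"
      by (intro AE_not_in countable_imp_null_set_lborel) (auto simp: Ints_def)
    then show ?thesis
    proof eventually_elim
      case (elim x)
      define d where "d = trunc_gauss lam x - Re (gauss_interp lam (of_real x))"
      have D: "?G x = of_real d"
        using gauss_interp_real[OF lam, of x] by (simp add: d_def complex_is_Real_iff complex_eq_iff)
      have "sin (pi * x) \<noteq> 0" using elim by (auto simp: sin_zero_iff_int2 Ints_def)
      moreover have "sin (pi * x) * d \<ge> 0" unfolding d_def by (rule gauss_interp_sign[OF lam])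
      ultimately have "\<bar>d\<bar> = d * ?s x" by (auto simp: sgn_if zero_le_mult_iff abs_if)
      then show ?case unfolding D by simp
    qed
  qed
  have VG: "(\<integral>x. norm (?G x) \<partial>lborel) = V"
  proof -
    have "(\<integral>x. norm (?G x) \<partial>lborel) = (\<integral>x. Re (?G x) * ?s x \<partial>lborel)"
    proof (rule integral_cong_AE[OF _ _ aeG])
      note m = borel_measurable_integrable[OF iG]
      show "(\<lambda>x. norm (?G x)) \<in> borel_measurable lborel"
        by (rule borel_measurable_integrable[OF integrable_norm[OF iG]])
      show "(\<lambda>x. Re (?G x) * ?s x) \<in> borel_measurable lborel"
        by (rule borel_measurable_times[OF measurable_compose[OF m borel_measurable_Re]]) measurable
    qed
    then show ?thesis using sign_integral[OF lam holG typeG iG] by (simp add: V_def)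
  qed
  \<comment> \<open>Nonnegativity of V makes \<open>ennreal V\<close> faithful, so that equality of
    extended integrals gives equality of real ones.\<close>
  then have V0: "V \<ge> 0" by (metis Bochner_Integration.integral_nonneg norm_ge_zero)
  have NG: "(\<integral>\<^sup>+x. ennreal (norm (?G x)) \<partial>lborel) = ennreal V"
    using nn_integral_eq_integral[OF integrable_norm[OF iG]] VG by simp
  \<comment> \<open>If N is infinite, the lower bound is trivial and equality is impossible, since
    \<open>ennreal V\<close> is finite.\<close>
  have finite_case: "N \<ge> ennreal V \<and> (N = ennreal V \<longrightarrow> K = gauss_interp lam)" if fin: "N < \<infinity>"
  proof -
    have mK: "(\<lambda>x. K (complex_of_real x)) \<in> borel_measurable lborel"
      by (auto intro!: borel_measurable_continuous_onI continuous_on_compose2[OF holomorphic_on_imp_continuous_on[OF hol]] continuous_intros)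
    have iD: "integrable lborel (?D K)"
    proof (rule integrableI_bounded)
      show "?D K \<in> borel_measurable lborel" using mK ig by auto
      show "(\<integral>\<^sup>+x. ennreal (norm (?D K x)) \<partial>lborel) < \<infinity>" using fin by (simp add: N_def)
    qed
    have NI: "N = ennreal (\<integral>x. norm (?D K x) \<partial>lborel)"
      unfolding N_def by (rule nn_integral_eq_integral[OF integrable_norm[OF iD]]) simp
    have le: "Re (?D K x) * ?s x \<le> norm (?D K x)" for x
    proof -
      have "Re (?D K x) * ?s x \<le> \<bar>Re (?D K x)\<bar> * \<bar>?s x\<bar>" by (metis abs_ge_self abs_mult)
      also have "\<dots> \<le> norm (?D K x) * 1" by (intro mult_mono abs_Re_le_cmod) (auto simp: abs_sgn_eq)
      finally show ?thesis by simp
    qed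
    have iRe: "integrable lborel (\<lambda>x. Re (?D K x) * ?s x)"
    proof (rule Bochner_Integration.integrable_bound[OF iD])
      show "(\<lambda>x. Re (?D K x) * ?s x) \<in> borel_measurable lborel"
        by (rule borel_measurable_times[OF measurable_compose[OF borel_measurable_integrable[OF iD] borel_measurable_Re]]) measurable
      show "AE x in lborel. norm (Re (?D K x) * ?s x) \<le> norm (?D K x)"
      proof (rule AE_I2)
        fix x
        have "\<bar>Re (?D K x)\<bar> * \<bar>?s x\<bar> \<le> norm (?D K x) * 1" by (intro mult_mono abs_Re_le_cmod) (auto simp: abs_sgn_eq)
        then show "norm (Re (?D K x) * ?s x) \<le> norm (?D K x)" by (simp only: real_norm_def abs_mult mult_1_right)
      qed
    qed
    have VI: "V = (\<integral>x. Re (?D K x) * ?s x \<partial>lborel)"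
      using sign_integral[OF lam hol type iD] by (simp add: V_def)
    also have "\<dots> \<le> (\<integral>x. norm (?D K x) \<partial>lborel)"
      using iRe iD le by (intro integral_mono integrable_norm) auto
    finally have "V \<le> (\<integral>x. norm (?D K x) \<partial>lborel)" .
    then have "N \<ge> ennreal V" unfolding NI by (rule ennreal_leI)
    moreover have "K = gauss_interp lam" if "N = ennreal V"
    proof -
      have "(\<integral>x. norm (?D K x) \<partial>lborel) = V"
        using that V0 unfolding NI by (simp add: Bochner_Integration.integral_nonneg)
      then have "(\<integral>x. norm (?D K x) - Re (?D K x) * ?s x \<partial>lborel) = 0"
        using Bochner_Integration.integral_diff[OF integrable_norm[OF iD] iRe] VI by simp
      then have "AE x in lborel. norm (?D K x) - Re (?D K x) * ?s x = 0"
        using integral_nonneg_eq_0_iff_AE[OF Bochner_Integration.integrable_diff[OF integrable_norm[OF iD] iRe]] le by simp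
      then have aeK: "AE x in lborel. norm (?D K x) = Re (?D K x) * ?s x" by eventually_elim simp
      \<comment> \<open>J is a difference of two integrable errors, and both functions interpolate
        G+ at the nonzero integers.\<close>
      define J where "J z = K z - gauss_interp lam z" for z
      have "J = (\<lambda>z. 0)"
      proof (rule exp_type_pi_zero)
        show "J holomorphic_on UNIV" unfolding J_def using hol holG by (intro holomorphic_intros)
        show "exp_type_le pi J" unfolding J_def using type typeG by (rule exp_type_le_diff)
        show "integrable lborel (\<lambda>x. J (of_real x))"
          using Bochner_Integration.integrable_diff[OF iG iD] by (simp add: J_def)
        show "J (of_int n) = 0" if "n \<noteq> 0" for n :: int
          using interpolation_of_sign_condition[OF hol aeK that] interpolation_of_sign_condition[OF holG aeG that]
          by (simp add: J_def)
      qed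
      then show ?thesis unfolding J_def by (auto simp: fun_eq_iff)
    qed
    ultimately show ?thesis by blast
  qed
  show "N \<ge> ennreal V"
    using finite_case by (cases "N < \<infinity>") (auto simp: not_less top_unique)
  show "N = ennreal V \<longleftrightarrow> K = gauss_interp lam"
  proof
    assume "K = gauss_interp lam"
    then show "N = ennreal V" using NG by (simp add: N_def)
  next
    assume *: "N = ennreal V"
    then have "N < \<infinity>" by simp
    then show "K = gauss_interp lam" using finite_case * by blast
  qed
qed

theorem theorem1:
  fixes lam :: real
  assumes "lam > 0"
  shows "(\<forall>x::real. gauss_interp lam (of_real x) \<in> \<real> \<and>
            sin (pi * x) * (trunc_gauss lam x - Re (gauss_interp lam (of_real x))) \<ge> 0) \<and>
         (\<forall>K :: complex \<Rightarrow> complex. K holomorphic_on UNIV \<longrightarrow> exp_type_le pi K \<longrightarrow>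
            (\<integral>\<^sup>+x. ennreal (cmod (of_real (trunc_gauss lam x) - K (of_real x))) \<partial>lborel)
              \<ge> ennreal (1 / (pi * lam) * (LBINT y=0..1. Re (theta1 0 (\<i> * of_real (1 / lam * (1 - y\<^sup>2)))))) \<and>
            ((\<integral>\<^sup>+x. ennreal (cmod (of_real (trunc_gauss lam x) - K (of_real x))) \<partial>lborel)
              = ennreal (1 / (pi * lam) * (LBINT y=0..1. Re (theta1 0 (\<i> * of_real (1 / lam * (1 - y\<^sup>2))))))
             \<longleftrightarrow> K = gauss_interp lam))"
proof -
  have "1 / (pi * lam) * (LBINT y=0..1. Re (theta1 0 (\<i> * of_real (1 / lam * (1 - y\<^sup>2))))) =
      (\<integral>x. trunc_gauss lam x * sgn (sin (pi * x)) \<partial>lborel)"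
    unfolding theta1_integral[OF assms] trunc_gauss_square_wave_integral[OF assms] by simp
  then show ?thesis
    using gauss_interp_real[OF assms] gauss_interp_sign[OF assms] L1_distance_ge_iff[OF assms] by (simp only:) blast
qed

end
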